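(* Let $T_1,\ldots, T_n \in \mathcal{B}(\mathcal{H})$ be commuting contractions on a complex Hilbert space $\mathcal H$ and let $T=\prod_{i=1}^nT_i$. Then $(T_1,\ldots ,T_n)$ possesses an isometric dilation on the minimal isometric dilation space of $T$, if there are projections $P_1,\ldots ,P_n$ and commuting unitaries $U_1,\ldots ,U_n$ in $\mathcal{B}(\mathcal{D}_T)$ such that the following hold for all $i,j\in\{1, \dots, n\}$: (1) $D_TT_i=P_i^{\perp}U_i^*D_T+P_iU_i^*D_TT$, (2) $P_i^{\perp}U_i^*P_j^{\perp}U_j^*=P_j^{\perp}U_j^*P_i^{\perp}U_i^*$, (3) $U_iP_iU_jP_j=U_jP_jU_iP_i$, (4) $D_TU_iP_iU_i^*D_T=D_{T_i}^2$. Conversely, if $(T_1,\ldots ,T_n)$ possesses an isometric dilation $(\widehat{V}_1,\ldots,\widehat{V}_{n})$ with $V=\prod_{i=1}^n\widehat V_i$ being the minimal isometric dilation of $T$, then there are unique projections $P_1,\ldots ,P_n$ and unique commuting unitaries $U_1,\ldots ,U_n$ in $\mathcal{B}(\mathcal{D}_T)$ satisfying the conditions (1)-(4).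
   Context: All operators are bounded operators on complex Hilbert spaces. A contraction is an operator of norm at most $1$. For a contraction $T$ on $\mathcal H$, $D_T=(I-T^*T)^{1/2}$ is the defect operator and $\mathcal D_T=\overline{\mathrm{Ran}}\,D_T$. Projections are orthogonal projections; for a projection $P$, $P^\perp=I-P$. A commuting tuple of isometries $(V_1,\dots,V_n)$ on a Hilbert space $\mathcal K$ is an isometric dilation of a commuting tuple of contractions $(T_1,\dots,T_n)$ on $\mathcal H$ if $\mathcal H$ is (identified with) a closed subspace of $\mathcal K$ and $T_1^{k_1}\cdots T_n^{k_n}=P_{\mathcal H}(V_1^{k_1}\cdots V_n^{k_n})|_{\mathcal H}$ for all non-negative integers $k_1,\dots,k_n$, where $P_{\mathcal H}:\mathcal K\to\mathcal H$ is the orthogonal projection. An isometric dilation $V$ on $\mathcal K$ of a single contraction $T$ is minimal if $\mathcal K=\overline{\mathrm{Span}}\{V^{k}h: h\in\mathcal H,\ k\in\mathbb N\cup\{0\}\}$; it is unique up to a unitary equivalence, and the space on which it acts is called the minimal isometric dilation space of $T$.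
   Formalization: Uniqueness under (1)-(4) alone fails (H=C, T_1=0, other T_i=1: U_1 is arbitrary); the P_i, U_i are shown to exist with, and to be unique under, the extra conditions U_1…U_n=I and P_1+U_1*P_2U_1+…+U_1*…U_{n-1}*P_nU_{n-1}…U_1=I on D_T. *)

theory Defs
  imports "HOL-Analysis.Analysis"
begin

section \<open>Complex Hilbert spaces\<close>

text \<open>The inner product is linear in its first argument. Definiteness and positivity of
  \<open>cinner x x\<close> follow from the norm axioms of the superclass and \<open>norm_eq_sqrt_cinner\<close>.\<close>

class chilbert_space = banach +
  fixes scaleC :: "complex \<Rightarrow> 'a \<Rightarrow> 'a" (infixr "*\<^sub>C" 75)
    and cinner :: "'a \<Rightarrow> 'a \<Rightarrow> complex"
  assumes scaleC_add_right: "a *\<^sub>C (x + y) = a *\<^sub>C x + a *\<^sub>C y"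
    and scaleC_add_left: "(a + b) *\<^sub>C x = a *\<^sub>C x + b *\<^sub>C x"
    and scaleC_scaleC: "a *\<^sub>C (b *\<^sub>C x) = (a * b) *\<^sub>C x"
    and scaleR_eq_scaleC: "r *\<^sub>R x = complex_of_real r *\<^sub>C x"
    and cinner_commute: "cinner x y = cnj (cinner y x)"
    and cinner_add_left: "cinner (x + y) z = cinner x z + cinner y z"
    and cinner_scaleC_left: "cinner (a *\<^sub>C x) y = a * cinner x y"
    and norm_eq_sqrt_cinner: "norm x = sqrt (Re (cinner x x))"

instantiation complex :: chilbert_space
begin

definition scaleC_complex :: "complex \<Rightarrow> complex \<Rightarrow> complex" where
  "scaleC_complex a x = a * x"

definition cinner_complex :: "complex \<Rightarrow> complex \<Rightarrow> complex" where
  "cinner_complex x y = x * cnj y"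

instance
  by standard
    (auto simp: scaleC_complex_def cinner_complex_def algebra_simps scaleR_conv_of_real
      cmod_def power2_eq_square)

end

definition csubspace :: "'a::chilbert_space set \<Rightarrow> bool" where
  "csubspace S \<longleftrightarrow> 0 \<in> S \<and> (\<forall>x\<in>S. \<forall>y\<in>S. x + y \<in> S) \<and> (\<forall>c. \<forall>x\<in>S. c *\<^sub>C x \<in> S)"

definition closed_csubspace :: "'a::chilbert_space set \<Rightarrow> bool" where
  "closed_csubspace S \<longleftrightarrow> csubspace S \<and> closed S"

definition cspan :: "'a::chilbert_space set \<Rightarrow> 'a set" where
  "cspan A = csubspace hull A"

text \<open>Orthogonal projection of \<open>x\<close> onto a closed subspace \<open>M\<close>.\<close>

definition orth_proj :: "'a::chilbert_space set \<Rightarrow> 'a \<Rightarrow> 'a" where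
  "orth_proj M x = (THE y. y \<in> M \<and> (\<forall>z\<in>M. cinner (x - y) z = 0))"


section \<open>Operators on a closed subspace\<close>

text \<open>An element of \<open>B(S)\<close>, for a closed subspace \<open>S\<close>, is represented by a function on the
  ambient space of which only the values on \<open>S\<close> matter; equality of operators in \<open>B(S)\<close> is
  therefore always equality on \<open>S\<close>. Operators on a whole space have \<open>S = UNIV\<close>.\<close>

definition bounded_op_on :: "'a::chilbert_space set \<Rightarrow> ('a \<Rightarrow> 'a) \<Rightarrow> bool" where
  "bounded_op_on S A \<longleftrightarrow>
     (\<forall>x\<in>S. A x \<in> S) \<and>
     (\<forall>x\<in>S. \<forall>y\<in>S. A (x + y) = A x + A y) \<and>
     (\<forall>c. \<forall>x\<in>S. A (c *\<^sub>C x) = c *\<^sub>C A x) \<and>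
     (\<exists>M. \<forall>x\<in>S. norm (A x) \<le> M * norm x)"

definition adj_on :: "'a::chilbert_space set \<Rightarrow> ('a \<Rightarrow> 'a) \<Rightarrow> 'a \<Rightarrow> 'a" where
  "adj_on S A y = (THE z. z \<in> S \<and> (\<forall>x\<in>S. cinner (A x) y = cinner x z))"

definition projection_on :: "'a::chilbert_space set \<Rightarrow> ('a \<Rightarrow> 'a) \<Rightarrow> bool" where
  "projection_on S P \<longleftrightarrow>
     bounded_op_on S P \<and> (\<forall>x\<in>S. P (P x) = P x) \<and> (\<forall>x\<in>S. adj_on S P x = P x)"

definition perp :: "('a::chilbert_space \<Rightarrow> 'a) \<Rightarrow> 'a \<Rightarrow> 'a" where
  "perp P x = x - P x"

definition isometry_on :: "'a::chilbert_space set \<Rightarrow> ('a \<Rightarrow> 'a) \<Rightarrow> bool" where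
  "isometry_on S V \<longleftrightarrow> bounded_op_on S V \<and> (\<forall>x\<in>S. norm (V x) = norm x)"

definition unitary_on :: "'a::chilbert_space set \<Rightarrow> ('a \<Rightarrow> 'a) \<Rightarrow> bool" where
  "unitary_on S U \<longleftrightarrow>
     bounded_op_on S U \<and> (\<forall>x\<in>S. adj_on S U (U x) = x) \<and> (\<forall>x\<in>S. U (adj_on S U x) = x)"

text \<open>Tuples of operators are families indexed by \<open>{1..n}\<close>.\<close>

definition commuting_on :: "'a::chilbert_space set \<Rightarrow> nat \<Rightarrow> (nat \<Rightarrow> 'a \<Rightarrow> 'a) \<Rightarrow> bool" where
  "commuting_on S n A \<longleftrightarrow> (\<forall>i\<in>{1..n}. \<forall>j\<in>{1..n}. \<forall>x\<in>S. A i (A j x) = A j (A i x))"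

text \<open>\<open>opprod n A = A 1 \<circ> \<dots> \<circ> A n\<close>\<close>

primrec opprod :: "nat \<Rightarrow> (nat \<Rightarrow> 'a \<Rightarrow> 'a) \<Rightarrow> 'a \<Rightarrow> 'a" where
  "opprod 0 A = id"
| "opprod (Suc n) A = opprod n A \<circ> A (Suc n)"


section \<open>Contractions and defect operators\<close>

definition contraction :: "('h::chilbert_space \<Rightarrow> 'h) \<Rightarrow> bool" where
  "contraction T \<longleftrightarrow> bounded_op_on UNIV T \<and> onorm T \<le> 1"

definition positive_op :: "('h::chilbert_space \<Rightarrow> 'h) \<Rightarrow> bool" where
  "positive_op A \<longleftrightarrow>
     bounded_op_on UNIV A \<and> (\<forall>x. Im (cinner (A x) x) = 0 \<and> 0 \<le> Re (cinner (A x) x))"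

text \<open>A positive operator has exactly one positive square root, so the choice is immaterial.\<close>

definition sqrt_op :: "('h::chilbert_space \<Rightarrow> 'h) \<Rightarrow> 'h \<Rightarrow> 'h" where
  "sqrt_op A = (SOME B. positive_op B \<and> (\<forall>x. B (B x) = A x))"

definition defect :: "('h::chilbert_space \<Rightarrow> 'h) \<Rightarrow> 'h \<Rightarrow> 'h" where
  "defect T = sqrt_op (\<lambda>x. x - adj_on UNIV T (T x))"

definition defect_space :: "('h::chilbert_space \<Rightarrow> 'h) \<Rightarrow> 'h set" where
  "defect_space T = closure (range (defect T))"


section \<open>Isometric dilations\<close>

text \<open>The dilation acts on a closed subspace \<open>K\<close> of an arbitrary Hilbert space \<open>'k\<close>, and the
  identification of \<open>'h\<close> with a closed subspace of \<open>K\<close> is a linear isometry \<open>J\<close>. Carriers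
  are needed since the isomorphism type of a dilation space depends on the operators.\<close>

definition embedding_into :: "'k::chilbert_space set \<Rightarrow> ('h::chilbert_space \<Rightarrow> 'k) \<Rightarrow> bool" where
  "embedding_into K J \<longleftrightarrow>
     range J \<subseteq> K \<and> (\<forall>x y. J (x + y) = J x + J y) \<and> (\<forall>c x. J (c *\<^sub>C x) = c *\<^sub>C J x) \<and>
     (\<forall>x. norm (J x) = norm x)"

definition isometric_dilation ::
  "nat \<Rightarrow> (nat \<Rightarrow> 'h::chilbert_space \<Rightarrow> 'h) \<Rightarrow> 'k::chilbert_space set \<Rightarrow> ('h \<Rightarrow> 'k) \<Rightarrow>
   (nat \<Rightarrow> 'k \<Rightarrow> 'k) \<Rightarrow> bool" where
  "isometric_dilation n T K J V \<longleftrightarrow>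
     closed_csubspace K \<and> embedding_into K J \<and>
     (\<forall>i\<in>{1..n}. isometry_on K (V i)) \<and> commuting_on K n V \<and>
     (\<forall>(k :: nat \<Rightarrow> nat) h.
        J (opprod n (\<lambda>i. T i ^^ k i) h) =
        orth_proj (range J) (opprod n (\<lambda>i. V i ^^ k i) (J h)))"

definition minimal_isometric_dilation ::
  "('h::chilbert_space \<Rightarrow> 'h) \<Rightarrow> 'k::chilbert_space set \<Rightarrow> ('h \<Rightarrow> 'k) \<Rightarrow> ('k \<Rightarrow> 'k) \<Rightarrow> bool" where
  "minimal_isometric_dilation T K J V \<longleftrightarrow>
     isometric_dilation 1 (\<lambda>_. T) K J (\<lambda>_. V) \<and>
     K = closure (cspan {(V ^^ k) (J h) | k h. True})"


section \<open>The projections and unitaries on the defect space\<close>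

definition defect_data ::
  "nat \<Rightarrow> (nat \<Rightarrow> 'h::chilbert_space \<Rightarrow> 'h) \<Rightarrow> (nat \<Rightarrow> 'h \<Rightarrow> 'h) \<Rightarrow> (nat \<Rightarrow> 'h \<Rightarrow> 'h) \<Rightarrow> bool" where
  "defect_data n Ts P U \<longleftrightarrow>
     (let T = opprod n Ts; D = defect T; DT = defect_space T; star = adj_on DT in
       (\<forall>i\<in>{1..n}. projection_on DT (P i)) \<and>
       (\<forall>i\<in>{1..n}. unitary_on DT (U i)) \<and> commuting_on DT n U \<and>
       (\<forall>i\<in>{1..n}. \<forall>j\<in>{1..n}.
          (\<forall>h. D (Ts i h) = perp (P i) (star (U i) (D h)) + P i (star (U i) (D (T h)))) \<and>
          (\<forall>x\<in>DT. perp (P i) (star (U i) (perp (P j) (star (U j) x))) =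
                   perp (P j) (star (U j) (perp (P i) (star (U i) x)))) \<and>
          (\<forall>x\<in>DT. U i (P i (U j (P j x))) = U j (P j (U i (P i x)))) \<and>
          (\<forall>h. D (U i (P i (star (U i) (D h)))) = defect (Ts i) (defect (Ts i) h))))"

text \<open>The normalisation
  \<open>U\<^sub>1 \<cdots> U\<^sub>n = I\<close> and
  \<open>P\<^sub>1 + U\<^sub>1\<^sup>* P\<^sub>2 U\<^sub>1 + \<dots> + U\<^sub>1\<^sup>* \<cdots> U\<^sub>n\<^sub>-\<^sub>1\<^sup>* P\<^sub>n U\<^sub>n\<^sub>-\<^sub>1 \<cdots> U\<^sub>1 = I\<close>
  on the defect space. For data as above it is equivalent to
  \<open>\<Prod>\<^sub>i (P\<^sub>i\<^sup>\<bottom> U\<^sub>i\<^sup>* + z P\<^sub>i U\<^sub>i\<^sup>*) = z I\<close>, i.e. it says that the dilation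
  which the data define has as its product the minimal isometric dilation of \<open>T\<close>. Without
  it uniqueness fails: for \<open>T\<^sub>1 = 0\<close> and \<open>T\<^sub>2 = \<dots> = T\<^sub>n = I\<close> on
  \<open>\<complex>\<close>, every unimodular \<open>U\<^sub>1\<close>, together with \<open>P\<^sub>1 = I\<close> and
  \<open>P\<^sub>i = 0\<close>, \<open>U\<^sub>i = I\<close> for \<open>i \<ge> 2\<close>, satisfies \<open>defect_data\<close>.\<close>

definition product_normalised ::
  "nat \<Rightarrow> (nat \<Rightarrow> 'h::chilbert_space \<Rightarrow> 'h) \<Rightarrow> (nat \<Rightarrow> 'h \<Rightarrow> 'h) \<Rightarrow> (nat \<Rightarrow> 'h \<Rightarrow> 'h) \<Rightarrow> bool" where
  "product_normalised n Ts P U \<longleftrightarrow>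
     (let DT = defect_space (opprod n Ts) in
       \<forall>x\<in>DT. opprod n U x = x \<and>
         (\<Sum>k=1..n. opprod (k - 1) (\<lambda>j. adj_on DT (U j)) (P k (opprod (k - 1) U x))) = x)"

end

theory Submission
  imports Defs
begin

text \<open>Let \<open>T = T\<^sub>1 \<cdots> T\<^sub>n\<close> and let \<open>V\<close> on \<open>K\<close> be a minimal isometric
dilation of \<open>T\<close>. The vectors \<open>V h - T h\<close> span a wandering subspace of \<open>V\<close> whose closure is a copy
\<open>L \<D>\<^sub>T\<close> of the defect space, \<open>L (D\<^sub>T h) = V h - T h\<close>, and the orthocomplement of
\<open>\<H>\<close> in \<open>K\<close> is \<open>N = L \<D>\<^sub>T \<oplus> V N\<close>, so that \<open>V\<close> acts on \<open>N\<close> as a unilateral shift.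

Suppose \<open>X Y = Y X = V\<close> with isometries \<open>X\<close>, \<open>Y\<close> that leave \<open>N\<close> invariant. Then \<open>X L\<close> has
degree at most one in \<open>V\<close>: for \<open>x \<in> N\<close> the vector \<open>V V x = X Y V x\<close> is orthogonal to
\<open>X L d\<close>, because \<open>Y V x = V Y x\<close> is orthogonal to \<open>L d\<close>. Thus \<open>X L = L E + V L F\<close> with
operators \<open>E\<close>, \<open>F\<close> on \<open>\<D>\<^sub>T\<close>. The symbol of \<open>Y\<close> then is \<open>F\<^sup>* + z E\<^sup>*\<close>, and comparing
coefficients in \<open>X Y = Y X = V\<close> makes \<open>E + F\<close> unitary and \<open>F F\<^sup>*\<close> a projection. This is the
model of Berger, Coburn and Lebow: with \<open>U\<^sup>* = E + F\<close> and \<open>P = F F\<^sup>*\<close> one has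
\<open>E = P\<^sup>\<bottom> U\<^sup>*\<close> and \<open>F = P U\<^sup>*\<close>. On \<open>\<H>\<close> the factor acts by \<open>X h = S h + L F D\<^sub>T h\<close>,
where \<open>S\<close> is its compression.

Applied to \<open>X = V\<^sub>i\<close> and the product \<open>Y\<close> of the other \<open>V\<^sub>j\<close>, this gives the defect data of a
dilation (\<open>defect_data_of_dilation\<close>): condition (1) is \<open>V\<^sub>i V = V V\<^sub>i\<close> on \<open>\<H>\<close>, condition
(4) is the isometry of \<open>V\<^sub>i\<close> on \<open>\<H>\<close>, and (2), (3) and the commutation of the unitaries are
the coefficients of \<open>V\<^sub>i V\<^sub>j = V\<^sub>j V\<^sub>i\<close>.

Conversely, given data, put \<open>V\<^sub>i (V\<^sup>k h) = V\<^sup>k (T\<^sub>i h + L P\<^sub>i U\<^sub>i\<^sup>* D\<^sub>T h)\<close>. By conditions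
(1) and (4) this preserves inner products, so it extends to an isometry of \<open>K\<close> (\<open>lift_exists\<close>),
and (2), (3) make these isometries commute (\<open>dilation_of_defect_data\<close>).

The two normalisations in \<open>product_normalised\<close> express
\<open>V\<^sub>1 \<cdots> V\<^sub>n = V\<close>: the partial product \<open>V\<^sub>1 \<cdots> V\<^sub>m\<close> has the symbol
\<open>((I - S\<^sub>m) + z S\<^sub>m) U\<^sub>1\<^sup>* \<cdots> U\<^sub>m\<^sup>*\<close> with
\<open>S\<^sub>m = P\<^sub>1 + U\<^sub>1\<^sup>* P\<^sub>2 U\<^sub>1 + \<dots>\<close> (\<open>m\<close> summands), as long as no term of degree two
arises. In one direction this holds because a partial product is itself a factor of \<open>V\<close>, in
the other because projections with sum \<open>I\<close> are mutually orthogonal.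

Finally, normalised data are unique because a dilation with product \<open>V\<close> is unique: if \<open>Y\<close> is
the product of the \<open>V\<^sub>j\<close> with \<open>j \<noteq> i\<close>, then
\<open>\<langle>V\<^sub>i h, V\<^sup>k\<^sup>+\<^sup>1 g\<rangle> = \<langle>V\<^sub>i h, V\<^sub>i Y V\<^sup>k g\<rangle> = \<langle>h, Y V\<^sup>k g\<rangle>\<close> depends on the contractions alone.\<close>

section \<open>Inner product geometry\<close>

lemma cinner_add_right: "cinner x (y + z) = cinner x y + cinner x (z::'a::chilbert_space)"
  by (metis cinner_add_left cinner_commute complex_cnj_add)

lemma cinner_scaleC_right: "cinner x (a *\<^sub>C y) = cnj a * cinner x (y::'a::chilbert_space)"
  by (metis cinner_commute cinner_scaleC_left complex_cnj_mult)

lemma cinner_self: "cinner x x = complex_of_real ((norm (x::'a::chilbert_space))\<^sup>2)"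
proof -
  have 1: "Im (cinner x x) = 0"
    by (metis cinner_commute Reals_cnj_iff complex_is_Real_iff)
  have "sqrt (Re (cinner x x)) \<ge> 0" by (metis norm_eq_sqrt_cinner norm_ge_zero)
  then have "(norm x)\<^sup>2 = Re (cinner x x)"
    by (simp add: norm_eq_sqrt_cinner)
  then show ?thesis using 1 by (simp add: complex_eq_iff)
qed

lemma norm_sq_cinner: "(norm (x::'a::chilbert_space))\<^sup>2 = Re (cinner x x)"
  by (simp add: cinner_self)

lemma norm_scaleC: "norm (a *\<^sub>C x) = cmod a * norm (x::'a::chilbert_space)"
proof -
  have "cinner (a *\<^sub>C x) (a *\<^sub>C x) = of_real ((cmod a * norm x)\<^sup>2)"
    by (simp only: cinner_scaleC_left cinner_scaleC_right cinner_self[of x] power_mult_distrib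
        of_real_mult complex_norm_square mult_ac)
  then have "(norm (a *\<^sub>C x))\<^sup>2 = (cmod a * norm x)\<^sup>2"
    by (metis cinner_self of_real_eq_iff)
  then show ?thesis by (simp add: power2_eq_iff_nonneg)
qed

lemma cinner_Cauchy_Schwarz: "cmod (cinner x y) \<le> norm x * norm (y::'a::chilbert_space)"
proof (cases "y = 0")
  case True
  have "cinner x 0 = 0" using cinner_scaleC_right[of x 0 0]
    by (metis add_cancel_right_right cinner_add_right)
  then show ?thesis using True by simp
next
  case False
  define b where "b = (norm y)\<^sup>2"
  define c where "c = cinner x y"
  have b: "b > 0" using False by (simp add: b_def)
  define z where "z = complex_of_real b *\<^sub>C x + (- c) *\<^sub>C y"
  have yx: "cinner y x = cnj c" unfolding c_def by (rule cinner_commute)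
  have "cinner z z = of_real b * (of_real b * of_real ((norm x)\<^sup>2) - c * cnj c)"
    unfolding z_def
    by (simp add: cinner_add_left cinner_add_right cinner_scaleC_left cinner_scaleC_right
       cinner_self[of x] cinner_self[of y] yx c_def[symmetric] b_def[symmetric] algebra_simps)
  then have "complex_of_real ((norm z)\<^sup>2) = of_real (b * (b * (norm x)\<^sup>2 - (cmod c)\<^sup>2))"
    by (simp only: cinner_self complex_norm_square of_real_mult of_real_diff)
  then have "(norm z)\<^sup>2 = b * (b * (norm x)\<^sup>2 - (cmod c)\<^sup>2)"
    using of_real_eq_iff by blast
  then have "b * (b * (norm x)\<^sup>2 - (cmod c)\<^sup>2) \<ge> 0" by (metis zero_le_power2)
  then have "(cmod c)\<^sup>2 \<le> (norm x * norm y)\<^sup>2"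
    using b by (simp add: zero_le_mult_iff b_def power_mult_distrib mult.commute)
  then show ?thesis unfolding c_def by (simp add: power2_le_iff_abs_le)
qed

lemma bounded_bilinear_cinner:
  "bounded_bilinear (cinner :: 'a::chilbert_space \<Rightarrow> 'a \<Rightarrow> complex)"
proof
  show "\<exists>K. \<forall>a b::'a. norm (cinner a b) \<le> norm a * norm b * K"
    by (intro exI[of _ 1]) (simp add: cinner_Cauchy_Schwarz)
qed (simp_all add: cinner_add_left cinner_add_right scaleR_eq_scaleC cinner_scaleC_left
    cinner_scaleC_right scaleC_complex_def)

interpretation cinner: bounded_bilinear "cinner :: 'a::chilbert_space \<Rightarrow> 'a \<Rightarrow> complex"
  by (rule bounded_bilinear_cinner)

lemma bounded_linear_scaleC: "bounded_linear ((*\<^sub>C) a :: 'a::chilbert_space \<Rightarrow> 'a)"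
proof
  show "\<exists>K. \<forall>x::'a. norm (a *\<^sub>C x) \<le> norm x * K"
    by (intro exI[of _ "cmod a"]) (simp add: norm_scaleC mult.commute)
qed (simp_all add: scaleC_add_right scaleR_eq_scaleC scaleC_scaleC mult.commute)

lemma scaleC_minus_one: "(-1) *\<^sub>C x = - (x::'a::chilbert_space)"
  using scaleR_eq_scaleC[of "-1" x] by simp

lemma scaleC_zero_left: "0 *\<^sub>C x = (0::'a::chilbert_space)"
  using scaleR_eq_scaleC[of "0" x] by simp

lemma scaleC_zero_right: "a *\<^sub>C 0 = (0::'a::chilbert_space)"
  by (metis add_cancel_right_right scaleC_add_right)

lemma scaleC_minus_right: "a *\<^sub>C (- x) = - (a *\<^sub>C (x::'a::chilbert_space))"
  by (metis mult.commute scaleC_minus_one scaleC_scaleC)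

lemma norm_sq_add:
  "(norm (x + y))\<^sup>2 = (norm x)\<^sup>2 + 2 * Re (cinner x y) + (norm (y::'a::chilbert_space))\<^sup>2"
proof -
  have "Re (cinner y x) = Re (cinner x y)"
    by (metis cinner_commute complex_cnj complex.sel(1) complex_surj)
  then show ?thesis by (simp add: norm_sq_cinner cinner.add_left cinner.add_right)
qed

lemma csubspace_zero: "csubspace S \<Longrightarrow> 0 \<in> S"
  and csubspace_add: "csubspace S \<Longrightarrow> x \<in> S \<Longrightarrow> y \<in> S \<Longrightarrow> x + y \<in> S"
  and csubspace_scaleC: "csubspace S \<Longrightarrow> x \<in> S \<Longrightarrow> c *\<^sub>C x \<in> S"
  by (auto simp: csubspace_def)

lemma csubspace_scaleR: "csubspace S \<Longrightarrow> x \<in> S \<Longrightarrow> r *\<^sub>R x \<in> S"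
  by (simp add: scaleR_eq_scaleC csubspace_scaleC)

lemma csubspace_minus: "csubspace S \<Longrightarrow> x \<in> S \<Longrightarrow> - x \<in> S"
  by (metis csubspace_scaleC scaleC_minus_one)

lemma csubspace_diff: "csubspace S \<Longrightarrow> x \<in> S \<Longrightarrow> y \<in> S \<Longrightarrow> x - y \<in> S"
  by (metis csubspace_add csubspace_minus diff_conv_add_uminus)

lemma csubspace_sum: "csubspace S \<Longrightarrow> (\<And>i. i \<in> I \<Longrightarrow> f i \<in> S) \<Longrightarrow> sum f I \<in> S"
  by (induction I rule: infinite_finite_induct) (auto simp: csubspace_zero csubspace_add)

lemma closed_csubspace_UNIV: "closed_csubspace (UNIV::'a::chilbert_space set)"
  by (simp add: closed_csubspace_def csubspace_def)

lemma cinner_ext: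
  assumes "csubspace S" "z \<in> S" "z' \<in> S" "\<And>x. x \<in> S \<Longrightarrow> cinner x z = cinner x z'"
  shows "z = (z'::'a::chilbert_space)"
proof -
  have "cinner (z - z') (z - z') = 0"
    using assms by (simp add: cinner.diff_right csubspace_diff)
  then show ?thesis by (simp add: cinner_self)
qed

lemma cinner_swap: "cinner a b = cinner c d \<Longrightarrow> cinner b a = cinner d (c::'a::chilbert_space)"
  for a b :: "'b::chilbert_space"
  by (metis cinner_commute)

lemma cinner_ext_left:
  assumes "csubspace S" "z \<in> S" "z' \<in> S" "\<And>x. x \<in> S \<Longrightarrow> cinner z x = cinner z' x"
  shows "z = (z'::'a::chilbert_space)"
  by (rule cinner_ext[OF assms(1-3)]) (rule cinner_swap, rule assms(4))

lemma cinner_eq_zero_swap: "cinner a b = 0 \<Longrightarrow> cinner b (a::'a::chilbert_space) = 0"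
  by (metis cinner_commute complex_cnj_zero)

text \<open>Used for an adjoint: \<open>z\<close> is the adjoint applied to \<open>y\<close>, and \<open>w\<close> the operator applied
  to \<open>z\<close>.\<close>

lemma norm_le_by_duality:
  assumes eq: "cinner z z = cinner w y" and w: "norm w \<le> M * norm z" and M: "M \<ge> 0"
  shows "norm (z::'a::chilbert_space) \<le> M * norm (y::'b::chilbert_space)"
proof (cases "z = 0")
  case False
  have "(norm z)\<^sup>2 = cmod (cinner w y)"
    by (metis eq cinner_self norm_of_real abs_of_nonneg zero_le_power2)
  also have "\<dots> \<le> norm w * norm y" by (rule cinner_Cauchy_Schwarz)
  also have "\<dots> \<le> (M * norm z) * norm y" by (intro mult_right_mono w) auto
  finally have "norm z * norm z \<le> norm z * (M * norm y)"
    by (simp add: power2_eq_square mult_ac)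
  then show ?thesis using False by simp
qed (use M in simp)

section \<open>Bounded operators on subspaces\<close>

text \<open>The two spaces may differ, so that the notion covers embeddings and their adjoints; taking
  \<open>complex\<close> as the target it also covers bounded functionals.\<close>

definition blin_on :: "'a::chilbert_space set \<Rightarrow> ('a \<Rightarrow> 'b::chilbert_space) \<Rightarrow> bool" where
  "blin_on S A \<longleftrightarrow>
     (\<forall>x\<in>S. \<forall>y\<in>S. A (x + y) = A x + A y) \<and> (\<forall>c. \<forall>x\<in>S. A (c *\<^sub>C x) = c *\<^sub>C A x) \<and>
     (\<exists>M. \<forall>x\<in>S. norm (A x) \<le> M * norm x)"

lemma bounded_op_on_iff: "bounded_op_on S A \<longleftrightarrow> (\<forall>x\<in>S. A x \<in> S) \<and> blin_on S A"
  by (auto simp: bounded_op_on_def blin_on_def)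

lemma blin_onI:
  assumes "\<And>x y. x \<in> S \<Longrightarrow> y \<in> S \<Longrightarrow> A (x + y) = A x + A y"
    and "\<And>c x. x \<in> S \<Longrightarrow> A (c *\<^sub>C x) = c *\<^sub>C A x"
    and "\<And>x. x \<in> S \<Longrightarrow> norm (A x) \<le> M * norm x"
  shows "blin_on S A"
  using assms unfolding blin_on_def by blast

lemma blin_on_add: "blin_on S A \<Longrightarrow> x \<in> S \<Longrightarrow> y \<in> S \<Longrightarrow> A (x + y) = A x + A y"
  and blin_on_scaleC: "blin_on S A \<Longrightarrow> x \<in> S \<Longrightarrow> A (c *\<^sub>C x) = c *\<^sub>C A x"
  by (auto simp: blin_on_def)

lemma blin_on_bound:
  assumes "blin_on S A"
  shows "\<exists>M\<ge>0. \<forall>x\<in>S. norm (A x) \<le> M * norm x"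
proof -
  obtain M where M: "\<forall>x\<in>S. norm (A x) \<le> M * norm x"
    using assms unfolding blin_on_def by blast
  have "norm (A x) \<le> max M 0 * norm x" if "x \<in> S" for x
    using M[rule_format, OF that] by (meson dual_order.trans max.cobounded1 mult_right_mono norm_ge_zero)
  then show ?thesis by (intro exI[of _ "max M 0"]) auto
qed

lemma blin_on_zero: "csubspace S \<Longrightarrow> blin_on S A \<Longrightarrow> A 0 = 0"
  by (metis blin_on_scaleC csubspace_zero scaleC_zero_left)

lemma blin_on_minus: "csubspace S \<Longrightarrow> blin_on S A \<Longrightarrow> x \<in> S \<Longrightarrow> A (- x) = - A x"
  by (metis blin_on_scaleC scaleC_minus_one)

lemma blin_on_diff:
  "csubspace S \<Longrightarrow> blin_on S A \<Longrightarrow> x \<in> S \<Longrightarrow> y \<in> S \<Longrightarrow> A (x - y) = A x - A y"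
  using blin_on_add[of S A x "- y"] by (simp add: blin_on_minus csubspace_minus)

lemma blin_on_comp:
  assumes "blin_on S A" "\<And>x. x \<in> S \<Longrightarrow> A x \<in> S'" "blin_on S' B"
  shows "blin_on S (\<lambda>x. B (A x))"
proof -
  obtain M where M: "M \<ge> 0" "\<And>x. x \<in> S \<Longrightarrow> norm (A x) \<le> M * norm x"
    using blin_on_bound[OF assms(1)] by metis
  obtain M' where M': "M' \<ge> 0" "\<And>x. x \<in> S' \<Longrightarrow> norm (B x) \<le> M' * norm x"
    using blin_on_bound[OF assms(3)] by metis
  show ?thesis
  proof (rule blin_onI)
    show "norm (B (A x)) \<le> (M' * M) * norm x" if "x \<in> S" for x
      using M(2)[OF that] M'(2)[OF assms(2)[OF that]] M'(1)
      by (smt (verit, ccfv_SIG) mult.assoc mult_left_mono)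
  qed (use assms in \<open>auto simp: blin_on_add blin_on_scaleC\<close>)
qed

lemma blin_on_plus: "blin_on S A \<Longrightarrow> blin_on S B \<Longrightarrow> blin_on S (\<lambda>x. A x + B x)"
proof -
  assume AB: "blin_on S A" "blin_on S B"
  obtain M where M: "M \<ge> 0" "\<And>x. x \<in> S \<Longrightarrow> norm (A x) \<le> M * norm x"
    using blin_on_bound[OF AB(1)] by metis
  obtain M' where M': "M' \<ge> 0" "\<And>x. x \<in> S \<Longrightarrow> norm (B x) \<le> M' * norm x"
    using blin_on_bound[OF AB(2)] by metis
  show ?thesis
  proof (rule blin_onI)
    show "norm (A x + B x) \<le> (M + M') * norm x" if "x \<in> S" for x
      using M(2)[OF that] M'(2)[OF that] norm_triangle_ineq[of "A x" "B x"]
      by (simp add: algebra_simps)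
  qed (use AB in \<open>auto simp: blin_on_add blin_on_scaleC scaleC_add_right\<close>)
qed

lemma blin_on_uminus: "blin_on S A \<Longrightarrow> blin_on S (\<lambda>x. - A x)"
  unfolding blin_on_def by (auto simp: scaleC_minus_right)

lemma blin_on_minus_fun: "blin_on S A \<Longrightarrow> blin_on S B \<Longrightarrow> blin_on S (\<lambda>x. A x - B x)"
  using blin_on_plus[OF _ blin_on_uminus, of S A B] by simp

lemma blin_on_id: "blin_on S (\<lambda>x. x)"
  by (rule blin_onI[where M=1]) auto

lemma blin_on_subset: "blin_on S A \<Longrightarrow> S' \<subseteq> S \<Longrightarrow> blin_on S' A"
  unfolding blin_on_def by blast

lemma blin_on_zero_fun: "blin_on S (\<lambda>x. 0)"
  by (rule blin_onI[where M=0]) (auto simp: scaleC_zero_right)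

lemma blin_on_cinner: "blin_on S A \<Longrightarrow> blin_on S (\<lambda>x. cinner (A x) y)"
proof -
  assume A: "blin_on S A"
  obtain M where M: "M \<ge> 0" "\<And>x. x \<in> S \<Longrightarrow> norm (A x) \<le> M * norm x"
    using blin_on_bound[OF A] by metis
  show ?thesis
  proof (rule blin_onI)
    show "norm (cinner (A x) y) \<le> M * norm y * norm x" if "x \<in> S" for x
      using cinner_Cauchy_Schwarz[of "A x" y] mult_right_mono[OF M(2)[OF that], of "norm y"]
      by (simp add: mult_ac)
  qed (use A in \<open>auto simp: blin_on_add blin_on_scaleC cinner.add_left cinner_scaleC_left
      scaleC_complex_def\<close>)
qed

lemma blin_on_tendsto:
  assumes S: "csubspace S" and A: "blin_on S A" and "\<And>k. u k \<in> S" "z \<in> S" "u \<longlonglongrightarrow> z"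
  shows "(\<lambda>k. A (u k)) \<longlonglongrightarrow> A z"
proof -
  obtain M where M: "M \<ge> 0" "\<And>x. x \<in> S \<Longrightarrow> norm (A x) \<le> M * norm x"
    using blin_on_bound[OF A] by metis
  have "(\<lambda>k. A (u k) - A z) \<longlonglongrightarrow> 0"
  proof (rule tendsto_norm_zero_cancel, rule tendsto_sandwich[where f="\<lambda>_. 0"])
    have "norm (A (u k) - A z) \<le> M * norm (u k - z)" for k
      using M(2)[of "u k - z"] assms by (simp add: blin_on_diff csubspace_diff)
    then show "\<forall>\<^sub>F k in sequentially. norm (A (u k) - A z) \<le> M * norm (u k - z)" by simp
    show "(\<lambda>k. M * norm (u k - z)) \<longlonglongrightarrow> 0"
      using tendsto_mult_right_zero[OF tendsto_norm_zero[OF LIM_zero[OF assms(5)]]] by simp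
  qed auto
  then show ?thesis by (simp add: LIM_zero_iff)
qed

lemma bounded_op_on_opprod:
  "(\<And>i. i \<in> {1..n} \<Longrightarrow> bounded_op_on S (A i)) \<Longrightarrow> bounded_op_on S (opprod n A)"
proof (induction n)
  case 0
  then show ?case by (simp add: bounded_op_on_iff id_def blin_on_id)
next
  case (Suc n)
  then have "bounded_op_on S (opprod n A)" "bounded_op_on S (A (Suc n))" by auto
  then show ?case
    by (auto simp: bounded_op_on_iff comp_def intro: blin_on_comp)
qed

lemma bounded_op_on_funpow: "bounded_op_on S A \<Longrightarrow> bounded_op_on S (A ^^ k)"
proof (induction k)
  case 0
  then show ?case by (simp add: bounded_op_on_iff id_def blin_on_id)
next
  case (Suc k)
  then show ?case by (auto simp: bounded_op_on_iff comp_def intro: blin_on_comp)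
qed

lemma isometry_on_opprod:
  "(\<And>i. i \<in> {1..n} \<Longrightarrow> isometry_on S (A i)) \<Longrightarrow> isometry_on S (opprod n A)"
proof (induction n)
  case 0
  then show ?case by (simp add: isometry_on_def bounded_op_on_iff id_def blin_on_id)
next
  case (Suc n)
  then have "isometry_on S (opprod n A)" "isometry_on S (A (Suc n))" by auto
  then show ?case
    by (auto simp: isometry_on_def bounded_op_on_iff comp_def intro: blin_on_comp)
qed

lemma csubspace_cspan: "csubspace (cspan A)"
  unfolding cspan_def by (rule hull_in) (auto simp: csubspace_def)

lemma cspan_superset: "A \<subseteq> cspan A"
  unfolding cspan_def by (rule hull_subset)

lemma closed_csubspace_closure:
  assumes S: "csubspace S"
  shows "closed_csubspace (closure S)"
proof -
  have "x + y \<in> closure S" if "x \<in> closure S" "y \<in> closure S" for x y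
  proof -
    obtain u where "\<forall>k. u k \<in> S" "u \<longlonglongrightarrow> x"
      using \<open>x \<in> closure S\<close> unfolding closure_sequential by auto
    moreover obtain v where "\<forall>k. v k \<in> S" "v \<longlonglongrightarrow> y"
      using \<open>y \<in> closure S\<close> unfolding closure_sequential by auto
    ultimately    show ?thesis unfolding closure_sequential
      using S by (intro exI[of _ "\<lambda>k. u k + v k"]) (auto intro: tendsto_add csubspace_add)
  qed
  moreover have "c *\<^sub>C x \<in> closure S" if "x \<in> closure S" for c x
  proof -
    obtain u where "\<forall>k. u k \<in> S" "u \<longlonglongrightarrow> x"
      using \<open>x \<in> closure S\<close> unfolding closure_sequential by auto
    then show ?thesis unfolding closure_sequential using S
      by (intro exI[of _ "\<lambda>k. c *\<^sub>C u k"])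
         (auto intro: bounded_linear.tendsto[OF bounded_linear_scaleC] csubspace_scaleC)
  qed
  moreover have "0 \<in> closure S" using csubspace_zero[OF S] closure_subset by blast
  ultimately show ?thesis by (simp add: closed_csubspace_def csubspace_def)
qed

lemma closure_cspan_least: "A \<subseteq> M \<Longrightarrow> closed_csubspace M \<Longrightarrow> closure (cspan A) \<subseteq> M"
  unfolding cspan_def closed_csubspace_def by (meson closure_minimal hull_minimal)

lemma closure_cspan_csubspace: "csubspace S \<Longrightarrow> closure (cspan S) = closure S"
  unfolding cspan_def by (simp add: hull_same)

lemma blin_on_eq_dense:
  assumes K: "K = closure (cspan G)" and A: "blin_on K A" and B: "blin_on K B"
    and eq: "\<And>x. x \<in> G \<Longrightarrow> A x = B x" and x: "x \<in> K"
  shows "A x = B x"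
proof -
  have KK: "closed_csubspace K" unfolding K by (rule closed_csubspace_closure[OF csubspace_cspan])
  then have sub: "csubspace K" and cl: "closed K" by (auto simp: closed_csubspace_def)
  have "G \<subseteq> K" unfolding K using cspan_superset closure_subset by blast
  moreover have "closed_csubspace {x \<in> K. A x = B x}"
    unfolding closed_csubspace_def
  proof
    show "csubspace {x \<in> K. A x = B x}"
      using sub A B by (auto simp: csubspace_def[of "{x \<in> K. A x = B x}"] blin_on_zero[OF sub]
          csubspace_zero csubspace_add csubspace_scaleC blin_on_add blin_on_scaleC)
    show "closed {x \<in> K. A x = B x}"
      unfolding closed_sequential_limits
    proof (intro allI impI, elim conjE)
      fix u l assume u: "\<forall>n. u n \<in> {x \<in> K. A x = B x}" "u \<longlonglongrightarrow> l"
      then have l: "l \<in> K" using cl closed_sequentially[of K u l] by auto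
      have "(\<lambda>n. A (u n)) \<longlonglongrightarrow> A l" "(\<lambda>n. B (u n)) \<longlonglongrightarrow> B l"
        using u l blin_on_tendsto[OF sub A, of u l] blin_on_tendsto[OF sub B, of u l] by auto
      moreover have "(\<lambda>n. A (u n)) = (\<lambda>n. B (u n))" using u by auto
      ultimately have "A l = B l" using LIMSEQ_unique by metis
      with l show "l \<in> {x \<in> K. A x = B x}" by simp
    qed
  qed
  ultimately have "closure (cspan G) \<subseteq> {x \<in> K. A x = B x}"
    using eq by (intro closure_cspan_least) auto
  then show ?thesis using x K by auto
qed

lemma isometric_cinner:
  assumes S: "csubspace S" and V: "blin_on S V" and iso: "\<And>x. x \<in> S \<Longrightarrow> norm (V x) = norm x"
    and x: "x \<in> S" and y: "y \<in> S"
  shows "cinner (V x) (V y) = cinner x y"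
proof -
  have Re: "Re (cinner (V x) (V y)) = Re (cinner x y)" if "x \<in> S" for x
    using norm_sq_add[of "V x" "V y"] norm_sq_add[of x y] iso[OF that] iso[OF y]
      iso[OF csubspace_add[OF S that y]] blin_on_add[OF V that y] by simp
  show ?thesis
    using Re[OF x] Re[OF csubspace_scaleC[OF S x, of \<i>]] blin_on_scaleC[OF V x]
    by (simp add: complex_eq_iff cinner_scaleC_left)
qed

section \<open>The Riesz theorem, adjoints and orthogonal projections\<close>

text \<open>The variational argument at a minimum, for quadratic polynomials.\<close>

lemma linear_coefficient_zero:
  fixes a b :: real
  assumes "\<And>t. t\<^sup>2 * a + 2 * t * b \<ge> 0"
  shows "b = 0"
proof (rule ccontr)
  assume b: "b \<noteq> 0"
  (* s exceeds a, so that the linear term dominates at t = - b / s *)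
  define s where "s = \<bar>a\<bar> + 1"
  have s: "s > 0" "a < s" by (auto simp: s_def)
  have "(- b / s)\<^sup>2 * a + 2 * (- b / s) * b = b\<^sup>2 / s * (a / s - 2)"
    using s by (simp add: field_simps power2_eq_square)
  moreover have "a / s - 2 < 0" "b\<^sup>2 / s > 0" using s b by (auto simp: field_simps)
  ultimately have "(- b / s)\<^sup>2 * a + 2 * (- b / s) * b < 0"
    by (metis mult_pos_neg)
  with assms show False by (meson not_le)
qed

text \<open>The representing vector is found without kernels or projections: it minimises
  \<open>\<parallel>z\<parallel>\<^sup>2 - 2 Re (f z)\<close> over the subspace. By the parallelogram law every minimising sequence is
  Cauchy.\<close>

lemma Riesz_representation:
  fixes S :: "'a::chilbert_space set"
  assumes S: "closed_csubspace S"
    and f: "blin_on S f"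
  shows "\<exists>z\<in>S. \<forall>x\<in>S. f x = cinner x z"
proof -
  have sub: "csubspace S" and cl: "closed S" using S by (auto simp: closed_csubspace_def)
  note [simp] = csubspace_zero[OF sub] csubspace_add[OF sub] csubspace_scaleC[OF sub]
    csubspace_scaleR[OF sub] csubspace_diff[OF sub]
  note add = blin_on_add[OF f] and scale = blin_on_scaleC[OF f, unfolded scaleC_complex_def]
  obtain M where bound: "\<And>x. x \<in> S \<Longrightarrow> cmod (f x) \<le> M * norm x"
    using blin_on_bound[OF f] by metis
  have fR: "f (r *\<^sub>R x) = of_real r * f x" if "x \<in> S" for r x
    using that by (simp add: scaleR_eq_scaleC scale)
  define \<phi> where "\<phi> z = (norm z)\<^sup>2 - 2 * Re (f z)" for z
  have low: "\<phi> z \<ge> - M\<^sup>2" if "z \<in> S" for z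
  proof -
    have "Re (f z) \<le> M * norm z" using bound[OF that] complex_Re_le_cmod[of "f z"] by linarith
    moreover have "0 \<le> (norm z - M)\<^sup>2" by simp
    ultimately show ?thesis by (simp add: \<phi>_def power2_eq_square algebra_simps)
  qed
  define m where "m = Inf (\<phi> ` S)"
  have bdd: "bdd_below (\<phi> ` S)" using low by (auto intro!: bdd_belowI2)
  have m_le: "m \<le> \<phi> z" if "z \<in> S" for z
    unfolding m_def using bdd that by (simp add: cINF_lower)
  have "\<exists>z\<in>S. \<phi> z < m + 1 / real (Suc k)" for k
  proof -
    have "Inf (\<phi> ` S) < m + 1 / real (Suc k)" by (simp add: m_def)
    then show ?thesis using cInf_lessD[of "\<phi> ` S"] csubspace_zero[OF sub] by blast
  qed
  then obtain u where u: "\<And>k. u k \<in> S" "\<And>k. \<phi> (u k) < m + 1 / real (Suc k)" by metis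
  have para: "(norm (x - y))\<^sup>2 = 2 * (\<phi> x + \<phi> y - 2 * \<phi> ((1/2) *\<^sub>R (x + y)))"
    if "x \<in> S" "y \<in> S" for x y
  proof -
    have "(norm (x - y))\<^sup>2 = (norm x)\<^sup>2 - 2 * Re (cinner x y) + (norm y)\<^sup>2"
      using norm_sq_add[of x "- y"] by (simp add: cinner.minus_right)
    moreover have "(norm ((1/2) *\<^sub>R (x + y)))\<^sup>2 = (norm (x + y))\<^sup>2 / 4"
      by (simp add: power_divide)
    ultimately show ?thesis using that
      by (simp add: \<phi>_def fR add norm_sq_add[of x y] algebra_simps)
  qed
  have close: "(norm (u p - u q))\<^sup>2 \<le> 2 * (1 / real (Suc p) + 1 / real (Suc q))" for p q
    using para[OF u(1)[of p] u(1)[of q]] u(2)[of p] u(2)[of q]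
      m_le[of "(1/2) *\<^sub>R (u p + u q)"] u(1) by simp
  have "Cauchy u"
  proof (rule CauchyI)
    fix e :: real assume e: "0 < e"
    obtain N where N: "1 / real (Suc N) < e\<^sup>2 / 4"
      using e nat_approx_posE[of "e\<^sup>2/4"] by auto
    have "norm (u p - u q) < e" if "p \<ge> N" "q \<ge> N" for p q
    proof -
      have "1 / real (Suc p) \<le> 1 / real (Suc N)" "1 / real (Suc q) \<le> 1 / real (Suc N)"
        using that by (auto simp: field_simps)
      then have "2 * (1 / real (Suc p) + 1 / real (Suc q))
          \<le> 2 * (1 / real (Suc N) + 1 / real (Suc N))"
        by (intro mult_left_mono add_mono) auto
      also have "\<dots> < e\<^sup>2" using N by (simp only: mult_2[symmetric])
      finally have "(norm (u p - u q))\<^sup>2 < e\<^sup>2" using close[of p q] by (rule le_less_trans[rotated])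
      then show ?thesis using e by (simp add: power2_less_imp_less)
    qed
    then show "\<exists>N. \<forall>p\<ge>N. \<forall>q\<ge>N. norm (u p - u q) < e" by blast
  qed
  then obtain z where z: "u \<longlonglongrightarrow> z" using convergent_eq_Cauchy by blast
  have zS: "z \<in> S" using cl z u(1) closed_sequentially by blast
  have "(\<lambda>k. f (u k)) \<longlonglongrightarrow> f z" by (rule blin_on_tendsto[OF sub f u(1) zS z])
  then have lim: "(\<lambda>k. \<phi> (u k)) \<longlonglongrightarrow> \<phi> z"
    unfolding \<phi>_def by (intro tendsto_intros z)
  have "(\<lambda>k. m + 1 / real (Suc k)) \<longlonglongrightarrow> m + 0"
    by (intro tendsto_intros) (rule LIMSEQ_inverse_real_of_nat[unfolded inverse_eq_divide])
  then have "\<phi> z \<le> m + 0"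
    by (rule LIMSEQ_le[OF lim]) (use u(2) less_imp_le in blast)
  then have min: "\<phi> z \<le> \<phi> w" if "w \<in> S" for w using m_le[OF that] by linarith
  have Re_eq: "Re (f w) = Re (cinner w z)" if w: "w \<in> S" for w
  proof -
    have "t\<^sup>2 * (norm w)\<^sup>2 + 2 * t * (Re (cinner w z) - Re (f w)) \<ge> 0" for t
    proof -
      have "Re (cinner z (t *\<^sub>R w)) = t * Re (cinner w z)"
        by (subst cinner_commute) (simp add: cinner.scaleR_left)
      then have "\<phi> (z + t *\<^sub>R w) =
          \<phi> z + (t\<^sup>2 * (norm w)\<^sup>2 + 2 * t * (Re (cinner w z) - Re (f w)))"
        using w zS by (simp add: \<phi>_def norm_sq_add[of z] add fR power_mult_distrib algebra_simps)
      then show ?thesis using min[of "z + t *\<^sub>R w"] w zS by simp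
    qed
    from linear_coefficient_zero[OF this] show ?thesis by simp
  qed
  have "f w = cinner w z" if w: "w \<in> S" for w
    using Re_eq[OF w] Re_eq[of "\<i> *\<^sub>C w"] w
    by (simp add: complex_eq_iff scale cinner_scaleC_left)
  with zS show ?thesis by blast
qed

lemma adj_on_eqI:
  assumes "csubspace S" "z \<in> S" "\<And>x. x \<in> S \<Longrightarrow> cinner (A x) y = cinner x z"
  shows "adj_on S A y = z"
  unfolding adj_on_def
proof (rule the_equality)
  fix z' assume "z' \<in> S \<and> (\<forall>x\<in>S. cinner (A x) y = cinner x z')"
  then show "z' = z" using assms by (intro cinner_ext[of S]) auto
qed (use assms in auto)

lemma Riesz_adjoint:
  fixes A :: "'a::chilbert_space \<Rightarrow> 'b::chilbert_space"
  assumes S: "closed_csubspace S" and A: "blin_on S A"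
  shows "\<exists>z\<in>S. \<forall>x\<in>S. cinner (A x) y = cinner x z"
  by (rule Riesz_representation[OF S blin_on_cinner[OF A]])

lemma
  assumes S: "closed_csubspace S" and A: "blin_on S A"
  shows adj_on_in: "adj_on S A y \<in> S"
    and adj_on_cinner: "x \<in> S \<Longrightarrow> cinner (A x) y = cinner x (adj_on S A y)"
    and adj_on_cinner_left: "x \<in> S \<Longrightarrow> cinner (adj_on S A y) x = cinner y (A x)"
proof -
  obtain z where z: "z \<in> S" "\<forall>x\<in>S. cinner (A x) y = cinner x z"
    using Riesz_adjoint[OF S A] by blast
  then have "adj_on S A y = z" using S by (auto intro: adj_on_eqI simp: closed_csubspace_def)
  with z show "adj_on S A y \<in> S"
    and *: "x \<in> S \<Longrightarrow> cinner (A x) y = cinner x (adj_on S A y)" by auto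
  show "x \<in> S \<Longrightarrow> cinner (adj_on S A y) x = cinner y (A x)"
    using * by (metis cinner_commute)
qed

lemma adj_on_blin:
  assumes S: "closed_csubspace S" and A: "bounded_op_on S A"
  shows "blin_on S (adj_on S A)"
proof -
  have sub: "csubspace S" using S by (simp add: closed_csubspace_def)
  have A': "blin_on S A" "\<And>x. x \<in> S \<Longrightarrow> A x \<in> S" using A by (auto simp: bounded_op_on_iff)
  obtain M where M: "M \<ge> 0" "\<And>x. x \<in> S \<Longrightarrow> norm (A x) \<le> M * norm x"
    using blin_on_bound[OF A'(1)] by metis
  note [simp] = adj_on_in[OF S A'(1)] csubspace_add[OF sub] csubspace_scaleC[OF sub]
    adj_on_cinner[OF S A'(1), symmetric]
  show ?thesis
  proof (rule blin_onI)
    show "norm (adj_on S A y) \<le> M * norm y" for y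
      by (rule norm_le_by_duality[of _ "A (adj_on S A y)"])
        (use M in simp_all)
  qed (auto intro!: adj_on_eqI sub simp: cinner.add_right cinner_scaleC_right)
qed

lemma orth_proj_eqI:
  assumes "csubspace M" "y \<in> M" "\<And>z. z \<in> M \<Longrightarrow> cinner (x - y) z = 0"
  shows "orth_proj M x = y"
  unfolding orth_proj_def
proof (rule the_equality)
  fix y' assume y': "y' \<in> M \<and> (\<forall>z\<in>M. cinner (x - y') z = 0)"
  have "cinner z y' = cinner z y" if "z \<in> M" for z
    using assms(3)[OF that] y' that
    by (rule_tac cinner_swap) (auto simp: cinner.diff_left)
  then show "y' = y" using assms y' by (intro cinner_ext[of M]) auto
qed (use assms in auto)

section \<open>Extension of isometries\<close>

text \<open>The closed linear relation generated by the pairs \<open>(x i, y i)\<close>. Closing under limits inside the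
  inductive definition replaces the usual two steps, first to the span and then to its closure, by
  a single induction.\<close>

inductive isometric_graph ::
  "('i \<Rightarrow> 'a::chilbert_space) \<Rightarrow> ('i \<Rightarrow> 'b::chilbert_space) \<Rightarrow> 'a \<Rightarrow> 'b \<Rightarrow> bool" for x y where
  gen: "isometric_graph x y (x i) (y i)"
| add: "isometric_graph x y u v \<Longrightarrow> isometric_graph x y u' v' \<Longrightarrow> isometric_graph x y (u + u') (v + v')"
| scale: "isometric_graph x y u v \<Longrightarrow> isometric_graph x y (c *\<^sub>C u) (c *\<^sub>C v)"
| lim: "(\<And>k::nat. isometric_graph x y (s k) (t k)) \<Longrightarrow> s \<longlonglongrightarrow> u \<Longrightarrow> t \<longlonglongrightarrow> v \<Longrightarrow> isometric_graph x y u v"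

text \<open>Inner products are sesquilinear and continuous, so equality on the generating pairs propagates to
  one argument and then to the other.\<close>

lemma isometric_graph_cinner:
  assumes xy: "\<And>i j. cinner (y i) (y j) = cinner (x i) (x j)"
    and uv: "isometric_graph x y u v" and uv': "isometric_graph x y u' v'"
  shows "cinner v v' = cinner u u'"
proof -
  have gen: "cinner v (y j) = cinner u (x j)" if "isometric_graph x y u v" for u v j
    using that
  proof induction
    case (lim s t u v)
    have "(\<lambda>k. cinner (t k) (y j)) \<longlonglongrightarrow> cinner v (y j)"
      and "(\<lambda>k. cinner (s k) (x j)) \<longlonglongrightarrow> cinner u (x j)"
      by (intro cinner.tendsto tendsto_const lim.hyps)+
    then show ?case using lim.IH LIMSEQ_unique by auto
  qed (auto simp: xy cinner.add_left cinner_scaleC_left)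
  from uv' show ?thesis
  proof induction
    case (lim s t u' v')
    have "(\<lambda>k. cinner v (t k)) \<longlonglongrightarrow> cinner v v'"
      and "(\<lambda>k. cinner u (s k)) \<longlonglongrightarrow> cinner u u'"
      by (intro cinner.tendsto tendsto_const lim.hyps)+
    then show ?case using lim.IH LIMSEQ_unique by auto
  qed (auto simp: gen[OF uv] cinner.add_right cinner_scaleC_right)
qed

text \<open>Differences of two pairs of the relation are again pairs, and pairs have equal norms. Hence the
  relation is single valued, and a convergent sequence in its domain lifts to a Cauchy sequence of
  values, which makes the domain closed.\<close>

lemma isometric_extension:
  fixes x :: "'i \<Rightarrow> 'a::chilbert_space" and y :: "'i \<Rightarrow> 'b::chilbert_space"
  assumes xy: "\<And>i j. cinner (y i) (y j) = cinner (x i) (x j)"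
    and K: "K = closure (cspan (range x))"
    and Q: "closed_csubspace Q" "\<And>i. y i \<in> Q"
  shows "\<exists>W. blin_on K W \<and> (\<forall>z\<in>K. norm (W z) = norm z) \<and> (\<forall>i. W (x i) = y i) \<and> (\<forall>z\<in>K. W z \<in> Q)"
proof -
  let ?G = "isometric_graph x y"
  have norm_eq: "norm v = norm u" if "?G u v" for u v
    using isometric_graph_cinner[OF xy that that]
    by (metis norm_eq_sqrt_cinner)
  have minus: "?G (u - u') (v - v')" if "?G u v" "?G u' v'" for u v u' v'
    using isometric_graph.add[OF that(1) isometric_graph.scale[OF that(2), of "-1"]]
    by (simp add: scaleC_minus_one)
  have unique: "v = v'" if "?G u v" "?G u v'" for u v v'
    using norm_eq[OF minus[OF that]] by simp
  have inQ: "v \<in> Q" if "?G u v" for u v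
    using that
  proof induction
    case (lim s t u v)
    then show ?case using Q closed_sequentially[of Q t v] by (auto simp: closed_csubspace_def)
  qed (use Q in \<open>auto simp: closed_csubspace_def csubspace_add csubspace_scaleC\<close>)
  (* the domain of the relation is a closed subspace, hence contains K *)
  define M where "M = {u. \<exists>v. ?G u v}"
  have "closed_csubspace M"
    unfolding closed_csubspace_def
  proof
    have "?G 0 0" using isometric_graph.scale[OF isometric_graph.gen, of x y 0]
      by (simp add: scaleC_zero_left)
    then show "csubspace M"
      unfolding csubspace_def M_def
      by (auto intro: isometric_graph.add isometric_graph.scale)
    show "closed M"
      unfolding closed_sequential_limits
    proof (intro allI impI, elim conjE)
      fix s l assume s: "\<forall>k. s k \<in> M" "s \<longlonglongrightarrow> l"
      then obtain t where t: "\<And>k. ?G (s k) (t k)" unfolding M_def by (auto dest!: choice)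
      have "dist (t p) (t q) = dist (s p) (s q)" for p q
        using norm_eq[OF minus[OF t t]] by (simp add: dist_norm)
      moreover have "Cauchy s" using s(2) by (rule LIMSEQ_imp_Cauchy)
      ultimately have "Cauchy t" unfolding Cauchy_def by simp
      then obtain v where "t \<longlonglongrightarrow> v" using convergent_eq_Cauchy by blast
      then show "l \<in> M" unfolding M_def using isometric_graph.lim[OF t s(2)] by blast
    qed
  qed
  then have "K \<subseteq> M" unfolding K
    by (intro closure_cspan_least) (auto simp: M_def intro: isometric_graph.gen)
  define W where "W u = (THE v. ?G u v)" for u
  have W_eq: "W u = v" if "?G u v" for u v
    unfolding W_def using that unique by blast
  have W: "?G u (W u)" if "u \<in> K" for u
    using that \<open>K \<subseteq> M\<close> W_eq by (fastforce simp: M_def)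
  have "norm (W u) = norm u" if "u \<in> K" for u using norm_eq[OF W[OF that]] .
  moreover have "blin_on K W"
    by (rule blin_onI[where M=1])
      (auto simp: calculation W intro!: W_eq isometric_graph.add isometric_graph.scale)
  ultimately show ?thesis
    using inQ[OF W] W_eq[OF isometric_graph.gen] by blast
qed

section \<open>Square roots and defect operators\<close>

lemma blin_on_UNIV_bounded_linear: "blin_on UNIV A \<Longrightarrow> bounded_linear A"
proof -
  assume A: "blin_on UNIV A"
  obtain M where "\<And>x. norm (A x) \<le> M * norm x" using blin_on_bound[OF A] by auto
  then show ?thesis
    using A by (intro bounded_linear_intro[where K=M])
      (auto simp: blin_on_add scaleR_eq_scaleC blin_on_scaleC mult.commute)
qed

lemma contraction_blin: "contraction T \<Longrightarrow> blin_on UNIV T"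
  by (simp add: contraction_def bounded_op_on_iff)

lemma contraction_norm_le: "contraction T \<Longrightarrow> norm (T x) \<le> norm x"
  using onorm[of T x] mult_right_mono[of "onorm T" 1 "norm x"]
  by (auto simp: contraction_def bounded_op_on_iff dest!: blin_on_UNIV_bounded_linear)

lemma contractionI:
  assumes "blin_on UNIV T" "\<And>x. norm (T x) \<le> norm x"
  shows "contraction T"
  using assms onorm_bound[of 1 T] by (simp add: contraction_def bounded_op_on_iff)

lemma opprod_norm_le:
  "(\<And>i x. i \<in> {1..n} \<Longrightarrow> norm (A i x) \<le> norm x) \<Longrightarrow> norm (opprod n A x) \<le> norm x"
proof (induction n arbitrary: x)
  case (Suc n)
  have "norm (opprod n A (A (Suc n) x)) \<le> norm (A (Suc n) x)"
    by (rule Suc.IH) (use Suc.prems in auto)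
  also have "\<dots> \<le> norm x" by (rule Suc.prems) simp
  finally show ?case by simp
qed simp

lemma contraction_opprod:
  assumes "\<And>i. i \<in> {1..n} \<Longrightarrow> contraction (T i)"
  shows "contraction (opprod n T)"
proof (rule contractionI)
  show "blin_on UNIV (opprod n T)"
    using bounded_op_on_opprod[of n UNIV T] assms contraction_blin by (auto simp: bounded_op_on_iff)
  show "norm (opprod n T x) \<le> norm x" for x
    by (rule opprod_norm_le) (use assms contraction_norm_le in blast)
qed

text \<open>A sesquilinear form whose quadratic form is real is Hermitian, by polarisation with
  \<open>x + y\<close> and \<open>\<i> x + y\<close>.\<close>

lemma positive_op_selfadjoint:
  assumes "positive_op A"
  shows "cinner (A x) y = cinner x (A y)"
proof -
  have A: "blin_on UNIV A" and im: "\<And>x. Im (cinner (A x) x) = 0"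
    using assms by (auto simp: positive_op_def bounded_op_on_iff)
  have *: "Im (cinner (A x) y) = - Im (cinner (A y) x)" for x y
    using im[of "x + y"] im[of x] im[of y]
    by (simp add: blin_on_add[OF A] cinner.add_left cinner.add_right)
  have "cinner (A x) y = cnj (cinner (A y) x)"
    using *[of x y] *[of "\<i> *\<^sub>C x" y]
    by (simp add: complex_eq_iff blin_on_scaleC[OF A] cinner_scaleC_left cinner_scaleC_right)
  then show ?thesis by (metis cinner_commute)
qed

context
  fixes C :: "'a::chilbert_space \<Rightarrow> 'a"
  assumes C: "blin_on UNIV C" and Csa: "\<And>x y. cinner (C x) y = cinner x (C y)"
    and Cle: "\<And>x. norm (C x) \<le> norm x"
begin

text \<open>With \<open>B = I - Y\<close>, the equation \<open>B\<^sup>2 = I - C\<close> reads \<open>Y = (C + Y\<^sup>2) / 2\<close>, which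
  suggests the iteration \<open>Y \<mapsto> (C + Y\<^sup>2) / 2\<close> from \<open>Y = 0\<close>.\<close>

primrec sqrt_iter :: "nat \<Rightarrow> 'a \<Rightarrow> 'a" where
  "sqrt_iter 0 = (\<lambda>x. 0)"
| "sqrt_iter (Suc k) = (\<lambda>x. (1/2) *\<^sub>R (C x + sqrt_iter k (sqrt_iter k x)))"

text \<open>The same iteration on scalars, for \<open>C = 1\<close>.\<close>

primrec sqrt_bound :: "nat \<Rightarrow> real" where
  "sqrt_bound 0 = 0"
| "sqrt_bound (Suc k) = (1 + (sqrt_bound k)\<^sup>2) / 2"

lemma sqrt_bound_range: "0 \<le> sqrt_bound k \<and> sqrt_bound k \<le> 1"
proof (induction k)
  case (Suc k)
  then have "(sqrt_bound k)\<^sup>2 \<le> 1" by (simp add: power_le_one)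
  then show ?case by simp
qed simp

lemma sqrt_bound_mono: "sqrt_bound k \<le> sqrt_bound (Suc k)"
proof -
  have "0 \<le> (1 - sqrt_bound k)\<^sup>2" by simp
  then show ?thesis by (simp add: power2_eq_square algebra_simps)
qed

lemma sqrt_iter_linear:
  "sqrt_iter k (x + y) = sqrt_iter k x + sqrt_iter k y"
  "sqrt_iter k (c *\<^sub>C x) = c *\<^sub>C sqrt_iter k x"
proof (induction k arbitrary: x y c)
  case (Suc k)
  case 1 show ?case
    by (simp add: blin_on_add[OF C] Suc(1) scaleR_add_right)
  case 2 show ?case
    by (simp add: blin_on_scaleC[OF C] Suc(2) scaleC_add_right scaleR_eq_scaleC scaleC_scaleC mult.commute)
qed (auto simp: scaleC_zero_right)

lemma sqrt_iter_diff: "sqrt_iter k (x - y) = sqrt_iter k x - sqrt_iter k y"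
  by (metis add_diff_cancel_right' diff_add_cancel sqrt_iter_linear(1))

lemma sqrt_iter_norm: "norm (sqrt_iter k x) \<le> sqrt_bound k * norm x"
proof (induction k arbitrary: x)
  case (Suc k)
  have "norm (sqrt_iter k (sqrt_iter k x)) \<le> sqrt_bound k * (sqrt_bound k * norm x)"
    using Suc[of "sqrt_iter k x"] mult_left_mono[OF Suc[of x]] sqrt_bound_range[of k] by fastforce
  then have "norm (C x + sqrt_iter k (sqrt_iter k x)) \<le> norm x + sqrt_bound k * (sqrt_bound k * norm x)"
    using norm_triangle_ineq[of "C x"] Cle[of x] by (smt (verit))
  then show ?case by (simp add: power2_eq_square distrib_right mult.assoc)
qed simp

lemma sqrt_iter_norm1: "norm (sqrt_iter k x) \<le> norm x"
  using sqrt_iter_norm[of k x] mult_right_mono[of "sqrt_bound k" 1 "norm x"] sqrt_bound_range[of k]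
  by simp

lemma sqrt_iter_selfadjoint: "cinner (sqrt_iter k x) y = cinner x (sqrt_iter k y)"
  by (induction k arbitrary: x y) (simp_all add: cinner.add_left cinner.add_right Csa cinner.scaleR_left
      cinner.scaleR_right cinner.zero_left cinner.zero_right)

text \<open>The scalar iteration increases and stays below \<open>1\<close>, and its increments majorise those of the
  operator iteration: both sides obey the same recursion, since
  \<open>Y\<^sub>1\<^sup>2 - Y\<^sub>0\<^sup>2 = Y\<^sub>1 (Y\<^sub>1 - Y\<^sub>0) + (Y\<^sub>1 - Y\<^sub>0) Y\<^sub>0\<close>. So there is norm
  convergence even when \<open>C\<close> has norm \<open>1\<close>.\<close>

lemma sqrt_iter_step:
  "norm (sqrt_iter (Suc k) x - sqrt_iter k x) \<le> (sqrt_bound (Suc k) - sqrt_bound k) * norm x"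
proof (induction k arbitrary: x)
  case 0
  then show ?case using Cle[of x] by simp
next
  case (Suc k)
  let ?X = "sqrt_iter k" and ?Y = "sqrt_iter (Suc k)"
  let ?s = "sqrt_bound k" and ?t = "sqrt_bound (Suc k)"
  have eq: "sqrt_iter (Suc (Suc k)) x - ?Y x = (1/2) *\<^sub>R (?Y (?Y x - ?X x) + (?Y (?X x) - ?X (?X x)))"
  proof -
    have "sqrt_iter (Suc (Suc k)) x = (1/2) *\<^sub>R (C x + ?Y (?Y x))"
      by (simp only: sqrt_iter.simps(2)[of "Suc k"])
    moreover have "?Y x = (1/2) *\<^sub>R (C x + ?X (?X x))" by simp
    ultimately have "sqrt_iter (Suc (Suc k)) x - ?Y x =
        (1/2) *\<^sub>R (C x + ?Y (?Y x)) - (1/2) *\<^sub>R (C x + ?X (?X x))"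
      by (rule arg_cong2)
    then show ?thesis
      by (simp only: sqrt_iter_diff) (simp add: algebra_simps del: sqrt_iter.simps)
  qed
  have "norm (?Y (?Y x - ?X x)) \<le> ?t * ((?t - ?s) * norm x)"
    using sqrt_iter_norm[of "Suc k" "?Y x - ?X x"] mult_left_mono[OF Suc[of x], of ?t]
      sqrt_bound_range[of "Suc k"] by (simp del: sqrt_bound.simps sqrt_iter.simps)
  moreover have "norm (?Y (?X x) - ?X (?X x)) \<le> (?t - ?s) * (?s * norm x)"
    using Suc[of "?X x"] mult_left_mono[OF sqrt_iter_norm[of k x], of "?t - ?s"] sqrt_bound_mono[of k]
    by (simp del: sqrt_bound.simps sqrt_iter.simps)
  ultimately have "norm (?Y (?Y x - ?X x) + (?Y (?X x) - ?X (?X x))) \<le>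
      ?t * ((?t - ?s) * norm x) + (?t - ?s) * (?s * norm x)"
    by (rule norm_add_rule_thm)
  also have "\<dots> = (?t\<^sup>2 - ?s\<^sup>2) * norm x" by (simp only: power2_eq_square) algebra
  finally have le: "norm (?Y (?Y x - ?X x) + (?Y (?X x) - ?X (?X x))) \<le> (?t\<^sup>2 - ?s\<^sup>2) * norm x" .
  have half: "norm ((1/2) *\<^sub>R z) \<le> (d / 2) * m" if "norm z \<le> d * m" for z :: 'a and d m
    using that by simp
  have "sqrt_bound (Suc (Suc k)) - ?t = (?t\<^sup>2 - ?s\<^sup>2) / 2"
    by (simp only: sqrt_bound.simps(2)) (simp add: field_simps)
  then show ?case unfolding eq using half[OF le] by (simp only:)
qed

lemma sqrt_iter_distance:
  "norm (sqrt_iter (k + j) x - sqrt_iter k x) \<le> (sqrt_bound (k + j) - sqrt_bound k) * norm x"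
proof (induction j)
  case (Suc j)
  have "norm ((sqrt_iter (Suc (k + j)) x - sqrt_iter (k + j) x) + (sqrt_iter (k + j) x - sqrt_iter k x))
     \<le> (sqrt_bound (Suc (k + j)) - sqrt_bound (k + j)) * norm x + (sqrt_bound (k + j) - sqrt_bound k) * norm x"
    by (rule norm_add_rule_thm[OF sqrt_iter_step Suc])
  also have "\<dots> = (sqrt_bound (Suc (k + j)) - sqrt_bound k) * norm x" by algebra
  finally show ?case by (simp del: sqrt_iter.simps sqrt_bound.simps)
qed simp

lemma sqrt_iter_converges: "convergent (\<lambda>k. sqrt_iter k x)"
proof -
  have "incseq sqrt_bound" by (rule incseq_SucI) (rule sqrt_bound_mono)
  then have "convergent sqrt_bound"
    using incseq_convergent[of sqrt_bound 1] sqrt_bound_range unfolding convergent_def by blast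
  then have Cb: "Cauchy (\<lambda>k. sqrt_bound k * norm x)"
    by (intro convergent_Cauchy) (metis convergent_def tendsto_mult_right)
  have "dist (sqrt_iter m x) (sqrt_iter k x) \<le> dist (sqrt_bound m * norm x) (sqrt_bound k * norm x)" for m k
  proof (induction m k rule: linorder_wlog)
    case (le m k)
    show ?case
      using sqrt_iter_distance[of m "k - m" x] le
      by (simp add: dist_norm norm_minus_commute dist_real_def algebra_simps abs_if)
  qed (simp add: dist_commute)
  then have "Cauchy (\<lambda>k. sqrt_iter k x)"
    using Cb unfolding Cauchy_def by (meson le_less_trans)
  then show ?thesis by (rule Cauchy_convergent)
qed

lemma sqrt_exists: "\<exists>B. positive_op B \<and> (\<forall>x. B (B x) = x - C x)"
proof -
  define Y where "Y x = lim (\<lambda>k. sqrt_iter k x)" for x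
  have lim: "(\<lambda>k. sqrt_iter k x) \<longlonglongrightarrow> Y x" for x
    unfolding Y_def using sqrt_iter_converges convergent_LIMSEQ_iff by blast
  have add: "Y (x + y) = Y x + Y y" for x y
    by (rule LIMSEQ_unique[OF lim]) (simp only: sqrt_iter_linear(1) tendsto_add[OF lim lim])
  have scale: "Y (c *\<^sub>C x) = c *\<^sub>C Y x" for c x
    by (rule LIMSEQ_unique[OF lim])
       (simp only: sqrt_iter_linear(2) bounded_linear.tendsto[OF bounded_linear_scaleC lim])
  have norm: "norm (Y x) \<le> norm x" for x
    using lim[of x] by (intro LIMSEQ_le_const2[OF tendsto_norm]) (auto intro: sqrt_iter_norm1)
  have sa: "cinner (Y x) y = cinner x (Y y)" for x y
  proof (rule LIMSEQ_unique)
    show "(\<lambda>k. cinner (sqrt_iter k x) y) \<longlonglongrightarrow> cinner (Y x) y"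
      by (intro cinner.tendsto lim tendsto_const)
    show "(\<lambda>k. cinner (sqrt_iter k x) y) \<longlonglongrightarrow> cinner x (Y y)"
      unfolding sqrt_iter_selfadjoint by (intro cinner.tendsto lim tendsto_const)
  qed
  have sq: "(\<lambda>k. sqrt_iter k (sqrt_iter k x)) \<longlonglongrightarrow> Y (Y x)" for x
  proof -
    have "(\<lambda>k. sqrt_iter k (sqrt_iter k x - Y x)) \<longlonglongrightarrow> 0"
    proof (rule tendsto_norm_zero_cancel, rule tendsto_sandwich[where f="\<lambda>_. 0"])
      show "(\<lambda>k. norm (sqrt_iter k x - Y x)) \<longlonglongrightarrow> 0"
        using tendsto_norm_zero[OF LIM_zero[OF lim]] .
    qed (auto intro!: always_eventually sqrt_iter_norm1)
    from tendsto_add[OF this lim[of "Y x"]] show ?thesis by (simp add: sqrt_iter_diff)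
  qed
  have fix_eq: "Y x = (1/2) *\<^sub>R (C x + Y (Y x))" for x
  proof (rule LIMSEQ_unique)
    show "(\<lambda>k. sqrt_iter (Suc k) x) \<longlonglongrightarrow> Y x" using lim by (rule LIMSEQ_Suc)
    show "(\<lambda>k. sqrt_iter (Suc k) x) \<longlonglongrightarrow> (1/2) *\<^sub>R (C x + Y (Y x))"
      unfolding sqrt_iter.simps by (intro tendsto_intros sq)
  qed
  have Y: "blin_on UNIV Y" by (rule blin_onI[where M=1]) (auto simp: add scale norm)
  define B where "B x = x - Y x" for x
  have "blin_on UNIV B" unfolding B_def by (intro blin_on_minus_fun blin_on_id Y)
  moreover have "Im (cinner (B x) x) = 0" for x
  proof -
    have "cinner (Y x) x = cnj (cinner (Y x) x)" by (metis sa cinner_commute)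
    then have "Im (cinner (Y x) x) = 0" by (simp add: complex_eq_iff)
    then show ?thesis by (simp add: B_def cinner.diff_left cinner_self)
  qed
  moreover have "0 \<le> Re (cinner (B x) x)" for x
  proof -
    have "Re (cinner (Y x) x) \<le> norm (Y x) * norm x"
      using cinner_Cauchy_Schwarz[of "Y x" x] complex_Re_le_cmod order_trans by blast
    also have "\<dots> \<le> (norm x)\<^sup>2" using norm[of x] by (simp add: power2_eq_square mult_right_mono)
    finally show ?thesis by (simp add: B_def cinner.diff_left cinner_self)
  qed
  moreover have "B (B x) = x - C x" for x
  proof -
    have "2 *\<^sub>R Y x = C x + Y (Y x)" using fix_eq[of x] by (metis scaleR_half_double scaleR_2 scaleR_right_distrib)
    then have "C x = Y x + Y x - Y (Y x)" by (simp add: scaleR_2)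
    moreover have "Y (x - Y x) = Y x - Y (Y x)"
      by (rule blin_on_diff[OF _ Y UNIV_I UNIV_I]) (simp add: csubspace_def)
    ultimately show ?thesis unfolding B_def by simp
  qed
  ultimately show ?thesis unfolding positive_op_def bounded_op_on_iff by blast
qed

end

text \<open>These properties hold for every positive square root, so the choice made in \<open>sqrt_op\<close> does not
  matter.\<close>

lemma
  assumes "contraction T"
  shows defect_blin: "blin_on UNIV (defect T)"
    and defect_selfadjoint: "cinner (defect T x) y = cinner x (defect T y)"
    and defect_cinner: "cinner (defect T x) (defect T y) = cinner x y - cinner (T x) (T y)"
proof -
  let ?C = "\<lambda>x. adj_on UNIV T (T x)"
  have T: "blin_on UNIV T" using assms by (rule contraction_blin)
  have op: "bounded_op_on UNIV T" using T by (simp add: bounded_op_on_iff)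
  have aT: "cinner (T x) y = cinner x (adj_on UNIV T y)" for x y
    by (rule adj_on_cinner[OF closed_csubspace_UNIV T]) simp
  have aT': "cinner (adj_on UNIV T y) x = cinner y (T x)" for x y
    by (rule adj_on_cinner_left[OF closed_csubspace_UNIV T]) simp
  have le: "norm (adj_on UNIV T y) \<le> norm y" for y
    using norm_le_by_duality[of "adj_on UNIV T y" "T (adj_on UNIV T y)" y 1]
      contraction_norm_le[OF assms] by (simp add: aT)
  have "\<exists>B. positive_op B \<and> (\<forall>x. B (B x) = x - ?C x)"
  proof (rule sqrt_exists)
    show "blin_on UNIV ?C"
      by (rule blin_on_comp[OF T _ adj_on_blin[OF closed_csubspace_UNIV op]]) simp
    show "norm (?C x) \<le> norm x" for x
      using le[of "T x"] contraction_norm_le[OF assms, of x] by simp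
  qed (simp only: aT' aT[symmetric])
  from someI_ex[OF this] have D: "positive_op (defect T)" "\<And>x. defect T (defect T x) = x - ?C x"
    unfolding defect_def sqrt_op_def by auto
  show "blin_on UNIV (defect T)" using D(1) by (simp add: positive_op_def bounded_op_on_iff)
  show sa: "cinner (defect T x) y = cinner x (defect T y)" for x y
    by (rule positive_op_selfadjoint[OF D(1)])
  show "cinner (defect T x) (defect T y) = cinner x y - cinner (T x) (T y)"
    by (simp add: sa D(2) cinner.diff_right aT)
qed

lemma csubspace_range: "blin_on UNIV A \<Longrightarrow> csubspace (range A)"
  unfolding csubspace_def
  by (auto simp: image_iff) (metis blin_on_zero closed_csubspace_UNIV closed_csubspace_def,
      metis UNIV_I blin_on_add, metis UNIV_I blin_on_scaleC)

lemma defect_space_closed: "contraction T \<Longrightarrow> closed_csubspace (defect_space T)"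
  unfolding defect_space_def
  by (intro closed_csubspace_closure csubspace_range defect_blin)

lemma defect_space_eq: "contraction T \<Longrightarrow> defect_space T = closure (cspan (range (defect T)))"
  unfolding defect_space_def
  by (rule closure_cspan_csubspace[OF csubspace_range[OF defect_blin], symmetric])

lemma defect_in_space: "defect T h \<in> defect_space T"
  unfolding defect_space_def by (rule subsetD[OF closure_subset rangeI])

section \<open>Products of commuting families\<close>

lemma opprod_cong:
  "(\<And>i x. i \<in> {1..n} \<Longrightarrow> x \<in> S \<Longrightarrow> A i x = B i x) \<Longrightarrow>
   (\<And>i x. i \<in> {1..n} \<Longrightarrow> x \<in> S \<Longrightarrow> B i x \<in> S) \<Longrightarrow> x \<in> S \<Longrightarrow> opprod n A x = opprod n B x"
  by (induction n arbitrary: x) auto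

lemma opprod_intertwine:
  assumes "\<And>i x. i \<in> {1..n} \<Longrightarrow> x \<in> S \<Longrightarrow> C (A i x) = B i (C x)"
    and "\<And>i x. i \<in> {1..n} \<Longrightarrow> x \<in> S \<Longrightarrow> A i x \<in> S" and "x \<in> S"
  shows "C (opprod n A x) = opprod n B (C x)"
  using assms
proof (induction n arbitrary: x)
  case (Suc n)
  have "C (opprod n A (A (Suc n) x)) = opprod n B (C (A (Suc n) x))"
    by (rule Suc.IH) (use Suc.prems in auto)
  then show ?case using Suc.prems by simp
qed simp

lemma opprod_comp:
  assumes "\<And>i x. i \<in> {1..n} \<Longrightarrow> x \<in> S \<Longrightarrow> A i x \<in> S" "\<And>i x. i \<in> {1..n} \<Longrightarrow> x \<in> S \<Longrightarrow> B i x \<in> S"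
    and "\<And>i j x. i \<in> {1..n} \<Longrightarrow> j \<in> {1..n} \<Longrightarrow> x \<in> S \<Longrightarrow> A i (B j x) = B j (A i x)" and "x \<in> S"
  shows "opprod n (\<lambda>i y. A i (B i y)) x = opprod n A (opprod n B x)"
  using assms
proof (induction n arbitrary: x)
  case (Suc n)
  have "opprod n (\<lambda>i y. A i (B i y)) (A (Suc n) (B (Suc n) x)) =
      opprod n A (opprod n B (A (Suc n) (B (Suc n) x)))"
    by (rule Suc.IH) (use Suc.prems in auto)
  also have "opprod n B (A (Suc n) (B (Suc n) x)) = A (Suc n) (opprod n B (B (Suc n) x))"
    by (rule opprod_intertwine[where S=S, symmetric]) (use Suc.prems in auto)
  finally show ?case by simp
qed simp

lemma opprod_trivial: "(\<And>i. i \<in> {1..n} \<Longrightarrow> A i = id) \<Longrightarrow> opprod n A = id"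
  by (induction n) auto

lemma opprod_split_initial:
  assumes "m \<le> n" "\<And>i. i \<in> {1..m} \<Longrightarrow> B i = A i" "\<And>i. i \<in> {m<..n} \<Longrightarrow> B i = id"
  shows "opprod n B = opprod m A"
  using assms
proof (induction n)
  case (Suc n)
  have "opprod m B = opprod m A"
    using Suc.prems(2)
  proof (induction m)
    case (Suc m)
    have "opprod m B = opprod m A" by (rule Suc.IH) (use Suc.prems in auto)
    then show ?case using Suc.prems by simp
  qed simp
  with Suc show ?case by (cases "m = Suc n") auto
qed simp

lemma opprod_single:
  assumes "i \<in> {1..n}" "B i = A" "\<And>j. j \<in> {1..n} \<Longrightarrow> j \<noteq> i \<Longrightarrow> B j = id"
  shows "opprod n B = A"
proof -
  obtain k where k: "i = Suc k" using assms(1) by (cases i) auto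
  have "opprod n B = opprod i B"
    using assms by (intro opprod_split_initial) auto
  also have "\<dots> = opprod k B \<circ> B i" using k by simp
  also have "opprod k B = id" using assms k by (intro opprod_trivial) auto
  finally show ?thesis using assms(2) by simp
qed

lemma funpow_in: "(\<And>x. x \<in> S \<Longrightarrow> A x \<in> S) \<Longrightarrow> x \<in> S \<Longrightarrow> (A ^^ k) x \<in> S"
  by (induction k arbitrary: x) auto

lemma funpow_intertwine:
  "(\<And>x. x \<in> S \<Longrightarrow> C (A x) = B (C x)) \<Longrightarrow> (\<And>x. x \<in> S \<Longrightarrow> A x \<in> S) \<Longrightarrow> x \<in> S \<Longrightarrow>
   C ((A ^^ k) x) = (B ^^ k) (C x)"
proof (induction k arbitrary: x)
  case (Suc k)
  have "(A ^^ k) x \<in> S" by (rule funpow_in) (use Suc in auto)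
  then show ?case using Suc by simp
qed simp

lemma opprod_funpow:
  assumes "\<And>i x. i \<in> {1..n} \<Longrightarrow> x \<in> S \<Longrightarrow> A i x \<in> S"
    and "\<And>i j x. i \<in> {1..n} \<Longrightarrow> j \<in> {1..n} \<Longrightarrow> x \<in> S \<Longrightarrow> A i (A j x) = A j (A i x)" and "x \<in> S"
  shows "opprod n (\<lambda>i. A i ^^ k) x = (opprod n A ^^ k) x"
  using assms(3)
proof (induction k arbitrary: x)
  case 0
  show ?case using fun_cong[OF opprod_trivial[of n "\<lambda>i. A i ^^ 0"], of x]
    by (simp add: id_def)
next
  case (Suc k)
  have "opprod n (\<lambda>i. A i ^^ Suc k) x = opprod n (\<lambda>i y. A i ((A i ^^ k) y)) x"
    by (simp add: comp_def)
  also have "\<dots> = opprod n A (opprod n (\<lambda>i. A i ^^ k) x)"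
  proof (rule opprod_comp[where S=S])
    show "A i ((A j ^^ k) x) = (A j ^^ k) (A i x)"
      if "i \<in> {1..n}" "j \<in> {1..n}" "x \<in> S" for i j x
      by (rule funpow_intertwine[where S=S]) (use assms that in auto)
  qed (use assms Suc in \<open>auto intro: funpow_in\<close>)
  finally show ?case using Suc by (simp add: comp_def)
qed

lemma opprod_inverse:
  assumes A: "\<And>i x. i \<in> {1..n} \<Longrightarrow> x \<in> S \<Longrightarrow> A i x \<in> S"
    and B: "\<And>i x. i \<in> {1..n} \<Longrightarrow> x \<in> S \<Longrightarrow> B i x \<in> S"
    and AB: "\<And>i x. i \<in> {1..n} \<Longrightarrow> x \<in> S \<Longrightarrow> A i (B i x) = x"
    and BA: "\<And>i x. i \<in> {1..n} \<Longrightarrow> x \<in> S \<Longrightarrow> B i (A i x) = x"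
    and comm: "\<And>i j x. i \<in> {1..n} \<Longrightarrow> j \<in> {1..n} \<Longrightarrow> x \<in> S \<Longrightarrow> A i (A j x) = A j (A i x)"
    and x: "x \<in> S"
  shows "opprod n A (opprod n B x) = x"
proof -
  have "A i (B j x) = B j (A i x)" if "i \<in> {1..n}" "j \<in> {1..n}" "x \<in> S" for i j x
  proof -
    have "B j (A j (A i (B j x))) = A i (B j x)" using that A B BA by simp
    moreover have "A j (A i (B j x)) = A i x" using that comm[of j i "B j x"] A B AB by simp
    ultimately show ?thesis by simp
  qed
  then have "opprod n A (opprod n B x) = opprod n (\<lambda>i y. A i (B i y)) x"
    using A B x by (intro opprod_comp[where S=S, symmetric]) auto
  also have "\<dots> = opprod n (\<lambda>i. id) x"
    by (rule opprod_cong[where S=S]) (use AB x in auto)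
  also have "\<dots> = x" by (subst opprod_trivial) simp_all
  finally show ?thesis .
qed

text \<open>The product of the operators whose index lies in \<open>\<alpha>\<close>; all subproducts have length \<open>n\<close>, padded
  by identities, so that complementary ones multiply factor by factor.\<close>

definition subprod :: "nat \<Rightarrow> nat set \<Rightarrow> (nat \<Rightarrow> 'a \<Rightarrow> 'a) \<Rightarrow> 'a \<Rightarrow> 'a" where
  "subprod n \<alpha> A = opprod n (\<lambda>j. if j \<in> \<alpha> then A j else id)"

lemma subprod_single: "i \<in> {1..n} \<Longrightarrow> subprod n {i} A = A i"
  unfolding subprod_def by (rule opprod_single) auto

lemma subprod_initial: "m \<le> n \<Longrightarrow> subprod n {1..m} A = opprod m A"
  unfolding subprod_def by (rule opprod_split_initial) auto

lemma subprod_complement: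
  assumes "\<And>i x. i \<in> {1..n} \<Longrightarrow> x \<in> S \<Longrightarrow> A i x \<in> S"
    and "\<And>i j x. i \<in> {1..n} \<Longrightarrow> j \<in> {1..n} \<Longrightarrow> x \<in> S \<Longrightarrow> A i (A j x) = A j (A i x)" and "x \<in> S"
  shows "subprod n \<alpha> A (subprod n (- \<alpha>) A x) = opprod n A x"
proof -
  have "subprod n \<alpha> A (subprod n (- \<alpha>) A x) =
    opprod n (\<lambda>i y. (if i \<in> \<alpha> then A i else id) ((if i \<in> - \<alpha> then A i else id) y)) x"
    unfolding subprod_def using assms by (intro opprod_comp[where S=S, symmetric]) auto
  also have "(\<lambda>i y. (if i \<in> \<alpha> then A i else id) ((if i \<in> - \<alpha> then A i else id) y)) = A"
    by (auto simp: fun_eq_iff)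
  finally show ?thesis .
qed

text \<open>Exponents \<open>k + 1\<close> on \<open>\<alpha>\<close> and \<open>k\<close> elsewhere: this form of a monomial is the one in which the
  dilation property speaks about a subproduct composed with a power of the full product.\<close>

lemma subprod_funpow:
  assumes A: "\<And>i x. i \<in> {1..n} \<Longrightarrow> x \<in> S \<Longrightarrow> A i x \<in> S"
    and comm: "\<And>i j x. i \<in> {1..n} \<Longrightarrow> j \<in> {1..n} \<Longrightarrow> x \<in> S \<Longrightarrow> A i (A j x) = A j (A i x)" and "x \<in> S"
  shows "opprod n (\<lambda>i. A i ^^ (of_bool (i \<in> \<alpha>) + k)) x = subprod n \<alpha> A ((opprod n A ^^ k) x)"
proof -
  have "opprod n (\<lambda>i. A i ^^ (of_bool (i \<in> \<alpha>) + k)) x =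
      opprod n (\<lambda>i y. (if i \<in> \<alpha> then A i else id) ((A i ^^ k) y)) x"
    by (rule arg_cong2[where f="\<lambda>A x. opprod n A x"]) (auto simp: fun_eq_iff)
  also have "\<dots> = subprod n \<alpha> A (opprod n (\<lambda>i. A i ^^ k) x)"
    unfolding subprod_def
  proof (rule opprod_comp[where S=S])
    show "(if i \<in> \<alpha> then A i else id) ((A j ^^ k) x) = (A j ^^ k) ((if i \<in> \<alpha> then A i else id) x)"
      if "i \<in> {1..n}" "j \<in> {1..n}" "x \<in> S" for i j x
      using funpow_intertwine[where S=S and A="A j" and B="A j" and C="A i" and x=x and k=k] that A comm
      by auto
  qed (use assms in \<open>auto intro: funpow_in\<close>)
  also have "opprod n (\<lambda>i. A i ^^ k) x = (opprod n A ^^ k) x"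
    by (rule opprod_funpow[where S=S]) (use assms in auto)
  finally show ?thesis .
qed

section \<open>Projections and unitaries on a closed subspace\<close>

lemma
  assumes S: "closed_csubspace S" and P: "projection_on S P"
  shows projection_in: "x \<in> S \<Longrightarrow> P x \<in> S"
    and projection_blin: "blin_on S P"
    and projection_idem: "x \<in> S \<Longrightarrow> P (P x) = P x"
    and projection_cinner: "x \<in> S \<Longrightarrow> y \<in> S \<Longrightarrow> cinner (P x) y = cinner x (P y)"
proof -
  show 1: "blin_on S P" "x \<in> S \<Longrightarrow> P x \<in> S" "x \<in> S \<Longrightarrow> P (P x) = P x"
    using P by (auto simp: projection_on_def bounded_op_on_iff)
  show "x \<in> S \<Longrightarrow> y \<in> S \<Longrightarrow> cinner (P x) y = cinner x (P y)"
    using P adj_on_cinner[OF S 1(1), of x y] by (simp add: projection_on_def)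
qed

lemma
  assumes S: "closed_csubspace S" and U: "unitary_on S U"
  shows unitary_in: "x \<in> S \<Longrightarrow> U x \<in> S"
    and unitary_blin: "blin_on S U"
    and unitary_adj_in: "adj_on S U x \<in> S"
    and unitary_adj_blin: "blin_on S (adj_on S U)"
    and unitary_adj_left: "x \<in> S \<Longrightarrow> adj_on S U (U x) = x"
    and unitary_adj_right: "x \<in> S \<Longrightarrow> U (adj_on S U x) = x"
    and unitary_cinner: "x \<in> S \<Longrightarrow> cinner (U x) y = cinner x (adj_on S U y)"
    and unitary_adj_cinner: "x \<in> S \<Longrightarrow> cinner (adj_on S U y) x = cinner y (U x)"
proof -
  have op: "bounded_op_on S U" using U by (simp add: unitary_on_def)
  then show bl: "blin_on S U" and "x \<in> S \<Longrightarrow> U x \<in> S" by (auto simp: bounded_op_on_iff)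
  show "adj_on S U x \<in> S" by (rule adj_on_in[OF S bl])
  show "blin_on S (adj_on S U)" by (rule adj_on_blin[OF S op])
  show "x \<in> S \<Longrightarrow> cinner (U x) y = cinner x (adj_on S U y)" by (rule adj_on_cinner[OF S bl])
  show "x \<in> S \<Longrightarrow> cinner (adj_on S U y) x = cinner y (U x)" by (rule adj_on_cinner_left[OF S bl])
  show "x \<in> S \<Longrightarrow> adj_on S U (U x) = x" "x \<in> S \<Longrightarrow> U (adj_on S U x) = x"
    using U by (auto simp: unitary_on_def)
qed

text \<open>For \<open>y\<close> in the range of \<open>R l\<close>,
  \<open>\<parallel>y\<parallel>\<^sup>2 = \<Sum>\<^sub>k \<langle>R\<^sub>k y, y\<rangle> = \<Sum>\<^sub>k \<parallel>R\<^sub>k y\<parallel>\<^sup>2\<close>, and the summand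
  \<open>k = l\<close> already accounts for the whole of it.\<close>

lemma projections_sum_one_orthogonal:
  assumes I: "finite I" and S: "csubspace S"
    and R: "\<And>k x. k \<in> I \<Longrightarrow> x \<in> S \<Longrightarrow> R k x \<in> S"
    and idem: "\<And>k x. k \<in> I \<Longrightarrow> x \<in> S \<Longrightarrow> R k (R k x) = R k x"
    and sa: "\<And>k x y. k \<in> I \<Longrightarrow> x \<in> S \<Longrightarrow> y \<in> S \<Longrightarrow> cinner (R k x) y = cinner x (R k y)"
    and one: "\<And>x. x \<in> S \<Longrightarrow> (\<Sum>k\<in>I. R k x) = x"
    and k: "k \<in> I" and l: "l \<in> I" "k \<noteq> l" and x: "x \<in> S"
  shows "R k (R l x) = (0::'a::chilbert_space)"
proof -
  let ?y = "R l x"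
  have y: "?y \<in> S" using R l x by auto
  have sq: "cinner (R j ?y) ?y = of_real ((norm (R j ?y))\<^sup>2)" if "j \<in> I" for j
    using sa[OF that R[OF that y] y] that y idem by (metis cinner_self)
  have "complex_of_real ((norm ?y)\<^sup>2) = cinner (\<Sum>j\<in>I. R j ?y) ?y"
    by (simp only: one[OF y] cinner_self)
  also have "\<dots> = (\<Sum>j\<in>I. of_real ((norm (R j ?y))\<^sup>2))"
    by (simp only: cinner.sum_left) (rule sum.cong, auto simp: sq)
  finally have "complex_of_real ((norm ?y)\<^sup>2) = of_real (\<Sum>j\<in>I. (norm (R j ?y))\<^sup>2)" by simp
  then have "(norm ?y)\<^sup>2 = (\<Sum>j\<in>I. (norm (R j ?y))\<^sup>2)" by (simp only: of_real_eq_iff)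
  also have "\<dots> = (norm (R l ?y))\<^sup>2 + (\<Sum>j\<in>I - {l}. (norm (R j ?y))\<^sup>2)"
    using I l by (simp add: sum.remove)
  also have "R l ?y = ?y" using idem l x by simp
  finally have "(\<Sum>j\<in>I - {l}. (norm (R j ?y))\<^sup>2) = 0" by simp
  then have "(norm (R k ?y))\<^sup>2 = 0"
    using I k l by (subst (asm) sum_nonneg_eq_0_iff) auto
  then show ?thesis by simp
qed

text \<open>The relations say that the symbols \<open>E + z F\<close> and \<open>F\<^sup>* + z E\<^sup>*\<close> multiply to \<open>z I\<close> in
  either order; here \<open>E' = F\<^sup>*\<close> and \<open>F' = E\<^sup>*\<close>.\<close>

lemma projection_unitary_of_symbol:
  fixes E F E' F' :: "'a::chilbert_space \<Rightarrow> 'a"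
  assumes S: "closed_csubspace S"
    and op: "bounded_op_on S E" "bounded_op_on S F" "bounded_op_on S E'" "bounded_op_on S F'"
    and adj: "\<And>d e. d \<in> S \<Longrightarrow> e \<in> S \<Longrightarrow> cinner (F d) e = cinner d (E' e)"
      "\<And>d e. d \<in> S \<Longrightarrow> e \<in> S \<Longrightarrow> cinner (F' d) e = cinner d (E e)"
    and rel: "\<And>d. d \<in> S \<Longrightarrow> E (E' d) = 0" "\<And>d. d \<in> S \<Longrightarrow> F (E' d) + E (F' d) = d"
      "\<And>d. d \<in> S \<Longrightarrow> F (F' d) = 0"
    and rel': "\<And>d. d \<in> S \<Longrightarrow> E' (E d) = 0" "\<And>d. d \<in> S \<Longrightarrow> F' (E d) + E' (F d) = d"
      "\<And>d. d \<in> S \<Longrightarrow> F' (F d) = 0"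
  defines "P \<equiv> \<lambda>d. F (E' d)" and "U \<equiv> \<lambda>d. E' d + F' d"
  shows "projection_on S P" "unitary_on S U"
    and "d \<in> S \<Longrightarrow> adj_on S U d = E d + F d"
    and "d \<in> S \<Longrightarrow> P (adj_on S U d) = F d" "d \<in> S \<Longrightarrow> perp P (adj_on S U d) = E d"
    and "d \<in> S \<Longrightarrow> U (P d) = E' d"
proof -
  have sub: "csubspace S" using S by (simp add: closed_csubspace_def)
  have [simp]: "\<And>d. d \<in> S \<Longrightarrow> E d \<in> S" "\<And>d. d \<in> S \<Longrightarrow> F d \<in> S" "\<And>d. d \<in> S \<Longrightarrow> E' d \<in> S" "\<And>d. d \<in> S \<Longrightarrow> F' d \<in> S"
    and b: "blin_on S E" "blin_on S F" "blin_on S E'" "blin_on S F'"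
    using op by (auto simp: bounded_op_on_iff)
  note [simp] = csubspace_add[OF sub] rel(1,3) rel'(1,3)
  note add = blin_on_add[OF b(1)] blin_on_add[OF b(2)] blin_on_add[OF b(3)] blin_on_add[OF b(4)]
  have adj': "cinner (E d) e = cinner d (F' e)" if "d \<in> S" "e \<in> S" for d e
    by (rule cinner_swap[OF adj(2)[OF that(2,1), symmetric]])
  have adj'': "cinner (E' d) e = cinner d (F e)" if "d \<in> S" "e \<in> S" for d e
    by (rule cinner_swap[OF adj(1)[OF that(2,1), symmetric]])
  have FEF: "F (E' (F d)) = F d" if "d \<in> S" for d
    using rel(2)[of "F d"] that by (simp add: blin_on_zero[OF sub b(1)])
  have EFE: "E' (F (E' d)) = E' d" if "d \<in> S" for d
    using rel'(2)[of "E' d"] that by (simp add: blin_on_zero[OF sub b(4)])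
  have Pop: "bounded_op_on S P"
    unfolding P_def bounded_op_on_iff using blin_on_comp[OF b(3) _ b(2)] by simp
  moreover have "adj_on S P x = P x" if "x \<in> S" for x
    by (rule adj_on_eqI[OF sub]) (use that in \<open>auto simp: P_def adj adj''\<close>)
  ultimately show "projection_on S P"
    by (auto simp: projection_on_def) (simp add: P_def FEF)
  show star: "adj_on S U d = E d + F d" if "d \<in> S" for d
    by (rule adj_on_eqI[OF sub])
      (use that in \<open>auto simp: U_def cinner.add_left cinner.add_right adj adj' adj''\<close>)
  have "bounded_op_on S U"
    unfolding U_def bounded_op_on_iff using blin_on_plus[OF b(3,4)] by simp
  moreover have "adj_on S U (U x) = x" "U (adj_on S U x) = x" if x: "x \<in> S" for x
  proof -
    have "U x \<in> S" using x by (simp add: U_def)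
    then have "adj_on S U (U x) = E (U x) + F (U x)" by (rule star)
    also have "\<dots> = F (E' x) + E (F' x)" using x by (simp add: U_def add)
    finally show "adj_on S U (U x) = x" using rel(2)[OF x] by simp
    have "U (adj_on S U x) = U (E x + F x)" using star[OF x] by simp
    also have "\<dots> = F' (E x) + E' (F x)" using x by (simp add: U_def add)
    finally show "U (adj_on S U x) = x" using rel'(2)[OF x] by simp
  qed
  ultimately show "unitary_on S U" by (simp add: unitary_on_def)
  show P: "P (adj_on S U d) = F d" if "d \<in> S" for d
    using that by (simp add: star P_def add FEF blin_on_zero[OF sub b(2)])
  show "perp P (adj_on S U d) = E d" if "d \<in> S" for d
    using P[OF that] star[OF that] by (simp add: perp_def)
  show "U (P d) = E' d" if "d \<in> S"
    using that by (simp add: U_def P_def EFE)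
qed

section \<open>The structure of a minimal isometric dilation\<close>

text \<open>A minimal isometric dilation \<open>V\<close> on \<open>K\<close> of one contraction, with the embedding \<open>J\<close>. All of
  its structure is derived inside \<open>K\<close>; no model space is built.\<close>

locale minimal_dilation =
  fixes T :: "'h::chilbert_space \<Rightarrow> 'h" and K :: "'k::chilbert_space set"
    and J :: "'h \<Rightarrow> 'k" and V :: "'k \<Rightarrow> 'k"
  assumes contraction: "contraction T" and minimal: "minimal_isometric_dilation T K J V"
begin

abbreviation "D \<equiv> defect T"

abbreviation "DT \<equiv> defect_space T"

lemma T_blin: "blin_on UNIV T" using contraction by (rule contraction_blin)

lemma K_closed: "closed_csubspace K"
  and J_in [simp]: "J h \<in> K"
  and J_blin: "blin_on UNIV J"
  and J_norm: "norm (J h) = norm h"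
  and V_in [simp]: "x \<in> K \<Longrightarrow> V x \<in> K"
  and V_blin: "blin_on K V"
  and V_norm: "x \<in> K \<Longrightarrow> norm (V x) = norm x"
  using minimal
  unfolding minimal_isometric_dilation_def isometric_dilation_def isometry_on_def embedding_into_def
    bounded_op_on_iff by (auto intro!: blin_onI[where M=1])

lemma K_sub: "csubspace K" using K_closed by (simp add: closed_csubspace_def)

lemma UNIV_sub: "csubspace UNIV" by (simp add: csubspace_def)

lemma J_cinner: "cinner (J x) (J y) = cinner x y"
  by (rule isometric_cinner[OF UNIV_sub J_blin]) (auto simp: J_norm)

lemma J_inj: "J x = J y \<Longrightarrow> x = y"
  using J_norm[of "x - y"] blin_on_diff[OF UNIV_sub J_blin, of x y] by simp

lemma V_cinner: "x \<in> K \<Longrightarrow> y \<in> K \<Longrightarrow> cinner (V x) (V y) = cinner x y"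
  by (rule isometric_cinner[OF K_sub V_blin]) (auto simp: V_norm)

lemma Vpow_op: "bounded_op_on K (V ^^ k)"
  by (rule bounded_op_on_funpow) (simp add: bounded_op_on_iff V_blin)

lemma Vpow_in [simp]: "x \<in> K \<Longrightarrow> (V ^^ k) x \<in> K"
  and Vpow_blin: "blin_on K (V ^^ k)"
  using Vpow_op[of k] by (auto simp: bounded_op_on_iff)

lemma Vpow_cinner: "x \<in> K \<Longrightarrow> y \<in> K \<Longrightarrow> cinner ((V ^^ k) x) ((V ^^ k) y) = cinner x y"
  by (induction k) (auto simp: V_cinner)

lemma K_dense: "K = closure (cspan (range (\<lambda>(k, h). (V ^^ k) (J h))))"
proof -
  have "range (\<lambda>(k, h). (V ^^ k) (J h)) = {(V ^^ k) (J h) | k h. True}" by auto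
  then show ?thesis using minimal unfolding minimal_isometric_dilation_def by simp
qed

text \<open>Minimality in the form in which it is used: bounded operators on \<open>K\<close> are determined by their
  values on the vectors \<open>V\<^sup>k J h\<close>.\<close>

lemma K_eqI:
  assumes "blin_on K A" "blin_on K B" "\<And>k h. A ((V ^^ k) (J h)) = B ((V ^^ k) (J h))" "x \<in> K"
  shows "A x = B x"
  by (rule blin_on_eq_dense[OF K_dense assms(1,2)]) (use assms in auto)

lemma K_commute_eqI:
  assumes A: "blin_on K A" "\<And>x. x \<in> K \<Longrightarrow> A x \<in> K" "\<And>x. x \<in> K \<Longrightarrow> A (V x) = V (A x)"
    and B: "blin_on K B" "\<And>x. x \<in> K \<Longrightarrow> B x \<in> K" "\<And>x. x \<in> K \<Longrightarrow> B (V x) = V (B x)"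
    and eq: "\<And>h. A (J h) = B (J h)" and x: "x \<in> K"
  shows "A x = B x"
proof (rule K_eqI[OF A(1) B(1) _ x])
  fix k h
  show "A ((V ^^ k) (J h)) = B ((V ^^ k) (J h))"
    by (induction k) (auto simp: eq A(3) B(3))
qed

text \<open>The adjoint of the embedding; \<open>J (Jad x)\<close> is the projection of \<open>x\<close> onto the embedded space.\<close>

definition Jad :: "'k \<Rightarrow> 'h" where
  "Jad y = (SOME z. \<forall>h. cinner (J h) y = cinner h z)"

lemma Jad_cinner: "cinner (J h) y = cinner h (Jad y)"
proof -
  have "\<exists>z. \<forall>h. cinner (J h) y = cinner h z"
    using Riesz_adjoint[OF closed_csubspace_UNIV J_blin, of y] by auto
  from someI_ex[OF this] show ?thesis unfolding Jad_def by blast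
qed

lemma Jad_cinner_left: "cinner y (J h) = cinner (Jad y) h"
  by (metis Jad_cinner cinner_commute)

lemma Jad_eqI: "(\<And>h. cinner y (J h) = cinner z h) \<Longrightarrow> Jad y = z"
  by (rule cinner_ext[OF UNIV_sub]) (auto simp: Jad_cinner_left intro: cinner_swap)

lemma Jad_J [simp]: "Jad (J h) = h"
  by (rule Jad_eqI) (rule J_cinner)

lemma Jad_blin: "blin_on S Jad"
proof (rule blin_onI[where M=1])
  show "norm (Jad y) \<le> 1 * norm y" for y
    by (rule norm_le_by_duality[of _ "J (Jad y)"]) (auto simp: Jad_cinner J_norm)
qed (auto intro!: Jad_eqI simp: cinner.add_left cinner_scaleC_left simp flip: Jad_cinner_left)

lemma orth_proj_J: "orth_proj (range J) x = J (Jad x)"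
  by (rule orth_proj_eqI)
    (auto simp: csubspace_range[OF J_blin] cinner.diff_left Jad_cinner_left J_cinner)

lemma Jad_Vpow_J: "Jad ((V ^^ k) (J h)) = (T ^^ k) h"
proof -
  have "\<forall>(k :: nat \<Rightarrow> nat) h. J (opprod 1 (\<lambda>i. T ^^ k i) h) =
      orth_proj (range J) (opprod 1 (\<lambda>i. V ^^ k i) (J h))"
    using minimal unfolding minimal_isometric_dilation_def isometric_dilation_def by blast
  from this[rule_format, of "\<lambda>_. k" h] show ?thesis by (auto simp: orth_proj_J dest!: J_inj)
qed

text \<open>The embedded space is coinvariant for \<open>V\<close>. This strengthens the dilation property, and it depends
  on minimality.\<close>

lemma Jad_V: "x \<in> K \<Longrightarrow> Jad (V x) = T (Jad x)"
proof (rule K_eqI)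
  show "blin_on K (\<lambda>x. Jad (V x))" by (rule blin_on_comp[OF V_blin _ Jad_blin]) auto
  show "blin_on K (\<lambda>x. T (Jad x))" by (rule blin_on_comp[OF Jad_blin _ T_blin]) auto
  show "Jad (V ((V ^^ k) (J h))) = T (Jad ((V ^^ k) (J h)))" for k h
    using Jad_Vpow_J[of "Suc k" h] by (simp add: Jad_Vpow_J)
qed

text \<open>The orthogonal complement of the embedded space in \<open>K\<close>.\<close>

definition N :: "'k set" where "N = {x \<in> K. Jad x = 0}"

lemma N_in_K [simp]: "x \<in> N \<Longrightarrow> x \<in> K"
  and N_J: "x \<in> N \<Longrightarrow> cinner x (J g) = 0"
  and J_N: "x \<in> N \<Longrightarrow> cinner (J g) x = 0"
  by (simp_all add: N_def Jad_cinner Jad_cinner_left cinner.zero_left cinner.zero_right)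

lemma N_I: "x \<in> K \<Longrightarrow> \<forall>g. cinner x (J g) = 0 \<Longrightarrow> x \<in> N"
  using Jad_eqI[of x 0] unfolding N_def by (simp add: cinner.zero_left)

lemma V_N [simp]: "x \<in> N \<Longrightarrow> V x \<in> N"
  unfolding N_def by (simp add: Jad_V blin_on_zero[OF UNIV_sub T_blin])

lemma N_sub: "csubspace N"
  using K_sub unfolding csubspace_def N_def
  by (auto simp: blin_on_zero[OF UNIV_sub Jad_blin] blin_on_add[OF Jad_blin[of UNIV]]
      blin_on_scaleC[OF Jad_blin[of UNIV]] scaleC_zero_right)

lemma N_closed: "closed_csubspace N"
  unfolding closed_csubspace_def
proof
  show "closed N"
    unfolding closed_sequential_limits
  proof (intro allI impI, elim conjE)
    fix u l assume u: "\<forall>k. u k \<in> N" "u \<longlonglongrightarrow> l"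
    have "(\<lambda>k. Jad (u k)) \<longlonglongrightarrow> Jad l"
      by (rule blin_on_tendsto[OF UNIV_sub Jad_blin]) (use u in auto)
    moreover have "(\<lambda>k. Jad (u k)) = (\<lambda>_. 0)" using u unfolding N_def by auto
    ultimately have "Jad l = 0" by (simp add: LIMSEQ_const_iff)
    moreover have "l \<in> K" using K_closed u closed_sequentially[of K u l]
      by (auto simp: closed_csubspace_def)
    ultimately show "l \<in> N" unfolding N_def by simp
  qed
qed (rule N_sub)

lemma D_cinner: "cinner (D x) (D y) = cinner x y - cinner (T x) (T y)"
  and D_in [simp]: "D h \<in> DT"
  and DT_closed: "closed_csubspace DT"
  using contraction by (simp_all add: defect_cinner defect_in_space defect_space_closed)

lemma DT_sub: "csubspace DT" using DT_closed by (simp add: closed_csubspace_def)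

lemma DT_eqI:
  assumes "blin_on DT A" "blin_on DT B" "\<And>h. A (D h) = B (D h)" "d \<in> DT"
  shows "A d = B d"
  by (rule blin_on_eq_dense[OF defect_space_eq[OF contraction] assms(1,2)]) (use assms in auto)

text \<open>The copy of the defect space in \<open>N\<close>. It exists because
  \<open>\<parallel>V J h - J T h\<parallel>\<^sup>2 = \<parallel>h\<parallel>\<^sup>2 - \<parallel>T h\<parallel>\<^sup>2 = \<parallel>D h\<parallel>\<^sup>2\<close>.\<close>

definition L :: "'h \<Rightarrow> 'k" where
  "L = (SOME W. blin_on DT W \<and> (\<forall>d\<in>DT. norm (W d) = norm d) \<and>
     (\<forall>h. W (D h) = V (J h) - J (T h)) \<and> (\<forall>d\<in>DT. W d \<in> N))"

lemma L_blin: "blin_on DT L"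
  and L_norm: "d \<in> DT \<Longrightarrow> norm (L d) = norm d"
  and L_D: "L (D h) = V (J h) - J (T h)"
  and L_N [simp]: "d \<in> DT \<Longrightarrow> L d \<in> N"
proof -
  have *: "cinner (V (J h)) (J g) = cinner (T h) g" for h g
    by (simp add: Jad_cinner_left Jad_V)
  then have *: "cinner (V (J h)) (J g) = cinner (T h) g" "cinner (J g) (V (J h)) = cinner g (T h)" for h g
    by (auto simp: Jad_cinner Jad_V)
  have "\<exists>W. blin_on DT W \<and> (\<forall>d\<in>DT. norm (W d) = norm d) \<and>
     (\<forall>h. W (D h) = V (J h) - J (T h)) \<and> (\<forall>d\<in>DT. W d \<in> N)"
  proof (rule isometric_extension[OF _ defect_space_eq[OF contraction] N_closed])
    show "cinner (V (J h) - J (T h)) (V (J g) - J (T g)) = cinner (D h) (D g)" for h g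
      by (simp add: cinner.diff_left cinner.diff_right * J_cinner V_cinner D_cinner)
    show "V (J h) - J (T h) \<in> N" for h
      by (rule N_I) (auto simp: cinner.diff_left * J_cinner csubspace_diff[OF K_sub])
  qed
  from someI_ex[OF this] show "blin_on DT L" "d \<in> DT \<Longrightarrow> norm (L d) = norm d"
    "L (D h) = V (J h) - J (T h)" "d \<in> DT \<Longrightarrow> L d \<in> N"
    unfolding L_def by blast+
qed

lemma L_in [simp]: "d \<in> DT \<Longrightarrow> L d \<in> K" by simp

lemma L_cinner: "d \<in> DT \<Longrightarrow> e \<in> DT \<Longrightarrow> cinner (L d) (L e) = cinner d e"
  by (rule isometric_cinner[OF DT_sub L_blin]) (auto simp: L_norm)

lemma V_J: "V (J h) = J (T h) + L (D h)" by (simp add: L_D)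

text \<open>The copy of the defect space is orthogonal to \<open>V N\<close>, hence wandering for \<open>V\<close>.\<close>

lemma L_V_N: "d \<in> DT \<Longrightarrow> x \<in> N \<Longrightarrow> cinner (L d) (V x) = 0"
proof (rule DT_eqI[where B = "\<lambda>_. 0"])
  assume x: "x \<in> N"
  show "cinner (L (D h)) (V x) = 0" for h
    using x by (simp add: L_D cinner.diff_left V_cinner J_N)
qed (auto intro: blin_on_cinner L_blin blin_on_zero_fun)

lemma V_N_L: "d \<in> DT \<Longrightarrow> x \<in> N \<Longrightarrow> cinner (V x) (L d) = 0"
  using L_V_N cinner_eq_zero_swap by blast

text \<open>By induction on \<open>k\<close>, splitting \<open>V J h = J T h + L D h\<close>, each \<open>V\<^sup>k J h\<close> is a sum of
  vectors of the two kinds.\<close>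

lemma total:
  assumes r: "r \<in> K" and J: "\<And>g. cinner (J g) r = 0" and L: "\<And>m g. cinner ((V ^^ m) (L (D g))) r = 0"
  shows "r = 0"
proof -
  have "cinner ((V ^^ k) (J h)) r = 0" for k h
  proof (induction k arbitrary: h)
    case (Suc k)
    have "(V ^^ Suc k) (J h) = (V ^^ k) (J (T h)) + (V ^^ k) (L (D h))"
      by (simp only: funpow_Suc_right comp_apply V_J) (simp add: blin_on_add[OF Vpow_blin])
    then show ?case by (simp only: cinner.add_left Suc L add_0_right)
  qed (simp add: J)
  then have *: "\<And>k h. cinner ((V ^^ k) (J h)) r = 0" .
  have "cinner r r = 0"
    by (rule K_eqI[where A="\<lambda>x. cinner x r" and B="\<lambda>_. 0",
          OF blin_on_cinner[OF blin_on_id] blin_on_zero_fun * r])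
  then show ?thesis by (simp add: cinner_self)
qed

text \<open>The first step of the Wold decomposition of \<open>V\<close> on \<open>N\<close>. The components are the ones that Riesz'
  theorem assigns to \<open>x\<close>; the remainder is orthogonal to \<open>L DT\<close> and to \<open>V N\<close> and vanishes by
  totality.\<close>

lemma N_decomposition:
  assumes x: "x \<in> N"
  shows "\<exists>d\<in>DT. \<exists>x'\<in>N. x = L d + V x'"
proof -
  obtain d where d: "d \<in> DT" "\<forall>e\<in>DT. cinner (L e) x = cinner e d"
    using Riesz_adjoint[OF DT_closed L_blin] by blast
  have "blin_on N V" using V_blin by (rule blin_on_subset) auto
  from Riesz_adjoint[OF N_closed this]
  obtain x' where x': "x' \<in> N" "\<forall>y\<in>N. cinner (V y) x = cinner y x'" by blast
  define r where "r = x - (L d + V x')"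
  have rN: "r \<in> N" unfolding r_def
    by (intro csubspace_diff[OF N_sub] csubspace_add[OF N_sub] x L_N V_N d x')
  have "cinner ((V ^^ m) (L (D g))) r = 0" for m g
  proof (cases m)
    case 0
    then show ?thesis using d x'
      by (simp add: r_def cinner.diff_right cinner.add_right L_V_N L_cinner)
  next
    case (Suc k)
    have "(V ^^ k) (L (D g)) \<in> N" by (rule funpow_in) auto
    then show ?thesis using d x' Suc
      by (simp add: r_def cinner.diff_right cinner.add_right V_N_L V_cinner)
  qed
  then have "r = 0" using rN by (intro total) (auto simp: J_N)
  then show ?thesis using d x' by (auto simp: r_def)
qed

lemma L_V_zero:
  assumes "d \<in> DT" "x \<in> N" "L d + V x = 0"
  shows "d = 0" "x = 0"
proof -
  have "cinner (L d + V x) (L d) = 0" "cinner (L d + V x) (V x) = 0"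
    using assms by (simp_all add: cinner.zero_left)
  then show "d = 0" "x = 0" using assms(1,2) L_norm[of d] V_norm[of x]
    by (simp_all add: cinner.add_left cinner.zero_left L_V_N V_N_L L_cinner V_cinner cinner_self)
qed

lemma L_V_unique:
  assumes "d \<in> DT" "d' \<in> DT" "x \<in> N" "x' \<in> N" "L d + V x = L d' + V x'"
  shows "d = d'" "x = x'"
proof -
  have "L (d - d') + V (x - x') = 0"
    using assms
    by (simp add: blin_on_diff[OF DT_sub L_blin] blin_on_diff[OF K_sub V_blin] algebra_simps)
  from L_V_zero[OF csubspace_diff[OF DT_sub assms(1,2)] csubspace_diff[OF N_sub assms(3,4)] this]
  show "d = d'" "x = x'" by simp_all
qed

lemma Jad_N: "x \<in> N \<Longrightarrow> Jad x = 0" unfolding N_def by simp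

lemma Vpow_J_L:
  assumes d: "d \<in> DT"
  shows "cinner ((V ^^ Suc m) (J h)) (L d) = cinner (D ((T ^^ m) h)) d"
proof (induction m arbitrary: h)
  case 0
  then show ?case using d by (simp add: V_J cinner.add_left J_N L_cinner)
next
  case (Suc m)
  have "(V ^^ Suc (Suc m)) (J h) = (V ^^ Suc m) (J (T h)) + V ((V ^^ m) (L (D h)))"
    by (simp only: funpow_Suc_right[of "Suc m"] comp_apply V_J)
       (simp add: blin_on_add[OF Vpow_blin] blin_on_add[OF V_blin])
  moreover have "(V ^^ m) (L (D h)) \<in> N" by (rule funpow_in) auto
  ultimately have "cinner ((V ^^ Suc (Suc m)) (J h)) (L d) = cinner ((V ^^ Suc m) (J (T h))) (L d)"
    using d by (simp only: cinner.add_left V_N_L add_0_right)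
  also have "\<dots> = cinner (D ((T ^^ m) (T h))) d" by (rule Suc)
  finally show ?case by (simp only: funpow_Suc_right comp_apply)
qed

section \<open>Lifting commuting operators to the dilation space\<close>

text \<open>The lift is prescribed by \<open>X (V\<^sup>m J h) = V\<^sup>m B h\<close> with \<open>B h = J S h + L F D h\<close>. Since \<open>V\<close> is
  isometric, inner products need to be compared only against \<open>B g\<close>. For \<open>m = 0\<close> the claim is
  the hypothesis on \<open>F\<close>. For \<open>m > 0\<close> the vector \<open>V\<^sup>m L F D h\<close> contributes nothing, and
  the two remaining terms are \<open>\<langle>S T\<^sup>m h, S g\<rangle>\<close> and
  \<open>\<langle>D S T\<^sup>m\<^sup>-\<^sup>1 h, F D g\<rangle> = \<langle>F D T\<^sup>m h, F D g\<rangle>\<close>, by the hypothesis on \<open>D S\<close> and the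
  orthogonality of the ranges of \<open>E\<close> and \<open>F\<close>; their sum is \<open>\<langle>T\<^sup>m h, g\<rangle>\<close>.\<close>

theorem lift_exists:
  assumes S: "blin_on UNIV S" and comm: "\<And>h. S (T h) = T (S h)"
    and E: "bounded_op_on DT E" and F: "bounded_op_on DT F"
    and DS: "\<And>h. D (S h) = E (D h) + F (D (T h))"
    and FF: "\<And>h g. cinner (F (D h)) (F (D g)) = cinner h g - cinner (S h) (S g)"
    and EF: "\<And>d e. d \<in> DT \<Longrightarrow> e \<in> DT \<Longrightarrow> cinner (E d) (F e) = 0"
  shows "\<exists>X. isometry_on K X \<and> (\<forall>x\<in>K. X (V x) = V (X x)) \<and> (\<forall>h. X (J h) = J (S h) + L (F (D h))) \<and>
     (\<forall>x\<in>K. Jad (X x) = S (Jad x)) \<and> (\<forall>d\<in>DT. X (L d) = L (E d) + V (L (F d)))"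
proof -
  have Ein [simp]: "\<And>d. d \<in> DT \<Longrightarrow> E d \<in> DT" and Eb: "blin_on DT E"
    and Fin [simp]: "\<And>d. d \<in> DT \<Longrightarrow> F d \<in> DT" and Fb: "blin_on DT F"
    using E F by (auto simp: bounded_op_on_iff)
  (* the prescribed value of the lift at J h *)
  define B where "B h = J (S h) + L (F (D h))" for h
  have BK [simp]: "B h \<in> K" for h unfolding B_def by (rule csubspace_add[OF K_sub]) auto
  have SV: "S ((T ^^ m) h) = (T ^^ m) (S h)" for m h
    by (rule funpow_intertwine[where S=UNIV]) (auto simp: comm)
  have JadVB: "cinner ((V ^^ m) (J (S h))) (J (S g)) = cinner (S ((T ^^ m) h)) (S g)" for m h g
    by (simp add: Jad_cinner_left Jad_Vpow_J SV)
  have one: "cinner ((V ^^ m) (B h)) (B g) = cinner ((V ^^ m) (J h)) (J g)" for m h g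
  proof (cases m)
    case 0
    then show ?thesis
      by (simp add: B_def cinner.add_left cinner.add_right J_N N_J J_cinner L_cinner FF)
  next
    case (Suc k)
    have N: "(V ^^ k) (L (F (D h))) \<in> N" by (rule funpow_in) auto
    have "(V ^^ m) (B h) = (V ^^ m) (J (S h)) + V ((V ^^ k) (L (F (D h))))"
      using Suc unfolding B_def by (simp add: blin_on_add[OF Vpow_blin] blin_on_add[OF V_blin])
    then have "cinner ((V ^^ m) (B h)) (B g) =
        cinner ((V ^^ m) (J (S h))) (J (S g)) + cinner ((V ^^ m) (J (S h))) (L (F (D g)))"
      using N by (simp add: B_def cinner.add_left cinner.add_right N_J V_N_L)
    also have "cinner ((V ^^ m) (J (S h))) (L (F (D g))) = cinner (D (S ((T ^^ k) h))) (F (D g))"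
      using Vpow_J_L[of "F (D g)" k "S h"] Suc by (simp add: SV)
    also have "\<dots> = cinner (F (D ((T ^^ m) h))) (F (D g))"
      using Suc by (simp add: DS cinner.add_left EF)
    also have "cinner ((V ^^ m) (J (S h))) (J (S g)) = cinner (S ((T ^^ m) h)) (S g)" by (rule JadVB)
    finally show ?thesis by (simp add: FF Jad_cinner_left Jad_Vpow_J)
  qed
  have le: "cinner ((V ^^ k) (B h)) ((V ^^ l) (B g)) = cinner ((V ^^ k) (J h)) ((V ^^ l) (J g))"
    if "l \<le> k" for k l h g
  proof -
    have "(V ^^ k) x = (V ^^ l) ((V ^^ (k - l)) x)" for x
      using that by (metis comp_apply funpow_add le_add_diff_inverse)
    then show ?thesis by (simp add: Vpow_cinner one)
  qed
  have all: "cinner ((V ^^ k) (B h)) ((V ^^ l) (B g)) = cinner ((V ^^ k) (J h)) ((V ^^ l) (J g))"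
    for k l h g
  proof (cases "l \<le> k")
    case False
    then show ?thesis using le[of k l g h] by (intro cinner_swap[of "(V ^^ l) (B g)"]) simp
  qed (rule le)
  have "\<exists>X. blin_on K X \<and> (\<forall>z\<in>K. norm (X z) = norm z) \<and>
      (\<forall>i. X ((\<lambda>(k, h). (V ^^ k) (J h)) i) = (\<lambda>(k, h). (V ^^ k) (B h)) i) \<and> (\<forall>z\<in>K. X z \<in> K)"
    by (rule isometric_extension[OF _ K_dense K_closed]) (auto simp: all)
  then obtain X where X: "blin_on K X" "\<And>z. z \<in> K \<Longrightarrow> norm (X z) = norm z"
    "\<And>k h. X ((V ^^ k) (J h)) = (V ^^ k) (B h)" and XK [simp]: "\<And>z. z \<in> K \<Longrightarrow> X z \<in> K"
    by (auto 0 3)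
  have XJ: "X (J h) = B h" for h using X(3)[of 0 h] by simp
  have XV: "X (V x) = V (X x)" if "x \<in> K" for x
  proof (rule K_eqI[OF _ _ _ that])
    show "blin_on K (\<lambda>x. X (V x))" by (rule blin_on_comp[OF V_blin _ X(1)]) auto
    show "blin_on K (\<lambda>x. V (X x))" by (rule blin_on_comp[OF X(1) _ V_blin]) auto
    show "X (V ((V ^^ k) (J h))) = V (X ((V ^^ k) (J h)))" for k h
      using X(3)[of "Suc k" h] by (simp add: X(3))
  qed
  have JadX: "Jad (X x) = S (Jad x)" if "x \<in> K" for x
  proof (rule K_eqI[OF _ _ _ that])
    show "blin_on K (\<lambda>x. Jad (X x))" by (rule blin_on_comp[OF X(1) _ Jad_blin]) auto
    show "blin_on K (\<lambda>x. S (Jad x))" by (rule blin_on_comp[OF Jad_blin _ S]) auto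
    fix k h
    have "(V ^^ k) (L (F (D h))) \<in> N" by (rule funpow_in) auto
    then show "Jad (X ((V ^^ k) (J h))) = S (Jad ((V ^^ k) (J h)))"
      by (simp add: X(3) B_def blin_on_add[OF Vpow_blin] blin_on_add[OF Jad_blin[of UNIV]] Jad_N
          Jad_Vpow_J SV)
  qed
  have XL: "X (L d) = L (E d) + V (L (F d))" if "d \<in> DT" for d
  proof (rule DT_eqI[OF _ _ _ that])
    show "blin_on DT (\<lambda>d. X (L d))" by (rule blin_on_comp[OF L_blin _ X(1)]) auto
    show "blin_on DT (\<lambda>d. L (E d) + V (L (F d)))"
      by (intro blin_on_plus blin_on_comp[OF _ _ V_blin] blin_on_comp[OF _ _ L_blin] Eb Fb) auto
    fix h
    have "X (L (D h)) = V (B h) - B (T h)"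
      by (simp add: L_D blin_on_diff[OF K_sub X(1)] XV XJ)
    also have "\<dots> = L (D (S h)) + V (L (F (D h))) - L (F (D (T h)))"
      by (simp add: B_def blin_on_add[OF V_blin] V_J comm)
    also have "\<dots> = L (E (D h)) + V (L (F (D h)))"
      by (simp add: DS blin_on_add[OF L_blin])
    finally show "X (L (D h)) = L (E (D h)) + V (L (F (D h)))" .
  qed
  have "isometry_on K X" using X(1,2) by (simp add: isometry_on_def bounded_op_on_iff)
  with XV JadX XL XJ show ?thesis unfolding B_def by blast
qed

section \<open>Operators with a linear symbol\<close>

text \<open>Under the identification of \<open>N\<close> with the \<open>\<D>\<^sub>T\<close>-valued Hardy space, in which \<open>V\<close> becomes
  multiplication by \<open>z\<close>, an operator \<open>X\<close> that commutes with \<open>V\<close> and satisfies this equation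
  is multiplication by the polynomial \<open>E + z F\<close>.\<close>

definition has_symbol where
  "has_symbol X E F \<longleftrightarrow> bounded_op_on DT E \<and> bounded_op_on DT F \<and>
     (\<forall>d\<in>DT. X (L d) = L (E d) + V (L (F d)))"

lemma
  assumes "has_symbol X E F"
  shows symbol_in0: "d \<in> DT \<Longrightarrow> E d \<in> DT" and symbol_in1: "d \<in> DT \<Longrightarrow> F d \<in> DT"
    and symbol_blin0: "blin_on DT E" and symbol_blin1: "blin_on DT F"
    and symbol_L: "d \<in> DT \<Longrightarrow> X (L d) = L (E d) + V (L (F d))"
  using assms by (auto simp: has_symbol_def bounded_op_on_iff)

lemma symbol_comp:
  assumes X: "blin_on K X" "\<And>x. x \<in> K \<Longrightarrow> X (V x) = V (X x)"
    and XE: "has_symbol X E F" and YE: "has_symbol Y E' F'" and d: "d \<in> DT"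
  shows "X (Y (L d)) = L (E (E' d)) + V (L (F (E' d) + E (F' d))) + V (V (L (F (F' d))))"
  using d
  by (simp add: symbol_L[OF YE] symbol_L[OF XE] symbol_in0[OF YE] symbol_in1[OF YE]
      symbol_in0[OF XE] symbol_in1[OF XE] blin_on_add[OF X(1)] X(2) blin_on_add[OF V_blin]
      blin_on_add[OF L_blin])

lemma quadratic_unique:
  assumes "a \<in> DT" "b \<in> DT" "c \<in> DT" "a' \<in> DT" "b' \<in> DT" "c' \<in> DT"
    and "L a + V (L b) + V (V (L c)) = L a' + V (L b') + V (V (L c'))"
  shows "a = a'" "b = b'" "c = c'"
proof -
  have N: "L b + V (L c) \<in> N" "L b' + V (L c') \<in> N"
    using assms by (auto intro!: csubspace_add[OF N_sub])
  have "L a + V (L b + V (L c)) = L a' + V (L b' + V (L c'))"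
    using assms by (simp add: blin_on_add[OF V_blin] add.assoc)
  from L_V_unique[OF assms(1,4) N this] have a: "a = a'" and "L b + V (L c) = L b' + V (L c')" .
  from L_V_unique[OF assms(2,5) _ _ this(2)] assms have "b = b'" "L c = L c'" by auto
  moreover from this L_V_unique[OF assms(3,6), of 0 0] have "c = c'"
    using csubspace_zero[OF N_sub] by simp
  ultimately show "a = a'" "b = b'" "c = c'" using a by auto
qed

lemma linear_unique:
  assumes "a \<in> DT" "b \<in> DT" "a' \<in> DT" "b' \<in> DT" "L a + V (L b) = L a' + V (L b')"
  shows "a = a'" "b = b'"
  using quadratic_unique[of a b 0 a' b' 0] assms csubspace_zero[OF DT_sub] by auto

lemma L_inj: "a \<in> DT \<Longrightarrow> b \<in> DT \<Longrightarrow> L a = L b \<Longrightarrow> a = b"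
  using linear_unique(1)[of a 0 b 0] csubspace_zero[OF DT_sub] by simp

lemma DT_zeroI: "r \<in> DT \<Longrightarrow> (\<And>g. cinner (D g) r = 0) \<Longrightarrow> r = 0"
proof -
  assume r: "r \<in> DT" "\<And>g. cinner (D g) r = 0"
  have "cinner r r = 0"
    by (rule DT_eqI[where A="\<lambda>x. cinner x r" and B="\<lambda>_. 0",
          OF blin_on_cinner[OF blin_on_id] blin_on_zero_fun r(2,1)])
  then show ?thesis by (simp add: cinner_self)
qed

end

section \<open>Products of lifted operators\<close>

text \<open>Operators on \<open>K\<close> whose symbols are the linear polynomials
  \<open>P\<^sub>i\<^sup>\<bottom> U\<^sub>i\<^sup>* + z P\<^sub>i U\<^sub>i\<^sup>*\<close>. Both directions of the theorem produce such a family, and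
  the normalisation is studied for it.\<close>

locale lifted_data = minimal_dilation +
  fixes n :: nat and X P U
  assumes P: "i \<in> {1..n} \<Longrightarrow> projection_on DT (P i)"
    and U: "i \<in> {1..n} \<Longrightarrow> unitary_on DT (U i)"
    and U_comm: "commuting_on DT n U"
    and X: "i \<in> {1..n} \<Longrightarrow> bounded_op_on K (X i)"
    and X_V: "i \<in> {1..n} \<Longrightarrow> x \<in> K \<Longrightarrow> X i (V x) = V (X i x)"
    and X_L: "i \<in> {1..n} \<Longrightarrow> d \<in> DT \<Longrightarrow>
      X i (L d) = L (perp (P i) (adj_on DT (U i) d)) + V (L (P i (adj_on DT (U i) d)))"
begin

abbreviation "star i \<equiv> adj_on DT (U i)"

lemmas P_in [simp] = projection_in[OF DT_closed P]
  and P_blin = projection_blin[OF DT_closed P]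
  and P_idem = projection_idem[OF DT_closed P]
  and P_cinner = projection_cinner[OF DT_closed P]
  and U_in [simp] = unitary_in[OF DT_closed U]
  and U_blin = unitary_blin[OF DT_closed U]
  and star_in [simp] = unitary_adj_in[OF DT_closed U]
  and star_blin = unitary_adj_blin[OF DT_closed U]
  and star_U [simp] = unitary_adj_left[OF DT_closed U]
  and U_star [simp] = unitary_adj_right[OF DT_closed U]
  and U_cinner = unitary_cinner[OF DT_closed U]
  and star_cinner = unitary_adj_cinner[OF DT_closed U]

lemma U_comm': "i \<in> {1..n} \<Longrightarrow> j \<in> {1..n} \<Longrightarrow> x \<in> DT \<Longrightarrow> U i (U j x) = U j (U i x)"
  using U_comm by (auto simp: commuting_on_def)

lemma star_comm:
  assumes "i \<in> {1..n}" "j \<in> {1..n}" "x \<in> DT"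
  shows "star i (star j x) = star j (star i x)"
proof (rule cinner_ext[OF DT_sub])
  show "cinner y (star i (star j x)) = cinner y (star j (star i x))" if "y \<in> DT" for y
    using assms that U_comm'[OF assms(1,2) that] by (simp flip: U_cinner)
qed (use assms in auto)

text \<open>Partial products of the adjoint unitaries; \<open>Aprod\<close> and \<open>R\<close> below are the other ingredients of
  \<open>product_normalised\<close>.\<close>

definition Astar where "Astar m = opprod m star"

definition Aprod where "Aprod m = opprod m U"

definition R where "R k x = Astar (k - 1) (P k (Aprod (k - 1) x))"

definition Rsum where "Rsum m x = (\<Sum>k=1..m. R k x)"

lemma Astar_op: "m \<le> n \<Longrightarrow> bounded_op_on DT (Astar m)"
  unfolding Astar_def by (rule bounded_op_on_opprod) (auto simp: bounded_op_on_iff star_blin)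

lemma Aprod_op: "m \<le> n \<Longrightarrow> bounded_op_on DT (Aprod m)"
  unfolding Aprod_def by (rule bounded_op_on_opprod) (auto simp: bounded_op_on_iff U_blin)

lemma Astar_in [simp]: "m \<le> n \<Longrightarrow> d \<in> DT \<Longrightarrow> Astar m d \<in> DT"
  and Astar_blin: "m \<le> n \<Longrightarrow> blin_on DT (Astar m)"
  using Astar_op by (auto simp: bounded_op_on_iff)

lemma Aprod_in [simp]: "m \<le> n \<Longrightarrow> d \<in> DT \<Longrightarrow> Aprod m d \<in> DT"
  and Aprod_blin: "m \<le> n \<Longrightarrow> blin_on DT (Aprod m)"
  using Aprod_op by (auto simp: bounded_op_on_iff)

lemma Aprod_Astar [simp]: "m \<le> n \<Longrightarrow> d \<in> DT \<Longrightarrow> Aprod m (Astar m d) = d"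
  unfolding Astar_def Aprod_def
  by (rule opprod_inverse[where S=DT]) (auto simp: U_comm')

lemma Astar_Aprod [simp]: "m \<le> n \<Longrightarrow> d \<in> DT \<Longrightarrow> Astar m (Aprod m d) = d"
  unfolding Astar_def Aprod_def
  by (rule opprod_inverse[where S=DT]) (auto simp: star_comm)

lemma Astar_cinner:
  "m \<le> n \<Longrightarrow> x \<in> DT \<Longrightarrow> y \<in> DT \<Longrightarrow> cinner (Astar m x) y = cinner x (Aprod m y)"
proof (induction m arbitrary: x)
  case (Suc m)
  have S: "Suc m \<in> {1..n}" using Suc.prems by simp
  have "cinner (Astar (Suc m) x) y = cinner (Astar m (star (Suc m) x)) y" by (simp add: Astar_def)
  also have "\<dots> = cinner (star (Suc m) x) (Aprod m y)" using Suc S by simp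
  also have "\<dots> = cinner x (U (Suc m) (Aprod m y))" using Suc S by (simp add: star_cinner)
  also have "U (Suc m) (Aprod m y) = Aprod m (U (Suc m) y)" unfolding Aprod_def
    by (rule opprod_intertwine[where S=DT]) (use Suc.prems S U_comm' in auto)
  finally show ?case by (simp add: Aprod_def)
qed (simp add: Astar_def Aprod_def)

lemma R_in [simp]: "k \<in> {1..n} \<Longrightarrow> d \<in> DT \<Longrightarrow> R k d \<in> DT"
  unfolding R_def by auto

lemma R_blin: "k \<in> {1..n} \<Longrightarrow> blin_on DT (R k)"
  unfolding R_def
  by (rule blin_on_comp[OF blin_on_comp[OF Aprod_blin _ P_blin] _ Astar_blin]) auto

lemma Rsum_in [simp]: "m \<le> n \<Longrightarrow> d \<in> DT \<Longrightarrow> Rsum m d \<in> DT"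
  unfolding Rsum_def by (rule csubspace_sum[OF DT_sub]) auto

lemma Rsum_Suc: "Rsum (Suc m) d = Rsum m d + R (Suc m) d"
  by (simp add: Rsum_def)

lemma Rsum_blin: "m \<le> n \<Longrightarrow> blin_on DT (Rsum m)"
proof (induction m)
  case 0
  then show ?case by (simp add: Rsum_def blin_on_zero_fun)
next
  case (Suc m)
  then have "blin_on DT (\<lambda>d. Rsum m d + R (Suc m) d)"
    by (intro blin_on_plus R_blin Suc.IH) auto
  then show ?case by (simp add: Rsum_Suc[abs_def])
qed

lemma R_idem: "k \<in> {1..n} \<Longrightarrow> d \<in> DT \<Longrightarrow> R k (R k d) = R k d"
  unfolding R_def by (auto simp: P_idem)

lemma R_cinner: "k \<in> {1..n} \<Longrightarrow> x \<in> DT \<Longrightarrow> y \<in> DT \<Longrightarrow> cinner (R k x) y = cinner x (R k y)"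
proof -
  assume k: "k \<in> {1..n}" and x: "x \<in> DT" and y: "y \<in> DT"
  have "cinner (Aprod (k - 1) x) z = cinner x (Astar (k - 1) z)" if "z \<in> DT" for z
    using k x that by (intro cinner_swap[of z] Astar_cinner[symmetric]) auto
  then show ?thesis unfolding R_def using k x y by (auto simp: Astar_cinner P_cinner)
qed

abbreviation "E i d \<equiv> perp (P i) (star i d)"

abbreviation "F i d \<equiv> P i (star i d)"

lemma E_in [simp]: "i \<in> {1..n} \<Longrightarrow> d \<in> DT \<Longrightarrow> E i d \<in> DT"
  unfolding perp_def by (auto intro!: csubspace_diff[OF DT_sub])

lemma opprod_X_op: "m \<le> n \<Longrightarrow> bounded_op_on K (opprod m X)"
  by (rule bounded_op_on_opprod) (auto intro: X)

lemma opprod_X_V: "m \<le> n \<Longrightarrow> x \<in> K \<Longrightarrow> opprod m X (V x) = V (opprod m X x)"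
  by (rule opprod_intertwine[where S=K, symmetric])
     (use X in \<open>auto simp: X_V bounded_op_on_iff\<close>)

lemma Astar_Suc: "Astar (Suc m) d = Astar m (star (Suc m) d)"
  by (simp add: Astar_def)

lemma R_Suc_Astar:
  assumes "m < n" "d \<in> DT"
  shows "R (Suc m) (Astar (Suc m) d) = Astar m (F (Suc m) d)"
  using assms by (simp add: R_def Astar_Suc)

text \<open>One more factor, with the part of degree two displayed. When that part vanishes, the symbol of the
  partial product keeps the shape \<open>((I - S\<^sub>m) + z S\<^sub>m) A\<^sub>m\<close>.\<close>

lemma opprod_X_L_step:
  assumes m: "m < n" and d: "d \<in> DT"
    and IH: "\<And>d. d \<in> DT \<Longrightarrow>
      opprod m X (L d) = L (Astar m d - Rsum m (Astar m d)) + V (L (Rsum m (Astar m d)))"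
  shows "opprod (Suc m) X (L d) =
      L (Astar (Suc m) d - Rsum (Suc m) (Astar (Suc m) d) + Rsum m (Astar m (F (Suc m) d)))
      + V (L (Rsum (Suc m) (Astar (Suc m) d) - Rsum m (Astar m (F (Suc m) d))
               - Rsum m (Astar m (F (Suc m) d))))
      + V (V (L (Rsum m (Astar m (F (Suc m) d)))))"
proof -
  let ?e = "E (Suc m) d" and ?f = "F (Suc m) d"
  have [simp]: "?e \<in> DT" "?f \<in> DT" using m d by auto
  have mn: "m \<le> n" using m by simp
  have Xb: "blin_on K (opprod m X)" using opprod_X_op[OF mn] by (simp add: bounded_op_on_iff)
  define a b c c' where "a = Astar m ?e" "b = Rsum m a" "c = Astar m ?f" "c' = Rsum m c"
  note abc = a_b_c_c'_def
  have [simp]: "a \<in> DT" "b \<in> DT" "c \<in> DT" "c' \<in> DT" using mn by (auto simp: abc)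
  have "star (Suc m) d = ?e + ?f" by (simp add: perp_def)
  then have A: "Astar (Suc m) d = a + c"
    using blin_on_add[OF Astar_blin[OF mn], of ?e ?f] by (simp add: Astar_def abc)
  have S: "Rsum (Suc m) (Astar (Suc m) d) = b + c' + c"
    using R_Suc_Astar[OF m d] blin_on_add[OF Rsum_blin[OF mn], of a c]
    by (simp add: Rsum_Suc A) (simp add: abc)
  have "opprod (Suc m) X (L d) = opprod m X (L ?e + V (L ?f))"
    using m d by (simp add: X_L)
  also have "\<dots> = opprod m X (L ?e) + V (opprod m X (L ?f))"
    by (simp add: blin_on_add[OF Xb] opprod_X_V[OF mn])
  also have "\<dots> = (L (a - b) + V (L b)) + V (L (c - c') + V (L c'))"
    by (simp add: IH abc)
  also have "\<dots> = L (a - b) + V (L (b + c - c')) + V (V (L c'))"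
    by (simp add: blin_on_add[OF V_blin] blin_on_add[OF L_blin] blin_on_diff[OF DT_sub L_blin]
        blin_on_diff[OF K_sub V_blin] csubspace_add[OF DT_sub] csubspace_diff[OF DT_sub]
        csubspace_diff[OF K_sub] csubspace_add[OF K_sub])
  finally show ?thesis unfolding A[symmetric] S
    by (simp add: S A) (simp add: abc algebra_simps)
qed

lemma opprod_X_L_0: "opprod 0 X (L d) = L (Astar 0 d - Rsum 0 (Astar 0 d)) + V (L (Rsum 0 (Astar 0 d)))"
  by (simp add: Astar_def Rsum_def blin_on_zero[OF DT_sub L_blin] blin_on_zero[OF K_sub V_blin])

text \<open>The part of degree two vanishes at every stage because the partial products have linear symbols by
  hypothesis. At the last stage, comparison with the symbol \<open>z I\<close> of \<open>V\<close> leaves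
  \<open>S\<^sub>n A\<^sub>n = I\<close> and \<open>A\<^sub>n = S\<^sub>n A\<^sub>n\<close>.\<close>

lemma product_V_imp_normalised:
  assumes sym: "\<And>m. m \<le> n \<Longrightarrow> \<exists>E' F'. has_symbol (opprod m X) E' F'"
    and prod: "\<And>x. x \<in> K \<Longrightarrow> opprod n X x = V x" and d: "d \<in> DT"
  shows "Aprod n d = d" "Rsum n d = d"
proof -
  have formula: "opprod m X (L d) = L (Astar m d - Rsum m (Astar m d)) + V (L (Rsum m (Astar m d)))"
    if "m \<le> n" "d \<in> DT" for m d
    using that
  proof (induction m arbitrary: d)
    case 0
    show ?case by (rule opprod_X_L_0)
  next
    case (Suc m)
    then have m: "m < n" by simp
    let ?c = "Rsum m (Astar m (F (Suc m) d))"
    have step: "opprod (Suc m) X (L d) =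
      L (Astar (Suc m) d - Rsum (Suc m) (Astar (Suc m) d) + ?c)
      + V (L (Rsum (Suc m) (Astar (Suc m) d) - ?c - ?c)) + V (V (L ?c))"
      by (rule opprod_X_L_step[OF m]) (use Suc in auto)
    obtain E' F' where sy: "has_symbol (opprod (Suc m) X) E' F'" using sym Suc.prems by blast
    have "opprod (Suc m) X (L d) = L (E' d) + V (L (F' d)) + V (V (L 0))"
      using symbol_L[OF sy] Suc.prems
      by (simp add: blin_on_zero[OF DT_sub L_blin] blin_on_zero[OF K_sub V_blin])
    note eq = trans[OF step[symmetric] this]
    have c: "?c \<in> DT" and a: "Astar (Suc m) d \<in> DT" "Rsum (Suc m) (Astar (Suc m) d) \<in> DT"
      using Suc.prems m by auto
    have "?c = 0"
      by (rule quadratic_unique(3)[OF csubspace_add[OF DT_sub csubspace_diff[OF DT_sub a] c]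
            csubspace_diff[OF DT_sub csubspace_diff[OF DT_sub a(2) c] c] c
            symbol_in0[OF sy] symbol_in1[OF sy] csubspace_zero[OF DT_sub] eq]) (rule Suc.prems)+
    with step show ?case
      by (simp add: blin_on_zero[OF DT_sub L_blin] blin_on_zero[OF K_sub V_blin])
  qed
  have *: "Astar n d - Rsum n (Astar n d) = 0" "Rsum n (Astar n d) = d" if d: "d \<in> DT" for d
  proof -
    have "L (Astar n d - Rsum n (Astar n d)) + V (L (Rsum n (Astar n d))) = L 0 + V (L d)"
      using formula[of n d] prod[of "L d"] d by (simp add: blin_on_zero[OF DT_sub L_blin])
    from linear_unique[OF _ _ _ _ this]
    show "Astar n d - Rsum n (Astar n d) = 0" "Rsum n (Astar n d) = d"
      using d csubspace_diff[OF DT_sub] csubspace_zero[OF DT_sub] by auto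
  qed
  then have Ad: "Astar n d = d" if "d \<in> DT" for d using that by simp
  show "Rsum n d = d" using *(2)[OF d] Ad[OF d] by simp
  show "Aprod n d = d" using Aprod_Astar[of n d] Ad[OF d] d by simp
qed

text \<open>Here the part of degree two is \<open>S\<^sub>m R\<^sub>m\<^sub>+\<^sub>1\<close> up to a unitary, and it vanishes because the
  projections \<open>R\<^sub>k\<close> add up to \<open>I\<close> and hence are mutually orthogonal.\<close>

lemma normalised_imp_product_V:
  assumes U1: "\<And>d. d \<in> DT \<Longrightarrow> Aprod n d = d" and R1: "\<And>d. d \<in> DT \<Longrightarrow> Rsum n d = d"
    and d: "d \<in> DT"
  shows "opprod n X (L d) = V (L d)"
proof -
  have orth: "R k (R l d) = 0" if "k \<in> {1..n}" "l \<in> {1..n}" "k \<noteq> l" "d \<in> DT" for k l d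
    by (rule projections_sum_one_orthogonal[of "{1..n}" DT R])
       (use that R1 in \<open>auto simp: DT_sub R_idem R_cinner Rsum_def\<close>)
  have "opprod m X (L d) = L (Astar m d - Rsum m (Astar m d)) + V (L (Rsum m (Astar m d)))"
    if "m \<le> n" "d \<in> DT" for m d
    using that
  proof (induction m arbitrary: d)
    case 0
    show ?case by (rule opprod_X_L_0)
  next
    case (Suc m)
    then have m: "m < n" by simp
    have "Rsum m (R (Suc m) x) = 0" if "x \<in> DT" for x
      unfolding Rsum_def using orth[of _ "Suc m" x] m that by (intro sum.neutral) auto
    then have c: "Rsum m (Astar m (F (Suc m) d)) = 0"
      using R_Suc_Astar[OF m, of d, symmetric] Suc.prems by simp
    have "opprod (Suc m) X (L d) =
      L (Astar (Suc m) d - Rsum (Suc m) (Astar (Suc m) d) + Rsum m (Astar m (F (Suc m) d)))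
      + V (L (Rsum (Suc m) (Astar (Suc m) d) - Rsum m (Astar m (F (Suc m) d))
               - Rsum m (Astar m (F (Suc m) d))))
      + V (V (L (Rsum m (Astar m (F (Suc m) d)))))"
      by (rule opprod_X_L_step[OF m]) (use Suc in auto)
    then show ?case unfolding c
      by (simp add: blin_on_zero[OF DT_sub L_blin] blin_on_zero[OF K_sub V_blin])
  qed
  moreover have "Astar n d = d" using U1 Astar_Aprod[of n d] d by simp
  ultimately show ?thesis using R1[OF d] d
    by (simp add: blin_on_zero[OF DT_sub L_blin])
qed

text \<open>It remains to treat the embedded space. Put \<open>\<nu> h = (X - V) J h\<close>, a vector of \<open>N\<close>. It satisfies
  \<open>V (\<nu> h) = \<nu> (T h)\<close>, because \<open>X\<close> and \<open>V\<close> agree on \<open>L D h\<close>. For \<open>y \<in> N\<close> with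
  \<open>X y = V y\<close> both \<open>X J h\<close> and \<open>V J h\<close> are orthogonal to \<open>V y\<close>, so \<open>\<nu> (T h)\<close> is
  orthogonal to \<open>V y\<close> and \<open>\<nu> h\<close> is orthogonal to \<open>y\<close>. The vectors \<open>V\<^sup>m L D g\<close> are
  such \<open>y\<close>, and by totality \<open>\<nu> h = 0\<close>.\<close>

lemma normalised_imp_product_V_everywhere:
  assumes nrm: "\<And>d. d \<in> DT \<Longrightarrow> Aprod n d = d" "\<And>d. d \<in> DT \<Longrightarrow> Rsum n d = d"
    and iso: "\<And>x. x \<in> K \<Longrightarrow> norm (opprod n X x) = norm x"
    and Jad_X: "\<And>x. x \<in> K \<Longrightarrow> Jad (opprod n X x) = T (Jad x)"
    and x: "x \<in> K"
  shows "opprod n X x = V x"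
proof -
  let ?X = "opprod n X"
  have Xin [simp]: "\<And>x. x \<in> K \<Longrightarrow> ?X x \<in> K" and Xb: "blin_on K ?X"
    using opprod_X_op[of n] by (auto simp: bounded_op_on_iff)
  have XV: "\<And>x. x \<in> K \<Longrightarrow> ?X (V x) = V (?X x)" by (rule opprod_X_V) auto
  have XL: "\<And>d. d \<in> DT \<Longrightarrow> ?X (L d) = V (L d)"
    by (rule normalised_imp_product_V) (use nrm in auto)
  have Xc: "\<And>x y. x \<in> K \<Longrightarrow> y \<in> K \<Longrightarrow> cinner (?X x) (?X y) = cinner x y"
    by (rule isometric_cinner[OF K_sub Xb iso])
  define \<nu> where "\<nu> h = ?X (J h) - V (J h)" for h
  have \<nu>K [simp]: "\<nu> h \<in> K" for h unfolding \<nu>_def by (rule csubspace_diff[OF K_sub]) auto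
  have "Jad (\<nu> h) = 0" for h
    by (simp add: \<nu>_def blin_on_diff[OF UNIV_sub Jad_blin] Jad_X Jad_V)
  then have \<nu>N [simp]: "\<nu> h \<in> N" for h unfolding N_def by simp
  have V\<nu>: "V (\<nu> h) = \<nu> (T h)" for h
  proof -
    have "V (?X (J h)) = ?X (J (T h)) + V (L (D h))"
      by (simp add: XV[symmetric] V_J blin_on_add[OF Xb] XL)
    moreover have "V (V (J h)) = V (J (T h)) + V (L (D h))"
      by (simp add: V_J[of h] blin_on_add[OF V_blin])
    ultimately show ?thesis by (simp add: \<nu>_def blin_on_diff[OF K_sub V_blin])
  qed
  have pos: "cinner (V y) (\<nu> h) = 0" if y: "y \<in> N" "?X y = V y" for y h
  proof -
    have "cinner (V y) (?X (J h)) = cinner (?X y) (?X (J h))" by (simp only: y(2))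
    also have "\<dots> = 0" using y(1) by (simp add: Xc N_J)
    finally show ?thesis using y by (simp add: \<nu>_def cinner.diff_right V_cinner N_J)
  qed
  have "\<nu> h = 0" for h
  proof (rule total)
    fix m g
    have XVm: "?X ((V ^^ k) (L (D g))) = V ((V ^^ k) (L (D g)))" for k
      by (induction k) (auto simp: XL XV)
    have Nk: "(V ^^ k) (L (D g)) \<in> N" for k by (rule funpow_in) auto
    have "cinner (V ((V ^^ m) (L (D g)))) (V (\<nu> h)) = 0"
      unfolding V\<nu> by (rule pos[OF Nk XVm])
    then show "cinner ((V ^^ m) (L (D g))) (\<nu> h) = 0" by (simp add: V_cinner)
  qed (auto simp: J_N)
  then have "?X (J h) = V (J h)" for h by (simp add: \<nu>_def)
  then show ?thesis
    by (rule_tac K_commute_eqI[OF Xb Xin XV V_blin V_in _ _ x]) auto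
qed

end

section \<open>Factors of the minimal isometric dilation\<close>

context minimal_dilation
begin

definition factor_pair where
  "factor_pair X Y \<longleftrightarrow> isometry_on K X \<and> isometry_on K Y \<and> (\<forall>x\<in>K. X (Y x) = V x \<and> Y (X x) = V x) \<and>
     (\<forall>x\<in>N. X x \<in> N \<and> Y x \<in> N)"

lemma factor_pair_sym: "factor_pair X Y \<Longrightarrow> factor_pair Y X"
  unfolding factor_pair_def by blast

lemma
  assumes "factor_pair X Y"
  shows factor_in: "x \<in> K \<Longrightarrow> X x \<in> K" and factor_blin: "blin_on K X"
    and factor_norm: "x \<in> K \<Longrightarrow> norm (X x) = norm x"
    and factor_N: "x \<in> N \<Longrightarrow> X x \<in> N"
    and factor_eq: "x \<in> K \<Longrightarrow> X (Y x) = V x"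
    and factor_V: "x \<in> K \<Longrightarrow> X (V x) = V (X x)"
    and factor_cinner: "x \<in> K \<Longrightarrow> y \<in> K \<Longrightarrow> cinner (X x) (X y) = cinner x y"
proof -
  show 1: "x \<in> K \<Longrightarrow> X x \<in> K" "blin_on K X" "x \<in> K \<Longrightarrow> norm (X x) = norm x"
    "x \<in> N \<Longrightarrow> X x \<in> N" "x \<in> K \<Longrightarrow> X (Y x) = V x" for x
    using assms by (auto simp: factor_pair_def isometry_on_def bounded_op_on_iff)
  show "x \<in> K \<Longrightarrow> X (V x) = V (X x)"
    using assms 1 by (metis factor_pair_def)
  show "x \<in> K \<Longrightarrow> y \<in> K \<Longrightarrow> cinner (X x) (X y) = cinner x y"
    by (rule isometric_cinner[OF K_sub 1(2,3)])
qed

text \<open>No term of degree two or more: \<open>V V x\<^sub>2 = X Y V x\<^sub>2\<close>, and \<open>Y V x\<^sub>2 = V Y x\<^sub>2\<close> is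
  orthogonal to \<open>L d\<close>.\<close>

lemma factor_L_decomposition:
  assumes f: "factor_pair X Y" and d: "d \<in> DT"
  shows "\<exists>a\<in>DT. \<exists>b\<in>DT. X (L d) = L a + V (L b)"
proof -
  note g = factor_pair_sym[OF f]
  have "X (L d) \<in> N" using d by (intro factor_N[OF f] L_N)
  then obtain a x1 where a: "a \<in> DT" "x1 \<in> N" "X (L d) = L a + V x1"
    using N_decomposition by blast
  then obtain b x2 where b: "b \<in> DT" "x2 \<in> N" "x1 = L b + V x2"
    using N_decomposition by blast
  have eq: "X (L d) = L a + V (L b) + V (V x2)"
    using a b by (simp add: blin_on_add[OF V_blin] add.assoc)
  have "cinner (X (L d)) (V (V x2)) = cinner (X (L d)) (X (Y (V x2)))"
    using b by (simp add: factor_eq[OF f])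
  also have "\<dots> = cinner (L d) (V (Y x2))"
    using b d by (simp add: factor_cinner[OF f] factor_in[OF g] factor_V[OF g])
  also have "\<dots> = 0" using b d by (simp add: L_V_N factor_N[OF g])
  finally have "cinner x2 x2 = 0"
    using a b by (simp add: eq cinner.add_left L_V_N V_cinner)
  then have "x2 = 0" by (simp add: cinner_self)
  then have "X (L d) = L a + V (L b)" using eq by (simp add: blin_on_zero[OF K_sub V_blin])
  then show ?thesis using a b by blast
qed

lemma norm_L_V_L: "a \<in> DT \<Longrightarrow> b \<in> DT \<Longrightarrow> (norm (L a + V (L b)))\<^sup>2 = (norm a)\<^sup>2 + (norm b)\<^sup>2"
  by (simp add: norm_sq_add L_V_N L_norm V_norm)

lemma factor_has_symbol:
  assumes f: "factor_pair X Y"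
  shows "\<exists>E F. has_symbol X E F"
proof -
  have "\<forall>d. \<exists>a b. d \<in> DT \<longrightarrow> a \<in> DT \<and> b \<in> DT \<and> X (L d) = L a + V (L b)"
    using factor_L_decomposition[OF f] by blast
  then obtain E F where EF: "\<And>d. d \<in> DT \<Longrightarrow> E d \<in> DT \<and> F d \<in> DT \<and> X (L d) = L (E d) + V (L (F d))"
    by metis
  then have in0 [simp]: "\<And>d. d \<in> DT \<Longrightarrow> E d \<in> DT" and in1 [simp]: "\<And>d. d \<in> DT \<Longrightarrow> F d \<in> DT"
    and XL: "\<And>d. d \<in> DT \<Longrightarrow> X (L d) = L (E d) + V (L (F d))" by auto
  note [simp] = csubspace_add[OF DT_sub] csubspace_scaleC[OF DT_sub] csubspace_scaleC[OF K_sub]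
  have add: "E (d + e) = E d + E e \<and> F (d + e) = F d + F e" if "d \<in> DT" "e \<in> DT" for d e
  proof -
    have "X (L (d + e)) = X (L d) + X (L e)"
      using that by (simp add: blin_on_add[OF L_blin] blin_on_add[OF factor_blin[OF f]])
    then have "L (E (d + e)) + V (L (F (d + e))) = (L (E d) + V (L (F d))) + (L (E e) + V (L (F e)))"
      using that by (simp only: XL csubspace_add[OF DT_sub])
    then have "L (E (d + e)) + V (L (F (d + e))) = L (E d + E e) + V (L (F d + F e))"
      using that by (simp add: blin_on_add[OF L_blin] blin_on_add[OF V_blin])
    with linear_unique[of "E (d + e)" "F (d + e)" "E d + E e" "F d + F e"] that show ?thesis by simp
  qed
  have scale: "E (c *\<^sub>C d) = c *\<^sub>C E d \<and> F (c *\<^sub>C d) = c *\<^sub>C F d" if "d \<in> DT" for c d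
  proof -
    have "X (L (c *\<^sub>C d)) = c *\<^sub>C X (L d)"
      using that by (simp add: blin_on_scaleC[OF L_blin] blin_on_scaleC[OF factor_blin[OF f]])
    then have "L (E (c *\<^sub>C d)) + V (L (F (c *\<^sub>C d))) = c *\<^sub>C (L (E d) + V (L (F d)))"
      using that by (simp only: XL csubspace_scaleC[OF DT_sub])
    then have "L (E (c *\<^sub>C d)) + V (L (F (c *\<^sub>C d))) = L (c *\<^sub>C E d) + V (L (c *\<^sub>C F d))"
      using that by (simp add: blin_on_scaleC[OF L_blin] blin_on_scaleC[OF V_blin] scaleC_add_right)
    with linear_unique[of "E (c *\<^sub>C d)" "F (c *\<^sub>C d)" "c *\<^sub>C E d" "c *\<^sub>C F d"] that show ?thesis by simp
  qed
  have "norm (E d) \<le> norm d \<and> norm (F d) \<le> norm d" if "d \<in> DT" for d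
  proof -
    have "(norm d)\<^sup>2 = (norm (E d))\<^sup>2 + (norm (F d))\<^sup>2"
      using norm_L_V_L[of "E d" "F d"] that by (simp add: XL[symmetric] factor_norm[OF f] L_norm)
    then show ?thesis by (metis le_add_same_cancel1 le_add_same_cancel2 norm_ge_zero power2_le_imp_le zero_le_power2)
  qed
  then have "blin_on DT E" "blin_on DT F"
    using add scale by (auto intro!: blin_onI[where M=1])
  then show ?thesis using XL unfolding has_symbol_def bounded_op_on_iff by (intro exI[of _ E] exI[of _ F]) simp
qed

text \<open>Both sides equal \<open>\<langle>X L d, V L e\<rangle>\<close>, where \<open>V L e = X Y L e\<close>.\<close>

lemma factor_symbol_adjoint:
  assumes f: "factor_pair X Y" and X: "has_symbol X E F" and Y: "has_symbol Y E' F'"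
    and d: "d \<in> DT" and e: "e \<in> DT"
  shows "cinner (F d) e = cinner d (E' e)"
proof -
  note [simp] = symbol_in0[OF X] symbol_in1[OF X] symbol_in0[OF Y] symbol_in1[OF Y]
  have "cinner (X (L d)) (V (L e)) = cinner (F d) e"
    using d e by (simp add: symbol_L[OF X] cinner.add_left L_V_N V_cinner L_cinner)
  moreover have "cinner (X (L d)) (V (L e)) = cinner (X (L d)) (X (Y (L e)))"
    using e by (simp add: factor_eq[OF f])
  moreover have "\<dots> = cinner (L d) (Y (L e))"
    using d e factor_in[OF factor_pair_sym[OF f]] by (simp add: factor_cinner[OF f])
  moreover have "\<dots> = cinner d (E' e)"
    using d e by (simp add: symbol_L[OF Y] cinner.add_right L_V_N L_cinner)
  ultimately show ?thesis by simp
qed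

lemma factor_symbol_product:
  assumes f: "factor_pair X Y" and X: "has_symbol X E F" and Y: "has_symbol Y E' F'" and d: "d \<in> DT"
  shows "E (E' d) = 0" "F (E' d) + E (F' d) = d" "F (F' d) = 0"
proof -
  note [simp] = symbol_in0[OF X] symbol_in1[OF X] symbol_in0[OF Y] symbol_in1[OF Y]
  have "X (Y (L d)) = L 0 + V (L d) + V (V (L 0))"
    using d by (simp add: factor_eq[OF f] blin_on_zero[OF DT_sub L_blin] blin_on_zero[OF K_sub V_blin])
  with symbol_comp[OF factor_blin[OF f] factor_V[OF f] X Y d]
  have "L (E (E' d)) + V (L (F (E' d) + E (F' d))) + V (V (L (F (F' d)))) =
      L 0 + V (L d) + V (V (L 0))" by simp
  from quadratic_unique[OF _ _ _ _ _ _ this]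
  show "E (E' d) = 0" "F (E' d) + E (F' d) = d" "F (F' d) = 0"
    using d csubspace_zero[OF DT_sub] csubspace_add[OF DT_sub] by auto
qed

text \<open>The component of \<open>X J h\<close> in \<open>N\<close> is orthogonal to \<open>V N = X Y N\<close>, because \<open>J h\<close> is orthogonal
  to \<open>Y N\<close>; hence it has the form \<open>L d\<close>. Testing it against \<open>L D g\<close> and moving everything
  under \<open>Y\<close> turns \<open>Y X J h\<close> into \<open>V J h = J T h + L D h\<close>, which identifies \<open>d\<close>.\<close>

lemma factor_J:
  assumes f: "factor_pair X Y" and X: "has_symbol X E F"
    and S: "\<And>x. x \<in> K \<Longrightarrow> Jad (X x) = S (Jad x)"
  shows "X (J h) = J (S h) + L (F (D h))"
proof -
  note g = factor_pair_sym[OF f]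
  obtain E' F' where Y: "has_symbol Y E' F'" using factor_has_symbol[OF g] by blast
  note [simp] = symbol_in0[OF X] symbol_in1[OF X] symbol_in0[OF Y] symbol_in1[OF Y]
    factor_in[OF f] factor_in[OF g] factor_N[OF f] factor_N[OF g]
  define c where "c = X (J h) - J (S h)"
  have "c \<in> K" unfolding c_def by (rule csubspace_diff[OF K_sub]) auto
  moreover have "Jad c = 0" by (simp add: c_def blin_on_diff[OF UNIV_sub Jad_blin] S)
  ultimately have "c \<in> N" unfolding N_def by simp
  then obtain d x' where d: "d \<in> DT" "x' \<in> N" "c = L d + V x'" using N_decomposition by blast
  have "cinner (X (J h)) (V x') = cinner (X (J h)) (X (Y x'))" using d by (simp add: factor_eq[OF f])
  also have "\<dots> = 0" using d by (simp add: factor_cinner[OF f] J_N)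
  finally have "cinner c (V x') = 0" using d(2) by (simp add: c_def cinner.diff_left J_N)
  then have "cinner x' x' = 0" using d by (simp add: cinner.add_left L_V_N V_cinner)
  then have x': "x' = 0" by (simp add: cinner_self)
  have "d - F (D h) = 0"
  proof (rule DT_zeroI)
    show "d - F (D h) \<in> DT" using d by (intro csubspace_diff[OF DT_sub]) auto
    fix g
    have "cinner d (D g) = cinner c (L (D g))"
      using d x' by (simp add: L_cinner blin_on_zero[OF K_sub V_blin])
    also have "\<dots> = cinner (X (J h)) (L (D g))" by (simp add: c_def cinner.diff_left J_N)
    also have "\<dots> = cinner (Y (X (J h))) (Y (L (D g)))" by (simp add: factor_cinner[OF g])
    also have "\<dots> = cinner (L (D h)) (Y (L (D g)))"
      by (simp add: factor_eq[OF g] V_J cinner.add_left J_N)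
    also have "\<dots> = cinner (D h) (E' (D g))"
      by (simp add: symbol_L[OF Y] cinner.add_right L_V_N L_cinner)
    also have "\<dots> = cinner (F (D h)) (D g)"
      by (rule factor_symbol_adjoint[OF f X Y, symmetric]) auto
    finally have "cinner (D g) d = cinner (D g) (F (D h))" by (rule cinner_swap)
    then show "cinner (D g) (d - F (D h)) = 0" by (simp add: cinner.diff_right)
  qed
  then have "X (J h) - J (S h) = L (F (D h))"
    using d x' by (simp add: c_def blin_on_zero[OF K_sub V_blin])
  then show ?thesis by (simp add: algebra_simps)
qed

text \<open>The first identity is the component in \<open>L DT\<close> of \<open>X V J h = V X J h\<close>, the second one the
  isometry of \<open>X\<close> on the embedded space.\<close>

lemma factor_defect:
  assumes f: "factor_pair X Y" and X: "has_symbol X E F"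
    and S: "\<And>x. x \<in> K \<Longrightarrow> Jad (X x) = S (Jad x)"
  shows "D (S h) = E (D h) + F (D (T h))"
    and "cinner (F (D h)) (F (D g)) = cinner h g - cinner (S h) (S g)"
proof -
  note [simp] = symbol_in0[OF X] symbol_in1[OF X] factor_in[OF f]
  have XJ: "X (J h) = J (S h) + L (F (D h))" for h by (rule factor_J[OF f X S])
  have ST: "S (T h) = T (S h)" for h
    using S[of "V (J h)"] by (simp add: Jad_V factor_V[OF f] S)
  have "X (V (J h)) = J (S (T h)) + L (F (D (T h))) + (L (E (D h)) + V (L (F (D h))))"
    by (simp add: V_J blin_on_add[OF factor_blin[OF f]] XJ symbol_L[OF X])
  moreover have "V (X (J h)) = J (T (S h)) + L (D (S h)) + V (L (F (D h)))"
    by (simp add: XJ blin_on_add[OF V_blin] V_J)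
  ultimately have "L (F (D (T h))) + L (E (D h)) = L (D (S h))"
    using factor_V[OF f, of "J h"] ST by simp
  then have "L (E (D h) + F (D (T h))) + V (L 0) = L (D (S h)) + V (L 0)"
    by (simp add: blin_on_add[OF L_blin] add.commute)
  then show "D (S h) = E (D h) + F (D (T h))"
    using linear_unique(1)[of "E (D h) + F (D (T h))" 0 "D (S h)" 0] csubspace_zero[OF DT_sub]
    by (simp add: csubspace_add[OF DT_sub])
  have "cinner h g = cinner (X (J h)) (X (J g))" by (simp add: factor_cinner[OF f] J_cinner)
  also have "\<dots> = cinner (S h) (S g) + cinner (F (D h)) (F (D g))"
    by (simp add: XJ cinner.add_left cinner.add_right J_cinner J_N N_J L_cinner)
  finally show "cinner (F (D h)) (F (D g)) = cinner h g - cinner (S h) (S g)" by simp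
qed

end

section \<open>From defect data to a dilation\<close>

locale commuting_product = minimal_dilation "opprod n Ts" K J V
  for n and Ts :: "nat \<Rightarrow> 'h::chilbert_space \<Rightarrow> 'h" and K :: "'k::chilbert_space set" and J V +
  assumes Ts: "i \<in> {1..n} \<Longrightarrow> contraction (Ts i)" and Ts_commuting: "commuting_on UNIV n Ts"
begin

lemma Ts_comm: "i \<in> {1..n} \<Longrightarrow> j \<in> {1..n} \<Longrightarrow> Ts i (Ts j h) = Ts j (Ts i h)"
  using Ts_commuting by (auto simp: commuting_on_def)

lemma Ts_blin: "i \<in> {1..n} \<Longrightarrow> blin_on UNIV (Ts i)"
  using Ts by (intro contraction_blin)

lemma Ts_T: "i \<in> {1..n} \<Longrightarrow> Ts i (opprod n Ts h) = opprod n Ts (Ts i h)"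
  by (rule opprod_intertwine[where S=UNIV]) (auto simp: Ts_comm)

text \<open>Condition (1) is the hypothesis on \<open>D S\<close> of the lifting theorem, and condition (4) gives the one on
  \<open>F\<close>. The adjoint of (3) says that the operators \<open>F\<^sub>i = P\<^sub>i U\<^sub>i\<^sup>*\<close> commute, condition (2) that
  the \<open>E\<^sub>i = P\<^sub>i\<^sup>\<bottom> U\<^sub>i\<^sup>*\<close> do. As \<open>E\<^sub>i + F\<^sub>i = U\<^sub>i\<^sup>*\<close> commute as well, so do the
  symbols \<open>E\<^sub>i + z F\<^sub>i\<close>. The properties of the lifts beyond the dilation property serve to
  compare this dilation with others.\<close>

theorem dilation_of_defect_data:
  assumes data: "defect_data n Ts P U"
  shows "\<exists>X. isometric_dilation n Ts K J X \<and> lifted_data (opprod n Ts) K J V n X P U \<and>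
    (\<forall>i\<in>{1..n}. \<forall>x\<in>K. Jad (X i x) = Ts i (Jad x)) \<and>
    (\<forall>i\<in>{1..n}. \<forall>h. X i (J h) = J (Ts i h) + L (P i (adj_on DT (U i) (D h))))"
proof -
  define E where "E i d = perp (P i) (adj_on DT (U i) d)" for i d
  define F where "F i d = P i (adj_on DT (U i) d)" for i d
  have dP: "\<And>i. i \<in> {1..n} \<Longrightarrow> projection_on DT (P i)"
    and dU: "\<And>i. i \<in> {1..n} \<Longrightarrow> unitary_on DT (U i)" and dUc: "commuting_on DT n U"
    and d1: "\<And>i h. i \<in> {1..n} \<Longrightarrow> D (Ts i h) = E i (D h) + F i (D (opprod n Ts h))"
    and d2: "\<And>i j x. i \<in> {1..n} \<Longrightarrow> j \<in> {1..n} \<Longrightarrow> x \<in> DT \<Longrightarrow> E i (E j x) = E j (E i x)"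
    and d3: "\<And>i j x. i \<in> {1..n} \<Longrightarrow> j \<in> {1..n} \<Longrightarrow> x \<in> DT \<Longrightarrow> U i (P i (U j (P j x))) = U j (P j (U i (P i x)))"
    and d4: "\<And>i h. i \<in> {1..n} \<Longrightarrow> D (U i (F i (D h))) = defect (Ts i) (defect (Ts i) h)"
    using data unfolding defect_data_def Let_def E_def F_def by blast+
  note P_facts = projection_in[OF DT_closed dP] projection_blin[OF DT_closed dP]
    projection_idem[OF DT_closed dP] projection_cinner[OF DT_closed dP]
  note U_facts = unitary_in[OF DT_closed dU] unitary_blin[OF DT_closed dU]
    unitary_adj_in[OF DT_closed dU] unitary_adj_blin[OF DT_closed dU]
  note U_inv = unitary_adj_left[OF DT_closed dU] unitary_adj_right[OF DT_closed dU]
  note U_cin = unitary_cinner[OF DT_closed dU] unitary_adj_cinner[OF DT_closed dU]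
  have Fin: "F i d \<in> DT" if "i \<in> {1..n}" "d \<in> DT" for i d
    unfolding F_def by (intro P_facts U_facts that)
  have Ein: "E i d \<in> DT" if "i \<in> {1..n}" "d \<in> DT" for i d
    unfolding E_def perp_def by (intro csubspace_diff[OF DT_sub] P_facts U_facts that)
  have Fop: "bounded_op_on DT (F i)" if i: "i \<in> {1..n}" for i
    using Fin[OF i] blin_on_comp[OF U_facts(4)[OF i] U_facts(3)[OF i] P_facts(2)[OF i]]
    by (simp add: bounded_op_on_iff F_def[abs_def])
  have sumEF: "E i d + F i d = adj_on DT (U i) d" for i d
    by (simp add: E_def F_def perp_def)
  have Eop: "bounded_op_on DT (E i)" if i: "i \<in> {1..n}" for i
    using Ein[OF i] blin_on_minus_fun[OF U_facts(4)[OF i] blin_on_comp[OF U_facts(4)[OF i] U_facts(3)[OF i] P_facts(2)[OF i]]]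
    by (simp add: bounded_op_on_iff E_def[abs_def] perp_def)
  have Eb: "blin_on DT (E i)" and Fb: "blin_on DT (F i)" if "i \<in> {1..n}" for i
    using Eop[OF that] Fop[OF that] by (auto simp: bounded_op_on_iff)
  have EF: "cinner (E i d) (F i e) = 0" if i: "i \<in> {1..n}" and "d \<in> DT" "e \<in> DT" for i d e
  proof -
    let ?s = "adj_on DT (U i)"
    have "cinner (?s d) (P i (?s e)) = cinner (P i (?s d)) (P i (?s e))"
      using i by (simp add: P_facts U_facts)
    then show ?thesis by (simp add: E_def F_def perp_def cinner.diff_left)
  qed
  have FF: "cinner (F i (D h)) (F i (D g)) = cinner h g - cinner (Ts i h) (Ts i g)"
    if i: "i \<in> {1..n}" for i h g
  proof -
    let ?s = "adj_on DT (U i)"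
    have "cinner (F i (D h)) (F i (D g)) = cinner (F i (D h)) (?s (D g))"
      using i by (simp add: F_def P_facts U_facts flip: P_facts(4))
    also have "\<dots> = cinner (U i (F i (D h))) (D g)" using i Fin by (simp add: U_cin)
    also have "\<dots> = cinner (D (U i (F i (D h)))) g"
      by (rule defect_selfadjoint[OF contraction, symmetric])
    also have "\<dots> = cinner (defect (Ts i) h) (defect (Ts i) g)"
      by (simp add: d4[OF i] defect_selfadjoint[OF Ts[OF i]])
    also have "\<dots> = cinner h g - cinner (Ts i h) (Ts i g)" by (rule defect_cinner[OF Ts[OF i]])
    finally show ?thesis .
  qed
  have FFcomm: "F i (F j d) = F j (F i d)" if i: "i \<in> {1..n}" and j: "j \<in> {1..n}" and d: "d \<in> DT" for i j d
  proof (rule cinner_ext_left[OF DT_sub])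
    have *: "cinner (F i (F j d)) y = cinner d (U j (P j (U i (P i y))))"
      if "i \<in> {1..n}" "j \<in> {1..n}" "y \<in> DT" for i j y
      using that d unfolding F_def by (simp add: P_facts U_facts U_cin)
    show "cinner (F i (F j d)) y = cinner (F j (F i d)) y" if y: "y \<in> DT" for y
      unfolding *[OF i j y] *[OF j i y] using d3[OF j i y] by simp
  qed (use i j d Fin in auto)
  have star_comm: "adj_on DT (U i) (adj_on DT (U j) d) = adj_on DT (U j) (adj_on DT (U i) d)"
    if i: "i \<in> {1..n}" and j: "j \<in> {1..n}" and d: "d \<in> DT" for i j d
  proof (rule cinner_ext_left[OF DT_sub])
    show "cinner (adj_on DT (U i) (adj_on DT (U j) d)) y = cinner (adj_on DT (U j) (adj_on DT (U i) d)) y"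
      if y: "y \<in> DT" for y
      using that i j d dUc by (simp add: U_cin U_facts commuting_on_def)
  qed (use i j d U_facts in auto)
  have mixed: "F i (E j d) + E i (F j d) = F j (E i d) + E j (F i d)"
    if i: "i \<in> {1..n}" and j: "j \<in> {1..n}" and d: "d \<in> DT" for i j d
  proof -
    have "(E i (E j d) + F i (F j d)) + (F i (E j d) + E i (F j d)) =
          (E j (E i d) + F j (F i d)) + (F j (E i d) + E j (F i d))"
      using star_comm[OF i j d] i j d Ein Fin
      by (simp add: sumEF[symmetric] blin_on_add[OF Eb] blin_on_add[OF Fb] add_ac)
    then show ?thesis using d2[OF i j d] FFcomm[OF i j d] by simp
  qed
  let ?lift = "\<lambda>i X. isometry_on K X \<and> (\<forall>x\<in>K. X (V x) = V (X x)) \<and>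
      (\<forall>h. X (J h) = J (Ts i h) + L (F i (D h))) \<and>
      (\<forall>x\<in>K. Jad (X x) = Ts i (Jad x)) \<and> (\<forall>d\<in>DT. X (L d) = L (E i d) + V (L (F i d)))"
  have "\<forall>i\<in>{1..n}. \<exists>X. ?lift i X"
    using lift_exists[OF Ts_blin Ts_T Eop Fop d1 FF EF] by blast
  from bchoice[OF this] obtain X where "\<forall>i\<in>{1..n}. ?lift i (X i)" ..
  then have X: "\<And>i. i \<in> {1..n} \<Longrightarrow> isometry_on K (X i)"
      "\<And>i x. i \<in> {1..n} \<Longrightarrow> x \<in> K \<Longrightarrow> X i (V x) = V (X i x)"
    and XJ: "\<And>i h. i \<in> {1..n} \<Longrightarrow> X i (J h) = J (Ts i h) + L (F i (D h))"
    and JX: "\<And>i x. i \<in> {1..n} \<Longrightarrow> x \<in> K \<Longrightarrow> Jad (X i x) = Ts i (Jad x)"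
    and XL: "\<And>i d. i \<in> {1..n} \<Longrightarrow> d \<in> DT \<Longrightarrow> X i (L d) = L (E i d) + V (L (F i d))"
    by blast+
  have Xin [simp]: "X i x \<in> K" if "i \<in> {1..n}" "x \<in> K" for i x
    using X(1)[OF that(1)] that(2) by (simp add: isometry_on_def bounded_op_on_iff)
  have Xb: "blin_on K (X i)" if "i \<in> {1..n}" for i
    using X(1)[OF that] by (simp add: isometry_on_def bounded_op_on_iff)
  have XXJ: "X i (X j (J h)) = J (Ts i (Ts j h)) + L (F i (E j (D h)) + E i (F j (D h)))
      + L (F i (F j (D (opprod n Ts h)))) + V (L (F i (F j (D h))))"
    if i: "i \<in> {1..n}" and j: "j \<in> {1..n}" for i j h
    using i j Ein Fin
    by (simp add: XJ blin_on_add[OF Xb] XL d1 blin_on_add[OF Fb] blin_on_add[OF L_blin] csubspace_add[OF DT_sub] add_ac)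
  have Xcomm: "X i (X j x) = X j (X i x)" if i: "i \<in> {1..n}" and j: "j \<in> {1..n}" and x: "x \<in> K" for i j x
  proof (rule K_commute_eqI[OF _ _ _ _ _ _ _ x])
    show "blin_on K (\<lambda>x. X i (X j x))"
      by (rule blin_on_comp[OF Xb[OF j] _ Xb[OF i]]) (rule Xin[OF j])
    show "blin_on K (\<lambda>x. X j (X i x))"
      by (rule blin_on_comp[OF Xb[OF i] _ Xb[OF j]]) (rule Xin[OF i])
    show "X i (X j (J h)) = X j (X i (J h))" for h
      using XXJ[OF i j, of h] XXJ[OF j i, of h] mixed[OF i j D_in, of h] FFcomm[OF i j D_in] Ts_comm[OF i j]
      by simp
  qed (use i j X(2) in auto)
  have "isometric_dilation n Ts K J X"
    unfolding isometric_dilation_def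
  proof (intro conjI allI)
    show "embedding_into K J"
      using minimal unfolding minimal_isometric_dilation_def isometric_dilation_def by blast
    fix k h
    have "Jad (opprod n (\<lambda>i. X i ^^ k i) (J h)) = opprod n (\<lambda>i. Ts i ^^ k i) (Jad (J h))"
    proof (rule opprod_intertwine[where S=K])
      show "Jad ((X i ^^ k i) x) = (Ts i ^^ k i) (Jad x)" if "i \<in> {1..n}" "x \<in> K" for i x
        by (rule funpow_intertwine[where S=K]) (use that JX in auto)
    qed (auto intro: funpow_in)
    then show "J (opprod n (\<lambda>i. Ts i ^^ k i) h) = orth_proj (range J) (opprod n (\<lambda>i. X i ^^ k i) (J h))"
      by (simp add: orth_proj_J)
  qed (use X K_closed Xcomm in \<open>auto simp: commuting_on_def\<close>)
  moreover have "lifted_data (opprod n Ts) K J V n X P U"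
    by unfold_locales
      (use dP dU dUc X XL in \<open>auto simp: E_def F_def isometry_on_def\<close>)
  ultimately show ?thesis using XJ JX unfolding F_def by blast
qed

end

section \<open>From a dilation to defect data\<close>

text \<open>A dilation \<open>W\<close> of the tuple on the space of \<open>V\<close> whose product is \<open>V\<close>. Equality of the
  product with \<open>V\<close> is demanded on \<open>K\<close> alone, since operators on \<open>K\<close> are represented by functions
  with arbitrary values elsewhere.\<close>

locale dilation_tuple = commuting_product n Ts K J V
  for n and Ts :: "nat \<Rightarrow> 'h::chilbert_space \<Rightarrow> 'h" and K :: "'k::chilbert_space set" and J V +
  fixes W :: "nat \<Rightarrow> 'k \<Rightarrow> 'k"
  assumes dilation: "isometric_dilation n Ts K J W" and prod: "x \<in> K \<Longrightarrow> opprod n W x = V x"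
begin

lemma W_iso: "i \<in> {1..n} \<Longrightarrow> isometry_on K (W i)"
  and W_comm: "i \<in> {1..n} \<Longrightarrow> j \<in> {1..n} \<Longrightarrow> x \<in> K \<Longrightarrow> W i (W j x) = W j (W i x)"
  using dilation by (auto simp: isometric_dilation_def commuting_on_def)

lemma W_in [simp]: "i \<in> {1..n} \<Longrightarrow> x \<in> K \<Longrightarrow> W i x \<in> K"
  using W_iso by (auto simp: isometry_on_def bounded_op_on_iff)

lemma subprod_iso: "isometry_on K (subprod n \<alpha> W)"
  unfolding subprod_def
  by (rule isometry_on_opprod)
    (auto simp: W_iso, auto simp: isometry_on_def bounded_op_on_iff blin_on_id id_def)

lemma subprod_in [simp]: "x \<in> K \<Longrightarrow> subprod n \<alpha> W x \<in> K"
  and subprod_blin: "blin_on K (subprod n \<alpha> W)"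
  using subprod_iso[of \<alpha>] by (auto simp: isometry_on_def bounded_op_on_iff)

lemma subprod_Ts_blin: "blin_on UNIV (subprod n \<alpha> Ts)"
proof -
  have "bounded_op_on UNIV (subprod n \<alpha> Ts)"
    unfolding subprod_def
    by (rule bounded_op_on_opprod) (auto simp: bounded_op_on_iff Ts_blin blin_on_id id_def)
  then show ?thesis by (simp add: bounded_op_on_iff)
qed

lemma opprod_W_funpow: "x \<in> K \<Longrightarrow> (opprod n W ^^ k) x = (V ^^ k) x"
  by (induction k) (auto simp: prod)

lemma Jad_subprod_Vpow: "Jad (subprod n \<alpha> W ((V ^^ k) (J h))) = subprod n \<alpha> Ts ((opprod n Ts ^^ k) h)"
proof -
  let ?k = "\<lambda>i. of_bool (i \<in> \<alpha>) + k :: nat"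
  have "\<forall>k h. J (opprod n (\<lambda>i. Ts i ^^ k i) h) = orth_proj (range J) (opprod n (\<lambda>i. W i ^^ k i) (J h))"
    using dilation unfolding isometric_dilation_def by blast
  from this[rule_format, of ?k h] have "opprod n (\<lambda>i. Ts i ^^ ?k i) h = Jad (opprod n (\<lambda>i. W i ^^ ?k i) (J h))"
    by (auto simp: orth_proj_J dest!: J_inj)
  moreover have "opprod n (\<lambda>i. Ts i ^^ ?k i) h = subprod n \<alpha> Ts ((opprod n Ts ^^ k) h)"
    by (rule subprod_funpow[where S=UNIV]) (auto simp: Ts_comm)
  moreover have "opprod n (\<lambda>i. W i ^^ ?k i) (J h) = subprod n \<alpha> W ((opprod n W ^^ k) (J h))"
    by (rule subprod_funpow[where S=K]) (auto simp: W_comm)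
  ultimately show ?thesis by (simp add: opprod_W_funpow)
qed

text \<open>Subproducts leave \<open>N\<close> invariant: by the joint dilation property and minimality the embedded space
  is coinvariant for them.\<close>

lemma Jad_subprod: "x \<in> K \<Longrightarrow> Jad (subprod n \<alpha> W x) = subprod n \<alpha> Ts (Jad x)"
proof (rule K_eqI)
  show "blin_on K (\<lambda>x. Jad (subprod n \<alpha> W x))" by (rule blin_on_comp[OF subprod_blin _ Jad_blin]) auto
  show "blin_on K (\<lambda>x. subprod n \<alpha> Ts (Jad x))" by (rule blin_on_comp[OF Jad_blin _ subprod_Ts_blin]) auto
qed (simp_all add: Jad_subprod_Vpow Jad_Vpow_J)

lemma subprod_complement_V: "x \<in> K \<Longrightarrow> subprod n \<alpha> W (subprod n (- \<alpha>) W x) = V x"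
  by (subst subprod_complement[where S=K]) (auto simp: W_comm prod)

lemma subprod_factor: "factor_pair (subprod n \<alpha> W) (subprod n (- \<alpha>) W)"
proof -
  have "subprod n \<alpha> W x \<in> N" if "x \<in> N" for x \<alpha>
    using that Jad_subprod[of x \<alpha>] blin_on_zero[OF UNIV_sub subprod_Ts_blin]
    unfolding N_def by simp
  then show ?thesis unfolding factor_pair_def
    using subprod_complement_V[of _ "- \<alpha>"] by (auto simp: subprod_iso subprod_complement_V)
qed

lemma W_factor: "i \<in> {1..n} \<Longrightarrow> factor_pair (W i) (subprod n (- {i}) W)"
  using subprod_factor[of "{i}"] by (simp add: subprod_single)

lemma Jad_W: "i \<in> {1..n} \<Longrightarrow> x \<in> K \<Longrightarrow> Jad (W i x) = Ts i (Jad x)"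
  using Jad_subprod[of x "{i}"] by (simp add: subprod_single)

text \<open>The last conjunct recovers the dilation from the data, which turns uniqueness of the dilation into
  uniqueness of the data.\<close>

theorem defect_data_of_dilation:
  "\<exists>P U. defect_data n Ts P U \<and> product_normalised n Ts P U \<and>
    (\<forall>i\<in>{1..n}. \<forall>h. W i (J h) = J (Ts i h) + L (P i (adj_on DT (U i) (D h))))"
proof -
  let ?Y = "\<lambda>i. subprod n (- {i}) W"
  have "\<forall>i. \<exists>E F E' F'. i \<in> {1..n} \<longrightarrow> has_symbol (W i) E F \<and> has_symbol (?Y i) E' F'"
    using factor_has_symbol[OF W_factor] factor_has_symbol[OF factor_pair_sym[OF W_factor]] by blast
  then obtain E F E' F' where sy: "\<And>i. i \<in> {1..n} \<Longrightarrow> has_symbol (W i) (E i) (F i)"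
    and sy': "\<And>i. i \<in> {1..n} \<Longrightarrow> has_symbol (?Y i) (E' i) (F' i)" by metis
  define P where "P i d = F i (E' i d)" for i d
  define U where "U i d = E' i d + F' i d" for i d
  have facts: "projection_on DT (P i)" "unitary_on DT (U i)"
      "\<And>d. d \<in> DT \<Longrightarrow> adj_on DT (U i) d = E i d + F i d"
      "\<And>d. d \<in> DT \<Longrightarrow> P i (adj_on DT (U i) d) = F i d"
      "\<And>d. d \<in> DT \<Longrightarrow> perp (P i) (adj_on DT (U i) d) = E i d"
      "\<And>d. d \<in> DT \<Longrightarrow> U i (P i d) = E' i d"
    if i: "i \<in> {1..n}" for i
  proof -
    note f = W_factor[OF i] and g = factor_pair_sym[OF W_factor[OF i]]
    note s = sy[OF i] and s' = sy'[OF i]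
    have ops: "bounded_op_on DT (E i)" "bounded_op_on DT (F i)" "bounded_op_on DT (E' i)" "bounded_op_on DT (F' i)"
      using s s' by (auto simp: has_symbol_def)
    have Pi: "P i = (\<lambda>d. F i (E' i d))" and Ui: "U i = (\<lambda>d. E' i d + F' i d)"
      by (auto simp: P_def U_def)
    note all = projection_unitary_of_symbol[OF DT_closed ops factor_symbol_adjoint[OF f s s']
        factor_symbol_adjoint[OF g s' s] factor_symbol_product[OF f s s'] factor_symbol_product[OF g s' s],
        folded Pi Ui]
    show "projection_on DT (P i)" by (rule all(1))
    show "unitary_on DT (U i)" by (rule all(2))
    show "adj_on DT (U i) d = E i d + F i d" if "d \<in> DT" for d using that by (rule all(3)[rotated -1])
    show "P i (adj_on DT (U i) d) = F i d" if "d \<in> DT" for d unfolding P_def using that by (rule all(4)[rotated -1])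
    show "perp (P i) (adj_on DT (U i) d) = E i d" if "d \<in> DT" for d using that by (rule all(5)[rotated -1])
    show "U i (P i d) = E' i d" if "d \<in> DT" for d unfolding P_def U_def using that by (rule all(6)[rotated -1])
  qed
  have in0: "E i d \<in> DT" and in1: "F i d \<in> DT" and in0': "E' i d \<in> DT" and in1': "F' i d \<in> DT"
    if "i \<in> {1..n}" "d \<in> DT" for i d
    using that symbol_in0[OF sy] symbol_in1[OF sy] symbol_in0[OF sy'] symbol_in1[OF sy'] by auto
  note Eb = symbol_blin0[OF sy] and Fb = symbol_blin1[OF sy]
  (* the three coefficients of the commuting products of linear symbols *)
  have WW: "E i (E j d) = E j (E i d)" "F i (E j d) + E i (F j d) = F j (E i d) + E j (F i d)"
      "F i (F j d) = F j (F i d)" if i: "i \<in> {1..n}" and j: "j \<in> {1..n}" and d: "d \<in> DT" for i j d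
  proof -
    have "W i (W j (L d)) = W j (W i (L d))" using i j d by (simp add: W_comm)
    then have "L (E i (E j d)) + V (L (F i (E j d) + E i (F j d))) + V (V (L (F i (F j d)))) =
        L (E j (E i d)) + V (L (F j (E i d) + E j (F i d))) + V (V (L (F j (F i d))))"
      using symbol_comp[OF factor_blin[OF W_factor[OF i]] factor_V[OF W_factor[OF i]] sy[OF i] sy[OF j] d]
        symbol_comp[OF factor_blin[OF W_factor[OF j]] factor_V[OF W_factor[OF j]] sy[OF j] sy[OF i] d]
      by simp
    from quadratic_unique[OF _ _ _ _ _ _ this]
    show "E i (E j d) = E j (E i d)" "F i (E j d) + E i (F j d) = F j (E i d) + E j (F i d)"
      "F i (F j d) = F j (F i d)"
      using i j d in0 in1 csubspace_add[OF DT_sub] by simp_all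
  qed
  note adjF = factor_symbol_adjoint[OF W_factor sy sy']
  have adjE': "cinner (E' i d) e = cinner d (F i e)" if "i \<in> {1..n}" "d \<in> DT" "e \<in> DT" for i d e
    by (rule cinner_swap[OF adjF[OF that(1,1,1) that(3,2), symmetric]])
  have E'comm: "E' i (E' j d) = E' j (E' i d)" if i: "i \<in> {1..n}" and j: "j \<in> {1..n}" and d: "d \<in> DT" for i j d
  proof (rule cinner_ext_left[OF DT_sub])
    show "cinner (E' i (E' j d)) y = cinner (E' j (E' i d)) y" if "y \<in> DT" for y
      using that i j d in0' in1 WW(3)[OF i j that] by (simp add: adjE')
  qed (use i j d in0' in auto)
  have Ucomm: "U i (U j d) = U j (U i d)" if i: "i \<in> {1..n}" and j: "j \<in> {1..n}" and d: "d \<in> DT" for i j d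
  proof (rule cinner_ext_left[OF DT_sub])
    note Ui = unitary_in[OF DT_closed facts(2)] unitary_cinner[OF DT_closed facts(2)]
    show "U i (U j d) \<in> DT" "U j (U i d) \<in> DT" using i j d Ui(1) by auto
    have *: "adj_on DT (U j) (adj_on DT (U i) y) =
        E j (E i y) + (F j (E i y) + E j (F i y)) + F j (F i y)"
      if "i \<in> {1..n}" "j \<in> {1..n}" "y \<in> DT" for i j y
      using that in0 in1
      by (simp add: facts(3) blin_on_add[OF Eb] blin_on_add[OF Fb] csubspace_add[OF DT_sub] add_ac)
    show "cinner (U i (U j d)) y = cinner (U j (U i d)) y" if y: "y \<in> DT" for y
    proof -
      have "adj_on DT (U j) (adj_on DT (U i) y) = adj_on DT (U i) (adj_on DT (U j) y)"
        unfolding *[OF i j y] *[OF j i y] using WW[OF i j y] by simp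
      then show ?thesis using i j d Ui by simp
    qed
  qed
  have d4: "D (E' i (F i (D h))) = defect (Ts i) (defect (Ts i) h)" if i: "i \<in> {1..n}" for i h
  proof (rule cinner_ext_left[OF UNIV_sub])
    fix g
    have "cinner (D (E' i (F i (D h)))) g = cinner (F i (D h)) (F i (D g))"
      using i in0' in1 by (simp add: defect_selfadjoint[OF contraction] adjE')
    also have "\<dots> = cinner h g - cinner (Ts i h) (Ts i g)"
      by (rule factor_defect(2)[OF W_factor[OF i] sy[OF i] Jad_W[OF i]])
    also have "\<dots> = cinner (defect (Ts i) (defect (Ts i) h)) g"
      using defect_selfadjoint[OF Ts[OF i], of "defect (Ts i) h" g] defect_cinner[OF Ts[OF i], of h g]
      by simp
    finally show "cinner (D (E' i (F i (D h)))) g = cinner (defect (Ts i) (defect (Ts i) h)) g" .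
  qed auto
  have d1: "D (Ts i h) = E i (D h) + F i (D (opprod n Ts h))" if i: "i \<in> {1..n}" for i h
    by (rule factor_defect(1)[OF W_factor[OF i] sy[OF i] Jad_W[OF i]])
  have UF: "U i (F i d) = E' i (F i d)" if i: "i \<in> {1..n}" and d: "d \<in> DT" for i d
  proof -
    have "U i (F i d) = E' i (adj_on DT (U i) d)"
      using facts(4)[OF i d] facts(6)[OF i, of "adj_on DT (U i) d"]
        unitary_adj_in[OF DT_closed facts(2)[OF i]] by simp
    also have "\<dots> = E' i (E i d) + E' i (F i d)"
      using i d in0 in1 by (simp add: facts(3) blin_on_add[OF symbol_blin0[OF sy']])
    finally show ?thesis
      using factor_symbol_product(1)[OF factor_pair_sym[OF W_factor[OF i]] sy'[OF i] sy[OF i] d] by simp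
  qed
  have data: "defect_data n Ts P U"
    unfolding defect_data_def Let_def
  proof (intro conjI ballI allI)
    fix i j h d assume i: "i \<in> {1..n}" and j: "j \<in> {1..n}"
    show "D (Ts i h) = perp (P i) (adj_on DT (U i) (D h)) + P i (adj_on DT (U i) (D (opprod n Ts h)))"
      using i by (simp add: facts(4,5) d1)
    show "D (U i (P i (adj_on DT (U i) (D h)))) = defect (Ts i) (defect (Ts i) h)"
      using i by (simp add: facts(4) UF d4)
    assume d: "d \<in> DT"
    show "perp (P i) (adj_on DT (U i) (perp (P j) (adj_on DT (U j) d))) =
        perp (P j) (adj_on DT (U j) (perp (P i) (adj_on DT (U i) d)))"
      using i j d in0 WW(1)[OF i j d] by (simp add: facts(5))
    show "U i (P i (U j (P j d))) = U j (P j (U i (P i d)))"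
      using i j d in0' E'comm[OF i j d] by (simp add: facts(6))
  qed (use facts Ucomm in \<open>auto simp: commuting_on_def\<close>)
  have WJ: "W i (J h) = J (Ts i h) + L (P i (adj_on DT (U i) (D h)))" if i: "i \<in> {1..n}" for i h
    using factor_J[OF W_factor[OF i] sy[OF i] Jad_W[OF i]] facts(4)[OF i] by simp
  interpret ld: lifted_data "opprod n Ts" K J V n W P U
  proof
    show "bounded_op_on K (W i)" if "i \<in> {1..n}" for i
      using W_iso[OF that] by (simp add: isometry_on_def)
    show "W i (V x) = V (W i x)" if "i \<in> {1..n}" "x \<in> K" for i x
      using that factor_V[OF W_factor] by simp
  qed (use facts Ucomm symbol_L[OF sy] in \<open>auto simp: commuting_on_def\<close>)
  have sym: "\<exists>E' F'. has_symbol (opprod m W) E' F'" if "m \<le> n" for m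
    using factor_has_symbol[OF subprod_factor, of "{1..m}"] subprod_initial[OF that, of W] by simp
  have "product_normalised n Ts P U"
    using ld.product_V_imp_normalised[OF sym prod]
    unfolding product_normalised_def Let_def ld.Aprod_def ld.Rsum_def ld.R_def ld.Astar_def by blast
  with data WJ show ?thesis by blast
qed

section \<open>Uniqueness of the defect data\<close>

text \<open>No operator of the dilation occurs on the right. For positive \<open>k\<close> one factor \<open>V\<close> is written as
  \<open>W i\<close> times the complementary subproduct, and the isometry \<open>W i\<close> cancels.\<close>

lemma cinner_W_J_Vpow:
  assumes i: "i \<in> {1..n}"
  shows "cinner (W i (J h)) ((V ^^ k) (J g)) =
    (case k of 0 \<Rightarrow> cinner (Ts i h) g
     | Suc k \<Rightarrow> cinner h (subprod n (- {i}) Ts ((opprod n Ts ^^ k) g)))"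
proof (cases k)
  case 0
  then show ?thesis using i by (simp add: Jad_cinner_left Jad_W)
next
  case (Suc m)
  note f = W_factor[OF i]
  have "cinner (W i (J h)) ((V ^^ k) (J g)) =
      cinner (W i (J h)) (W i (subprod n (- {i}) W ((V ^^ m) (J g))))"
    using Suc by (simp add: factor_eq[OF f])
  also have "\<dots> = cinner (J h) (subprod n (- {i}) W ((V ^^ m) (J g)))"
    by (simp add: factor_cinner[OF f])
  finally show ?thesis using Suc by (simp add: Jad_cinner Jad_subprod_Vpow)
qed

lemma W_J_determined:
  assumes "dilation_tuple n Ts K J V W'" and i: "i \<in> {1..n}"
  shows "W i (J h) = W' i (J h)"
proof -
  interpret other: dilation_tuple n Ts K J V W' by fact
  have Vr: "cinner ((V ^^ k) (J g)) (W i (J h) - W' i (J h)) = 0" for k g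
  proof -
    have "cinner (W i (J h)) ((V ^^ k) (J g)) = cinner (W' i (J h)) ((V ^^ k) (J g))"
      by (simp only: cinner_W_J_Vpow[OF i] other.cinner_W_J_Vpow[OF i])
    then have "cinner ((V ^^ k) (J g)) (W i (J h)) = cinner ((V ^^ k) (J g)) (W' i (J h))"
      by (rule cinner_swap)
    then show ?thesis by (simp add: cinner.diff_right)
  qed
  have "W i (J h) - W' i (J h) \<in> K" using i by (intro csubspace_diff[OF K_sub]) auto
  from K_eqI[OF blin_on_cinner[OF blin_on_id] blin_on_zero_fun Vr this]
  show ?thesis by (simp add: cinner_self)
qed

text \<open>The data \<open>P'\<close>, \<open>U'\<close> define a dilation whose product is \<open>V\<close> by the normalisation. It agrees with
  \<open>W\<close> on the embedded space, so \<open>P' U'\<^sup>*\<close> and \<open>P U\<^sup>*\<close> agree. Condition (1) then yields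
  \<open>P'\<^sup>\<bottom> U'\<^sup>* = P\<^sup>\<bottom> U\<^sup>*\<close>; the sum of the two determines the unitary, and then the
  first one determines the projection.\<close>

theorem defect_data_unique:
  assumes data: "defect_data n Ts P U" and data': "defect_data n Ts P' U'"
    and nrm': "product_normalised n Ts P' U'"
    and WJ: "\<And>i h. i \<in> {1..n} \<Longrightarrow> W i (J h) = J (Ts i h) + L (P i (adj_on DT (U i) (D h)))"
    and i: "i \<in> {1..n}" and x: "x \<in> DT"
  shows "P' i x = P i x \<and> U' i x = U i x"
proof -
  obtain X where X: "isometric_dilation n Ts K J X" "lifted_data (opprod n Ts) K J V n X P' U'"
    and JX: "\<And>i x. i \<in> {1..n} \<Longrightarrow> x \<in> K \<Longrightarrow> Jad (X i x) = Ts i (Jad x)"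
    and XJ: "\<And>i h. i \<in> {1..n} \<Longrightarrow> X i (J h) = J (Ts i h) + L (P' i (adj_on DT (U' i) (D h)))"
    using dilation_of_defect_data[OF data'] by blast
  interpret ld: lifted_data "opprod n Ts" K J V n X P' U' by (rule X(2))
  have X_iso: "isometry_on K (opprod n X)"
    using X(1) by (intro isometry_on_opprod) (auto simp: isometric_dilation_def)
  have Jad_X: "Jad (opprod n X x) = opprod n Ts (Jad x)" if x: "x \<in> K" for x
  proof (rule opprod_intertwine[where S=K])
    show "Jad (X i x) = Ts i (Jad x)" if "i \<in> {1..n}" "x \<in> K" for i x using that by (rule JX)
  qed (use x ld.X in \<open>auto simp: bounded_op_on_iff\<close>)
  have nrm: "ld.Aprod n d = d" "ld.Rsum n d = d" if "d \<in> DT" for d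
    using nrm' that unfolding product_normalised_def Let_def ld.Aprod_def ld.Rsum_def ld.R_def ld.Astar_def
    by blast+
  have "opprod n X x = V x" if "x \<in> K" for x
    using ld.normalised_imp_product_V_everywhere[OF nrm _ Jad_X that] X_iso by (simp add: isometry_on_def)
  then have "dilation_tuple n Ts K J V X" using X(1) by unfold_locales
  from W_J_determined[OF this] have eq: "W i (J h) = X i (J h)" if "i \<in> {1..n}" for i h using that by blast
  have unfold: "projection_on DT (P i)" "unitary_on DT (U i)"
      "\<And>h. D (Ts i h) = perp (P i) (adj_on DT (U i) (D h)) + P i (adj_on DT (U i) (D (opprod n Ts h)))"
      if "defect_data n Ts P U" for P U
    using that i unfolding defect_data_def Let_def by blast+
  let ?s = "adj_on DT (U i)" and ?s' = "adj_on DT (U' i)"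
  note p = unfold(1)[OF data] and u = unfold(2)[OF data]
  note p' = unfold(1)[OF data'] and u' = unfold(2)[OF data']
  have F: "P i (?s d) = P' i (?s' d)" if "d \<in> DT" for d
  proof (rule DT_eqI[OF _ _ _ that])
    fix h
    have "L (P i (?s (D h))) = L (P' i (?s' (D h)))"
      using eq[OF i, of h] unfolding WJ[OF i] XJ[OF i] by simp
    then show "P i (?s (D h)) = P' i (?s' (D h))"
      by (rule L_inj[rotated 2])
        (rule projection_in[OF DT_closed] p p' unitary_adj_in[OF DT_closed] u u')+
  next
    show "blin_on DT (\<lambda>d. P i (?s d))"
      by (rule blin_on_comp[OF unitary_adj_blin[OF DT_closed u] _ projection_blin[OF DT_closed p]])
        (rule unitary_adj_in[OF DT_closed u])
    show "blin_on DT (\<lambda>d. P' i (?s' d))"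
      by (rule blin_on_comp[OF unitary_adj_blin[OF DT_closed u'] _ projection_blin[OF DT_closed p']])
        (rule unitary_adj_in[OF DT_closed u'])
  qed
  have s: "?s d = ?s' d" if "d \<in> DT" for d
  proof (rule DT_eqI[OF _ _ _ that])
    fix h
    have "perp (P i) (?s (D h)) = perp (P' i) (?s' (D h))"
      using unfold(3)[OF data, of h] unfold(3)[OF data', of h] F[OF D_in, of "opprod n Ts h"] by simp
    then show "?s (D h) = ?s' (D h)" using F[OF D_in, of h] by (simp add: perp_def)
  qed (rule unitary_adj_blin[OF DT_closed u] unitary_adj_blin[OF DT_closed u'])+
  note Uin = unitary_in[OF DT_closed u x] unitary_in[OF DT_closed u' x]
  have Ueq: "U' i x = U i x"
  proof -
    have "U' i x = U i (?s (U' i x))" by (rule unitary_adj_right[OF DT_closed u Uin(2), symmetric])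
    also have "?s (U' i x) = x" using s[OF Uin(2)] unitary_adj_left[OF DT_closed u' x] by simp
    finally show ?thesis .
  qed
  have "P' i x = P' i (?s' (U i x))" using unitary_adj_left[OF DT_closed u' x] Ueq by simp
  also have "\<dots> = P i (?s (U i x))" using F[OF Uin(1)] by simp
  also have "\<dots> = P i x" using unitary_adj_left[OF DT_closed u x] by simp
  finally show ?thesis using Ueq by simp
qed

end

section \<open>The characterisation\<close>

theorem theorem3p9:
  fixes T :: "nat \<Rightarrow> 'h::chilbert_space \<Rightarrow> 'h" and n :: nat
  assumes "n \<ge> 1"
    and "\<forall>i\<in>{1..n}. contraction (T i)"
    and "commuting_on UNIV n T"
  shows "((\<exists>P U. defect_data n T P U) \<longrightarrow>
           (\<forall>(K :: 'k::chilbert_space set) J V0.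
              minimal_isometric_dilation (opprod n T) K J V0 \<longrightarrow>
              (\<exists>V. isometric_dilation n T K J V)))
       \<and> (\<forall>(K :: 'k set) J V.
            isometric_dilation n T K J V \<and>
            minimal_isometric_dilation (opprod n T) K J (opprod n V) \<longrightarrow>
            (\<exists>P U. defect_data n T P U \<and> product_normalised n T P U \<and>
               (\<forall>P' U'. defect_data n T P' U' \<and> product_normalised n T P' U' \<longrightarrow>
                  (\<forall>i\<in>{1..n}. \<forall>x\<in>defect_space (opprod n T). P' i x = P i x \<and> U' i x = U i x))))"
proof (intro conjI impI allI)
  have contr: "contraction (opprod n T)" by (rule contraction_opprod) (use assms in blast)
  {
    fix K :: "'k set" and J V0
    assume "\<exists>P U. defect_data n T P U"
    then obtain P U where data: "defect_data n T P U" by blast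
    assume min: "minimal_isometric_dilation (opprod n T) K J V0"
    interpret commuting_product n T K J V0
      using contr min assms by unfold_locales auto
    show "\<exists>V. isometric_dilation n T K J V" using dilation_of_defect_data[OF data] by blast
  next
    fix K :: "'k set" and J V
    assume V: "isometric_dilation n T K J V \<and> minimal_isometric_dilation (opprod n T) K J (opprod n V)"
    interpret dilation_tuple n T K J "opprod n V" V
      using contr V assms by unfold_locales auto
    obtain P U where PU: "defect_data n T P U" "product_normalised n T P U"
      and WJ: "\<And>i h. i \<in> {1..n} \<Longrightarrow> V i (J h) = J (T i h) + L (P i (adj_on DT (U i) (D h)))"
      using defect_data_of_dilation by blast
    then show "\<exists>P U. defect_data n T P U \<and> product_normalised n T P U \<and>
               (\<forall>P' U'. defect_data n T P' U' \<and> product_normalised n T P' U' \<longrightarrow>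
                  (\<forall>i\<in>{1..n}. \<forall>x\<in>DT. P' i x = P i x \<and> U' i x = U i x))"
      using defect_data_unique[OF PU(1) _ _ WJ] by blast
  }
qed

end
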